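(* Let $n\ge 4$ and let $Q$ be any Dynkin quiver of finite type $D_n$. Let $\gamma\in\Phi_n^+$ be a non-simple positive root. Then every pair $(\alpha,\beta)$ of $\gamma$ (so $\alpha+\beta=\gamma$) is minimal with respect to some (suitable, possibly depending on the pair) total order on $\Phi_n^+$ compatible with $\prec_Q$ if and only if $\gamma$ is multiplicity free.
   Context: Type $D_n$ and the AR-quiver. $\Delta_n$ ($n\ge4$) is the Dynkin diagram of type $D_n$ with vertex set $I_0=\{1,\dots,n\}$ and edges $i - (i+1)$ for $1\le i\le n-2$ and $(n-2) - n$. With $\varepsilon_1,\dots,\varepsilon_n$ orthonormal, $\alpha_i=\varepsilon_i-\varepsilon_{i+1}$ ($i\le n-1$), $\alpha_n=\varepsilon_{n-1}+\varepsilon_n$, and the set of positive roots is $\Phi_n^+=\{\varepsilon_a\pm\varepsilon_b : 1\le a<b\le n\}$. A Dynkin quiver $Q$ of type $D_n$ is an orientation of $\Delta_n$. Fix a height function $\xi:I_0\to\mathbb Z$, i.e. $\xi_j=\xi_i-1$ whenever $i\to j$ in $Q$. For $i\in I_0$ let $\eta_i=\sum_j\alpha_j$, the sum over all $j$ admitting a (possibly trivial) path from $j$ to $i$ in $Q$. Let $s_iQ$ be $Q$ with all arrows at $i$ reversed, and let $\tau=s_{i_1}\cdots s_{i_n}$ be the Coxeter element adapted to $Q$: $\{i_1,\dots,i_n\}=I_0$ and $i_k$ is a source of $s_{i_{k-1}}\cdots s_{i_1}Q$ for all $k$. Put $m_i=\max\{k\ge 0:\tau^k(\eta_i)\in\Phi_n^+\}$.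 The Auslander-Reiten quiver $\Gamma_Q$ has vertices $(i,\xi_i-2k)$ with $i\in I_0$, $0\le k\le m_i$, and arrows $(i,p)\to(j,p+1)$ for $i,j$ adjacent in $\Delta_n$. Its vertices are identified with $\Phi_n^+$ by the bijection $(i,\xi_i-2k)\leftrightarrow\tau^k(\eta_i)$. Order and pairs. For $\alpha\neq\beta\in\Phi_n^+$, $\alpha\prec_Q\beta$ iff there is a path from $\beta$ to $\alpha$ in $\Gamma_Q$. A total order $<$ on $\Phi_n^+$ is compatible with $\prec_Q$ if $\alpha\prec_Q\beta$ implies $\alpha<\beta$. A pair of $\gamma\in\Phi_n^+$ is $(\alpha,\beta)$ with $\alpha,\beta\in\Phi_n^+$, $\alpha+\beta=\gamma$ and $\alpha\prec_Q\beta$ (two positive roots whose sum is a root are always comparable for $\prec_Q$). It is minimal with respect to $<$ if there is no pair $(\alpha',\beta')$ with $\gamma=\alpha'+\beta'$ and $\alpha<\alpha'<\gamma<\beta'<\beta$. A positive root $\sum_i n_i\alpha_i$ is multiplicity free if $n_i\le1$ for all $i$.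
   Formalization: In the definition of the Auslander-Reiten quiver, m_i is taken as the largest k such that τ^0(η_i),…,τ^k(η_i) are all positive roots, because τ has finite order and the maximum of all k with τ^k(η_i) positive does not exist. *)

theory Defs
  imports Main "HOL-Library.Function_Algebras"
begin

text \<open>
  Vectors are coordinate functions with respect to the orthonormal vectors
  \<open>\<epsilon>\<^sub>1, \<dots>, \<epsilon>\<^sub>n\<close>; only the coordinates \<open>1, \<dots>, n\<close> are ever nonzero.
  Addition and subtraction of vectors are pointwise (\<^theory>\<open>HOL-Library.Function_Algebras\<close>).
\<close>

type_synonym vec = "nat \<Rightarrow> int"

definition eps :: "nat \<Rightarrow> vec" where
  "eps a = (\<lambda>x. if x = a then 1 else 0)"

definition inner_prod :: "nat \<Rightarrow> vec \<Rightarrow> vec \<Rightarrow> int" where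
  "inner_prod n u v = (\<Sum>x\<in>{1..n}. u x * v x)"

definition simple_root :: "nat \<Rightarrow> nat \<Rightarrow> vec" where
  "simple_root n i = (if i = n then eps (n - 1) + eps n else eps i - eps (i + 1))"

definition positive_roots :: "nat \<Rightarrow> vec set" where
  "positive_roots n =
     {eps a - eps b |a b. 1 \<le> a \<and> a < b \<and> b \<le> n} \<union>
     {eps a + eps b |a b. 1 \<le> a \<and> a < b \<and> b \<le> n}"

definition multiplicity_free :: "nat \<Rightarrow> vec \<Rightarrow> bool" where
  "multiplicity_free n \<gamma> \<longleftrightarrow>
     (\<exists>c :: nat \<Rightarrow> nat. \<gamma> = (\<lambda>x. \<Sum>i\<in>{1..n}. int (c i) * simple_root n i x) \<and>
        (\<forall>i\<in>{1..n}. c i \<le> 1))"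

text \<open>All simple roots have squared length 2, hence no denominator.\<close>

definition simple_reflection :: "nat \<Rightarrow> nat \<Rightarrow> vec \<Rightarrow> vec" where
  "simple_reflection n i v =
     (\<lambda>x. v x - inner_prod n v (simple_root n i) * simple_root n i x)"

definition diagram_edges :: "nat \<Rightarrow> (nat \<times> nat) set" where
  "diagram_edges n = {(i, i + 1) |i. 1 \<le> i \<and> i \<le> n - 2} \<union> {(n - 2, n)}"

definition adjacent :: "nat \<Rightarrow> nat \<Rightarrow> nat \<Rightarrow> bool" where
  "adjacent n i j \<longleftrightarrow> (i, j) \<in> diagram_edges n \<or> (j, i) \<in> diagram_edges n"

text \<open>A quiver is given by its set of arrows: \<open>(i, j) \<in> Q\<close> means \<open>i \<rightarrow> j\<close>.\<close>

type_synonym quiver = "(nat \<times> nat) set"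

definition dynkin_quiver :: "nat \<Rightarrow> quiver \<Rightarrow> bool" where
  "dynkin_quiver n Q \<longleftrightarrow>
     (\<forall>(i, j)\<in>Q. adjacent n i j) \<and>
     (\<forall>(i, j)\<in>diagram_edges n. ((i, j) \<in> Q) \<noteq> ((j, i) \<in> Q))"

definition height_function :: "quiver \<Rightarrow> (nat \<Rightarrow> int) \<Rightarrow> bool" where
  "height_function Q \<xi> \<longleftrightarrow> (\<forall>(i, j)\<in>Q. \<xi> j = \<xi> i - 1)"

definition eta :: "nat \<Rightarrow> quiver \<Rightarrow> nat \<Rightarrow> vec" where
  "eta n Q i = (\<Sum>j | j \<in> {1..n} \<and> (j, i) \<in> Q\<^sup>*. simple_root n j)"

definition reverse_at :: "nat \<Rightarrow> quiver \<Rightarrow> quiver" where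
  "reverse_at i Q = {(a, b). if a = i \<or> b = i then (b, a) \<in> Q else (a, b) \<in> Q}"

definition is_source :: "quiver \<Rightarrow> nat \<Rightarrow> bool" where
  "is_source Q i \<longleftrightarrow> (\<forall>j. (j, i) \<notin> Q)"

text \<open>
  For \<open>w = [i\<^sub>1, \<dots>, i\<^sub>n]\<close>, the quiver \<open>fold reverse_at (take k w) Q\<close>
  is \<open>s\<close> at \<open>i\<^sub>k\<close> after \dots after \<open>s\<close> at \<open>i\<^sub>1\<close>, applied to \<open>Q\<close>,
  and \<open>coxeter n w\<close> applies the reflection at \<open>i\<^sub>n\<close> first.
  The Coxeter element does not depend on the adapted word chosen to write it.
\<close>

definition adapted_word :: "nat \<Rightarrow> quiver \<Rightarrow> nat list \<Rightarrow> bool" where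
  "adapted_word n Q w \<longleftrightarrow> distinct w \<and> set w = {1..n} \<and>
     (\<forall>k < length w. is_source (fold reverse_at (take k w) Q) (w ! k))"

definition coxeter :: "nat \<Rightarrow> nat list \<Rightarrow> vec \<Rightarrow> vec" where
  "coxeter n w = foldr (simple_reflection n) w"

text \<open>
  As \<open>\<tau>\<close> has finite order, \<open>\<tau>\<^sup>k(\<eta>\<^sub>i)\<close> is again positive for
  infinitely many \<open>k\<close>. The maximum defining \<open>m\<^sub>i\<close> therefore refers to the
  initial run of positive roots.
\<close>

definition m_max :: "nat \<Rightarrow> quiver \<Rightarrow> nat list \<Rightarrow> nat \<Rightarrow> nat" where
  "m_max n Q w i =
     Max {k. \<forall>l\<le>k. (coxeter n w ^^ l) (eta n Q i) \<in> positive_roots n}"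

definition ar_vertices :: "nat \<Rightarrow> quiver \<Rightarrow> (nat \<Rightarrow> int) \<Rightarrow> nat list \<Rightarrow> (nat \<times> int) set" where
  "ar_vertices n Q \<xi> w = {(i, \<xi> i - 2 * int k) |i k. i \<in> {1..n} \<and> k \<le> m_max n Q w i}"

definition ar_arrows ::
  "nat \<Rightarrow> quiver \<Rightarrow> (nat \<Rightarrow> int) \<Rightarrow> nat list \<Rightarrow> ((nat \<times> int) \<times> (nat \<times> int)) set" where
  "ar_arrows n Q \<xi> w =
     {((i, p), (j, p + 1)) |i j p.
        (i, p) \<in> ar_vertices n Q \<xi> w \<and> (j, p + 1) \<in> ar_vertices n Q \<xi> w \<and> adjacent n i j}"

text \<open>The root at the vertex \<open>(i, \<xi>\<^sub>i - 2k)\<close> is \<open>\<tau>\<^sup>k(\<eta>\<^sub>i)\<close>.\<close>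

definition ar_root :: "nat \<Rightarrow> quiver \<Rightarrow> (nat \<Rightarrow> int) \<Rightarrow> nat list \<Rightarrow> nat \<times> int \<Rightarrow> vec" where
  "ar_root n Q \<xi> w = (\<lambda>(i, p). (coxeter n w ^^ nat ((\<xi> i - p) div 2)) (eta n Q i))"

definition prec :: "nat \<Rightarrow> quiver \<Rightarrow> (nat \<Rightarrow> int) \<Rightarrow> nat list \<Rightarrow> vec \<Rightarrow> vec \<Rightarrow> bool" where
  "prec n Q \<xi> w \<alpha> \<beta> \<longleftrightarrow> \<alpha> \<noteq> \<beta> \<and>
     (\<exists>u\<in>ar_vertices n Q \<xi> w. \<exists>v\<in>ar_vertices n Q \<xi> w.
        ar_root n Q \<xi> w u = \<alpha> \<and> ar_root n Q \<xi> w v = \<beta> \<and> (v, u) \<in> (ar_arrows n Q \<xi> w)\<^sup>*)"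

text \<open>Total orders are strict: \<open>(\<alpha>, \<beta>) \<in> r\<close> stands for \<open>\<alpha> < \<beta>\<close>.\<close>

definition compatible_order ::
  "nat \<Rightarrow> quiver \<Rightarrow> (nat \<Rightarrow> int) \<Rightarrow> nat list \<Rightarrow> vec rel \<Rightarrow> bool" where
  "compatible_order n Q \<xi> w r \<longleftrightarrow>
     r \<subseteq> positive_roots n \<times> positive_roots n \<and>
     strict_linear_order_on (positive_roots n) r \<and>
     (\<forall>\<alpha>\<in>positive_roots n. \<forall>\<beta>\<in>positive_roots n. prec n Q \<xi> w \<alpha> \<beta> \<longrightarrow> (\<alpha>, \<beta>) \<in> r)"

definition pair_of ::
  "nat \<Rightarrow> quiver \<Rightarrow> (nat \<Rightarrow> int) \<Rightarrow> nat list \<Rightarrow> vec \<Rightarrow> vec \<times> vec \<Rightarrow> bool" where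
  "pair_of n Q \<xi> w \<gamma> = (\<lambda>(\<alpha>, \<beta>).
     \<alpha> \<in> positive_roots n \<and> \<beta> \<in> positive_roots n \<and> \<alpha> + \<beta> = \<gamma> \<and> prec n Q \<xi> w \<alpha> \<beta>)"

definition minimal_pair ::
  "nat \<Rightarrow> quiver \<Rightarrow> (nat \<Rightarrow> int) \<Rightarrow> nat list \<Rightarrow> vec rel \<Rightarrow> vec \<Rightarrow> vec \<times> vec \<Rightarrow> bool" where
  "minimal_pair n Q \<xi> w r \<gamma> = (\<lambda>(\<alpha>, \<beta>).
     pair_of n Q \<xi> w \<gamma> (\<alpha>, \<beta>) \<and>
     \<not> (\<exists>\<alpha>' \<beta>'. pair_of n Q \<xi> w \<gamma> (\<alpha>', \<beta>') \<and>
          (\<alpha>, \<alpha>') \<in> r \<and> (\<alpha>', \<gamma>) \<in> r \<and> (\<gamma>, \<beta>') \<in> r \<and> (\<beta>', \<beta>) \<in> r))"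

end

theory Submission
  imports Defs
begin

text \<open>
  Write \<open>\<langle>x, y\<rangle>\<close> for the Euler form of \<open>Q\<close>, the bilinear form with
  \<open>\<langle>\<alpha>\<^sub>i, \<alpha>\<^sub>i\<rangle> = 1\<close>, \<open>\<langle>\<alpha>\<^sub>i, \<alpha>\<^sub>j\<rangle> = -1\<close> for an arrow \<open>i \<rightarrow> j\<close>, and
  \<open>\<langle>\<alpha>\<^sub>i, \<alpha>\<^sub>j\<rangle> = 0\<close> otherwise. The proof has two halves.

  The first half eliminates the Auslander-Reiten quiver: \<open>\<alpha> \<prec> \<beta>\<close> holds iff \<open>\<alpha>\<close> can be
  reached from \<open>\<beta>\<close> by steps \<open>x, y\<close> between positive roots with \<open>\<langle>x, y\<rangle> > 0\<close>
  (lemma \<open>prec_iff\<close>). Along an arrow the form is positive. Conversely, if the form is positive on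
  the roots of two vertices, the mesh relation at the first vertex passes this positivity to the
  target of some arrow leaving it, and iterating leads to the second vertex (\<open>path_if_hom\<close>). This uses
  \<open>\<langle>y, \<tau>x\<rangle> = - \<langle>x, y\<rangle>\<close> and the fact that \<open>\<langle>y, \<eta>\<^sub>i\<rangle>\<close> is the coefficient of \<open>\<alpha>\<^sub>i\<close> in \<open>y\<close>.

  The second half computes in the coordinates \<open>\<epsilon>\<^sub>a\<close>. There is one index \<open>f \<in> {n - 1, n}\<close> whose
  coordinate vector is orthogonal, for the Euler form, to all the others, and for the remaining indices
  \<open>2 \<langle>\<epsilon>\<^sub>a, \<epsilon>\<^sub>b\<rangle>\<close> is \<open>1\<close> or \<open>-1\<close> according to the order of two integers,
  the times of \<open>a\<close> and \<open>b\<close>. Imagine a vector \<open>e(t)\<close> at every integer \<open>t\<close> with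
  \<open>e(t + H) = - e(t)\<close> and with \<open>\<epsilon>\<^sub>a\<close> at its time. A root without \<open>\<epsilon>\<^sub>f\<close> is
  \<open>e(u) - e(l)\<close> with \<open>l < u < l + H\<close>; a root \<open>e(u) \<plusminus> \<epsilon>\<^sub>f\<close> gets \<open>l = u - H\<close>.
  Along \<open>\<langle>x, y\<rangle> > 0\<close> both \<open>u\<close> and \<open>l\<close> weakly increase (\<open>index_coords_mono\<close>). Hence sorting the
  positive roots by decreasing \<open>(u, l)\<close>, lexicographically, is a compatible order, and so is sorting
  by decreasing \<open>(l, u)\<close>.

  If \<open>\<gamma>\<close> is multiplicity free, its support is a tree and a pair of \<open>\<gamma>\<close> cuts it into two
  parts. A pair whose smaller part contains the leading vector \<open>\<epsilon>\<^sub>a\<close> of \<open>\<gamma>\<close> is minimal for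
  the order by \<open>(u, l)\<close>, any other pair is minimal for the order by \<open>(l, u)\<close>, if ties
  between roots with equal coordinates are broken suitably
  (\<open>minimal_order\<close>). If \<open>\<gamma>\<close> is not multiplicity free, then
  \<open>\<gamma> = \<epsilon>\<^sub>a + \<epsilon>\<^sub>b\<close> with \<open>a < b \<le> n - 2\<close>. Let \<open>m \<noteq> f\<close> be the other element of
  \<open>{n - 1, n}\<close>; its time precedes or follows both the times of \<open>a\<close> and \<open>b\<close>. For a suitable sign
  \<open>t\<close> and with \<open>{l, h} = {a, b}\<close> ordered by time,
  \<open>\<epsilon>\<^sub>h - t\<epsilon>\<^sub>m \<prec> \<epsilon>\<^sub>l - t\<epsilon>\<^sub>m \<prec> \<gamma> \<prec> \<epsilon>\<^sub>h + t\<epsilon>\<^sub>m \<prec> \<epsilon>\<^sub>l + t\<epsilon>\<^sub>m\<close>,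
  so the outer pair is not minimal for any compatible order (\<open>crossing_pairs\<close>).
\<close>

section \<open>The Euler form in orthonormal coordinates\<close>

locale dquiver =
  fixes n :: nat and Q :: quiver
  assumes n4: "n \<ge> 4" and dynkin: "dynkin_quiver n Q"
begin

text \<open>
  The diagram is treated as a tree with root \<open>1\<close>.
\<close>
definition parent :: "nat \<Rightarrow> nat" where
  "parent b = (if b = n then n - 2 else b - 1)"

text \<open>
  The Coxeter element sends one of the vectors \<open>\<epsilon>\<^sub>n\<close>, \<open>\<epsilon>\<^sub>n\<^sub>-\<^sub>1\<close> to its negative and permutes
  the others up to sign: \<open>\<epsilon>\<^sub>n\<close> if the edges at \<open>n - 1\<close> and \<open>n\<close> both point towards or both away
  from \<open>n - 2\<close>, and \<open>\<epsilon>\<^sub>n\<^sub>-\<^sub>1\<close> otherwise. The roots involving this vector occupy the rows \<open>n -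
  1\<close> and \<open>n\<close> of the Auslander-Reiten quiver.
\<close>
definition spin :: nat where
  "spin = (if ((n - 2, n - 1) \<in> Q) = ((n - 2, n) \<in> Q) then n else n - 1)"

text \<open>
  The vertex \<open>1\<close> has no parent; either sign would do there.
\<close>
definition orient :: "nat \<Rightarrow> int" where
  "orient b = (if b = 1 \<or> (parent b, b) \<in> Q then 1 else - 1)"

text \<open>
  The index \<open>b\<close> is later than all smaller indices if the edge to its parent points away from
  \<open>b\<close>, and earlier than all of them if it points to \<open>b\<close>. Only the order of the times matters,
  so \<open>b\<close> itself can serve as their size.
\<close>
definition time :: "nat \<Rightarrow> int" where
  "time b = - orient b * int b"

definition euler2_eps :: "nat \<Rightarrow> nat \<Rightarrow> int" where
  "euler2_eps a b = (if a = b then 1 else if a = spin \<or> b = spin then 0 else if time a < time b then 1 else - 1)"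

text \<open>
  Twice the Euler form: the factor makes the values at the vectors \<open>\<epsilon>\<^sub>a\<close> integral.
\<close>
definition euler2 :: "vec \<Rightarrow> vec \<Rightarrow> int" where
  "euler2 x y = (\<Sum>a\<in>{1..n}. \<Sum>b\<in>{1..n}. x a * y b * euler2_eps a b)"

abbreviation \<alpha> :: "nat \<Rightarrow> vec" where "\<alpha> \<equiv> simple_root n"
abbreviation Pos :: "vec set" where "Pos \<equiv> positive_roots n"

lemma edge_iff: "(i, j) \<in> diagram_edges n \<longleftrightarrow> 2 \<le> j \<and> j \<le> n \<and> i = parent j"
  using n4 unfolding diagram_edges_def parent_def by auto

lemma adjacent_iff:
  "adjacent n i j \<longleftrightarrow> 2 \<le> j \<and> j \<le> n \<and> i = parent j \<or> 2 \<le> i \<and> i \<le> n \<and> j = parent i"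
  unfolding adjacent_def edge_iff ..

lemma arrow_cases:
  assumes "(i, j) \<in> Q"
  shows "2 \<le> j \<and> j \<le> n \<and> i = parent j \<or> 2 \<le> i \<and> i \<le> n \<and> j = parent i"
  using assms dynkin unfolding dynkin_quiver_def adjacent_iff by blast

lemma arrow_adjacent: "(i, j) \<in> Q \<Longrightarrow> adjacent n i j"
  using arrow_cases adjacent_iff by blast

lemma one_orientation: "2 \<le> b \<Longrightarrow> b \<le> n \<Longrightarrow> ((parent b, b) \<in> Q) \<noteq> ((b, parent b) \<in> Q)"
  using dynkin edge_iff[of "parent b" b] unfolding dynkin_quiver_def by blast

lemma parent_bounds: "2 \<le> b \<Longrightarrow> b \<le> n \<Longrightarrow> 1 \<le> parent b \<and> parent b < b"
  using n4 unfolding parent_def by auto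

lemma arrow_range: assumes "(i, j) \<in> Q" shows "i \<in> {1..n}" "j \<in> {1..n}" "i \<noteq> j"
  using arrow_cases[OF assms] parent_bounds by fastforce+

lemma spin_cases: "spin = n \<or> spin = n - 1" unfolding spin_def by auto

lemma orient_cases: "orient b = 1 \<or> orient b = - 1" unfolding orient_def by auto

lemma orient_spin: "spin = n \<Longrightarrow> orient n = orient (n - 1)" "spin = n - 1 \<Longrightarrow> orient n = - orient (n - 1)"
proof -
  have "parent n = n - 2" "parent (n - 1) = n - 2" "n \<noteq> 1" "n - 1 \<noteq> 1" "n - 1 \<noteq> n"
    using n4 unfolding parent_def by auto
  then show "spin = n \<Longrightarrow> orient n = orient (n - 1)" "spin = n - 1 \<Longrightarrow> orient n = - orient (n - 1)"
    unfolding spin_def orient_def by (simp_all split: if_splits)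
qed

lemma time_abs: "\<bar>time b\<bar> = int b"
  using orient_cases[of b] unfolding time_def by auto

lemma euler2_eps_upward: "a < b \<Longrightarrow> a \<noteq> spin \<Longrightarrow> b \<noteq> spin \<Longrightarrow> euler2_eps a b = - orient b"
  using orient_cases[of b] orient_cases[of a] unfolding euler2_eps_def time_def by auto

lemma euler2_eps_downward: "a < b \<Longrightarrow> a \<noteq> spin \<Longrightarrow> b \<noteq> spin \<Longrightarrow> euler2_eps b a = orient b"
  using orient_cases[of b] orient_cases[of a] unfolding euler2_eps_def time_def by auto

lemma euler2_eps_less:
  assumes "a < b"
  shows "euler2_eps a b = (if a = spin \<or> b = spin then 0 else - orient b)"
    and "euler2_eps b a = (if a = spin \<or> b = spin then 0 else orient b)"
  using assms euler2_eps_upward[OF assms] euler2_eps_downward[OF assms] unfolding euler2_eps_def by auto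

lemma euler2_eps_same [simp]: "euler2_eps a a = 1" unfolding euler2_eps_def by simp

lemma euler2_eps_sym: "euler2_eps a b + euler2_eps b a = (if a = b then 2 else 0)"
proof -
  have "a = b \<or> time a \<noteq> time b" using time_abs[of a] time_abs[of b] by (metis of_nat_eq_iff)
  then show ?thesis unfolding euler2_eps_def by auto
qed

text \<open>
  Whichever of the two indices \<open>n - 1\<close> and \<open>n\<close> is the distinguished one, the edge from \<open>n - 2\<close>
  to the other one determines these combinations; this makes the case distinction on \<open>spin\<close>
  disappear from the computation of the form at the simple roots.
\<close>
lemma euler2_eps_branch:
  "euler2_eps (n - 2) (n - 1) - euler2_eps (n - 2) n = - orient (n - 1)"
  "euler2_eps (n - 1) (n - 2) - euler2_eps n (n - 2) = orient (n - 1)"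
  "euler2_eps (n - 2) (n - 1) + euler2_eps (n - 2) n = - orient n"
  "euler2_eps (n - 1) (n - 2) + euler2_eps n (n - 2) = orient n"
proof -
  have lt: "n - 2 < n - 1" "n - 2 < n" using n4 by auto
  have ns: "(n - 2 = spin) = False" "(n - 1 = spin) = (spin \<noteq> n)" "(n = spin) = (spin = n)"
    using spin_cases n4 by auto
  have sn: "spin \<noteq> n \<Longrightarrow> orient n = - orient (n - 1)" using spin_cases orient_spin by blast
  note v = euler2_eps_less[OF lt(1)] euler2_eps_less[OF lt(2)]
  show "euler2_eps (n - 2) (n - 1) - euler2_eps (n - 2) n = - orient (n - 1)"
    "euler2_eps (n - 1) (n - 2) - euler2_eps n (n - 2) = orient (n - 1)"
    "euler2_eps (n - 2) (n - 1) + euler2_eps (n - 2) n = - orient n"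
    "euler2_eps (n - 1) (n - 2) + euler2_eps n (n - 2) = orient n"
    unfolding v ns using orient_spin(1) sn by (cases "spin = n"; simp)+
qed

lemma euler2_add_left: "euler2 (x + y) z = euler2 x z + euler2 y z"
  unfolding euler2_def by (simp add: algebra_simps sum.distrib)

lemma euler2_add_right: "euler2 z (x + y) = euler2 z x + euler2 z y"
  unfolding euler2_def by (simp add: algebra_simps sum.distrib)

lemma euler2_diff_left: "euler2 (x - y) z = euler2 x z - euler2 y z"
  unfolding euler2_def by (simp add: algebra_simps sum_subtractf)

lemma euler2_diff_right: "euler2 z (x - y) = euler2 z x - euler2 z y"
  unfolding euler2_def by (simp add: algebra_simps sum_subtractf)

lemma euler2_zero_left [simp]: "euler2 0 z = 0" unfolding euler2_def by simp

lemma euler2_zero_right [simp]: "euler2 z 0 = 0" unfolding euler2_def by simp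

lemma euler2_minus_left [simp]: "euler2 (- x) z = - euler2 x z" using euler2_diff_left[of 0 x z] by simp

lemma euler2_minus_right [simp]: "euler2 z (- x) = - euler2 z x" using euler2_diff_right[of z 0 x] by simp

lemma euler2_scale_left: "euler2 (\<lambda>a. c * x a) z = c * euler2 x z"
  unfolding euler2_def by (simp add: sum_distrib_left mult.assoc)

lemma euler2_scale_right: "euler2 z (\<lambda>a. c * x a) = c * euler2 z x"
  unfolding euler2_def by (simp add: sum_distrib_left algebra_simps)

lemma euler2_sum_left: fixes h :: "'b \<Rightarrow> vec" shows "euler2 (sum h A) z = (\<Sum>i\<in>A. euler2 (h i) z)"
  by (induction A rule: infinite_finite_induct) (auto simp: euler2_add_left simp del: plus_fun_apply zero_fun_apply)

lemma euler2_sum_right: fixes h :: "'b \<Rightarrow> vec" shows "euler2 z (sum h A) = (\<Sum>i\<in>A. euler2 z (h i))"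
  by (induction A rule: infinite_finite_induct) (auto simp: euler2_add_right simp del: plus_fun_apply zero_fun_apply)

lemma euler2_of_eps: assumes "a \<in> {1..n}" "b \<in> {1..n}" shows "euler2 (eps a) (eps b) = euler2_eps a b"
proof -
  have "euler2 (eps a) (eps b) = (\<Sum>x\<in>{1..n}. if x = a then (\<Sum>y\<in>{1..n}. if y = b then euler2_eps x y else 0) else 0)"
    unfolding euler2_def eps_def by (intro sum.cong refl) (simp add: if_distrib[where f = "\<lambda>u. u * v" for v] cong: if_cong)
  then show ?thesis using assms by simp
qed

lemma euler2_sym: "euler2 x y + euler2 y x = 2 * inner_prod n x y"
proof -
  have "euler2 y x = (\<Sum>a\<in>{1..n}. \<Sum>b\<in>{1..n}. x a * y b * euler2_eps b a)"
    unfolding euler2_def by (subst sum.swap) (simp add: algebra_simps)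
  then have "euler2 x y + euler2 y x = (\<Sum>a\<in>{1..n}. \<Sum>b\<in>{1..n}. x a * y b * (euler2_eps a b + euler2_eps b a))"
    unfolding euler2_def by (simp add: sum.distrib algebra_simps)
  also have "\<dots> = (\<Sum>a\<in>{1..n}. \<Sum>b\<in>{1..n}. if a = b then 2 * (x a * y b) else 0)"
    by (intro sum.cong refl) (auto simp: euler2_eps_sym)
  also have "\<dots> = 2 * inner_prod n x y"
    unfolding inner_prod_def sum_distrib_left by (intro sum.cong refl) simp
  finally show ?thesis .
qed

lemma euler2_simple_expand: assumes "i \<in> {1..n}" "j \<in> {1..n}"
  shows "euler2 (\<alpha> i) (\<alpha> j) = 
     (if i = n then if j = n then euler2_eps (n-1) (n-1) + euler2_eps (n-1) n + euler2_eps n (n-1) + euler2_eps n n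
         else euler2_eps (n-1) j - euler2_eps (n-1) (j+1) + euler2_eps n j - euler2_eps n (j+1)
      else if j = n then euler2_eps i (n-1) + euler2_eps i n - euler2_eps (i+1) (n-1) - euler2_eps (i+1) n
      else euler2_eps i j - euler2_eps i (j+1) - euler2_eps (i+1) j + euler2_eps (i+1) (j+1))"
  using assms n4 by (auto simp: simple_root_def euler2_add_left euler2_add_right euler2_diff_left euler2_diff_right euler2_of_eps)

lemma euler2_simple_sym: assumes "i \<in> {1..n}" "j \<in> {1..n}" "i < j"
  shows "euler2 (\<alpha> i) (\<alpha> j) + euler2 (\<alpha> j) (\<alpha> i) = (if i = parent j then - 2 else 0)"
proof -
  have j: "(j = n) \<or> (j \<noteq> n \<and> i \<noteq> n)" and i: "i \<noteq> n" using assms by auto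
  show ?thesis
  proof (cases "j = n")
    case True
    have "euler2 (\<alpha> i) (\<alpha> j) + euler2 (\<alpha> j) (\<alpha> i) = (euler2_eps i (n-1) + euler2_eps (n-1) i) + (euler2_eps i n + euler2_eps n i)
       - (euler2_eps (i+1) (n-1) + euler2_eps (n-1) (i+1)) - (euler2_eps (i+1) n + euler2_eps n (i+1))"
      using i True unfolding euler2_simple_expand[OF assms(1,2)] euler2_simple_expand[OF assms(2,1)] by simp
    then show ?thesis unfolding euler2_eps_sym parent_def using True assms n4 by auto
  next
    case False
    have "euler2 (\<alpha> i) (\<alpha> j) + euler2 (\<alpha> j) (\<alpha> i) = (euler2_eps i j + euler2_eps j i) + (euler2_eps (i+1) (j+1) + euler2_eps (j+1) (i+1))
       - (euler2_eps (i+1) j + euler2_eps j (i+1)) - (euler2_eps i (j+1) + euler2_eps (j+1) i)"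
      using i False unfolding euler2_simple_expand[OF assms(1,2)] euler2_simple_expand[OF assms(2,1)] by simp
    then show ?thesis unfolding euler2_eps_sym parent_def using False assms n4 by auto
  qed
qed

lemma euler2_simple_less: assumes "i \<in> {1..n}" "j \<in> {1..n}" "i < j"
  shows "euler2 (\<alpha> i) (\<alpha> j) = (if (i, j) \<in> Q then - 2 else 0)"
proof -
  note ex = euler2_simple_expand[OF assms(1,2)]
  have ar: "(i, j) \<in> Q \<Longrightarrow> 2 \<le> j \<and> j \<le> n \<and> i = parent j \<or> 2 \<le> i \<and> i \<le> n \<and> j = parent i" by (rule arrow_cases)
  have zz: "euler2_eps (n - 1) n = 0" "euler2_eps n (n - 1) = 0"
    using euler2_eps_less[of "n - 1" n] spin_cases n4 by auto
  consider "i \<noteq> parent j" | "i = parent j" by blast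
  then show ?thesis
  proof cases
    case 1
    then have nQ: "(i, j) \<notin> Q" using ar assms parent_bounds[of i] by auto
    have "i = n - 1 \<and> j = n \<or> i + 1 < n - 1 \<and> j = n \<or> i + 1 < j \<and> j < n"
      using 1 assms n4 unfolding parent_def atLeastAtMost_iff by presburger
    then consider "i = n - 1" "j = n" | "i + 1 < n - 1" "j = n" | "i + 1 < j" "j < n" by blast
    then show ?thesis
    proof cases
      case 1
      have z: "euler2_eps (n - 1) n = 0" "euler2_eps n (n - 1) = 0"
        using euler2_eps_less[of "n - 1" n] spin_cases n4 by auto
      have "euler2 (\<alpha> i) (\<alpha> j) = 0" unfolding ex using 1 z n4 by simp
      then show ?thesis using nQ 1 n4 by simp
    next
      case 2
      have "euler2_eps i (n - 1) = euler2_eps (i + 1) (n - 1)" "euler2_eps (n - 1) i = euler2_eps (n - 1) (i + 1)"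
        "euler2_eps i n = euler2_eps (i + 1) n" "euler2_eps n i = euler2_eps n (i + 1)"
        using 2 spin_cases n4 by (simp_all add: euler2_eps_less) linarith+
      then have "euler2 (\<alpha> i) (\<alpha> j) = 0" unfolding ex using 2 n4 by auto
      then show ?thesis using nQ 2 by auto
    next
      case 3
      have "euler2_eps i j = euler2_eps (i + 1) j" "euler2_eps j i = euler2_eps j (i + 1)"
        "euler2_eps i (j + 1) = euler2_eps (i + 1) (j + 1)" "euler2_eps (j + 1) i = euler2_eps (j + 1) (i + 1)"
        using 3 spin_cases n4 by (simp_all add: euler2_eps_less) linarith+
      then have "euler2 (\<alpha> i) (\<alpha> j) = 0" unfolding ex using 3 n4 by auto
      then show ?thesis using nQ 3 by auto
    qed
  next
    case 2
    have sgb: "orient j = (if (i, j) \<in> Q then 1 else - 1)" using 2 assms unfolding orient_def by auto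
    have "j = i + 1 \<and> j < n - 1 \<or> i = n - 2 \<and> j = n - 1 \<or> i = n - 2 \<and> j = n"
      using 2 assms n4 unfolding parent_def atLeastAtMost_iff by presburger
    then have "euler2 (\<alpha> i) (\<alpha> j) = - 1 - orient j"
    proof (elim disjE conjE)
      assume h: "j = i + 1" "j < n - 1"
      have "euler2_eps i (j + 1) = euler2_eps j (j + 1)" "euler2_eps (j + 1) i = euler2_eps (j + 1) j"
        "euler2_eps i j = - orient j" "euler2_eps j i = orient j"
        using h spin_cases n4 by (simp_all add: euler2_eps_less) linarith+
      then show ?thesis unfolding ex using h by auto
    next
      assume h: "i = n - 2" "j = n - 1"
      have "euler2_eps (n - 2) (n - 1) - euler2_eps (n - 2) n = - orient (n - 1)" "euler2_eps (n - 1) (n - 2) - euler2_eps n (n - 2) = orient (n - 1)"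
        by (rule euler2_eps_branch)+
      moreover have "n - 2 + 1 = n - 1" "n - 1 + 1 = n" "n - 2 \<noteq> n" "n - 1 \<noteq> n" using n4 by auto
      ultimately show ?thesis unfolding ex unfolding h using zz by simp
    next
      assume h: "i = n - 2" "j = n"
      have "euler2_eps (n - 2) (n - 1) + euler2_eps (n - 2) n = - orient n" "euler2_eps (n - 1) (n - 2) + euler2_eps n (n - 2) = orient n"
        by (rule euler2_eps_branch)+
      moreover have "n - 2 + 1 = n - 1" "n - 2 \<noteq> n" using n4 by auto
      ultimately show ?thesis unfolding ex unfolding h using zz by simp
    qed
    then show ?thesis using sgb 2 assms by auto
  qed
qed

text \<open>
  The form defined by the times is indeed the Euler form: this is where the choice of \<open>time\<close>
  and \<open>spin\<close> is justified.
\<close>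
lemma euler2_simple: assumes "i \<in> {1..n}" "j \<in> {1..n}"
  shows "euler2 (\<alpha> i) (\<alpha> j) = (if i = j then 2 else if (i, j) \<in> Q then - 2 else 0)"
proof -
  consider "i = j" | "i < j" | "j < i" by linarith
  then show ?thesis
  proof cases
    case 1
    then show ?thesis using euler2_simple_expand[OF assms] euler2_eps_sym[of "n-1" n] euler2_eps_sym[of i "i+1"] n4 by auto
  next
    case 2
    then show ?thesis using euler2_simple_less assms by auto
  next
    case 3
    have a: "(i, j) \<in> Q \<longleftrightarrow> j = parent i \<and> (j, i) \<notin> Q" and b: "(j, i) \<in> Q \<Longrightarrow> j = parent i"
      using 3 assms arrow_cases[of i j] arrow_cases[of j i] one_orientation[of i] parent_bounds[of j] by auto
    show ?thesis
    proof (cases "(j, i) \<in> Q")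
      case True
      then show ?thesis using 3 a b euler2_simple_sym[OF assms(2,1) 3] euler2_simple_less[OF assms(2,1) 3] by simp
    next
      case False
      then show ?thesis using 3 a euler2_simple_sym[OF assms(2,1) 3] euler2_simple_less[OF assms(2,1) 3] by simp
    qed
  qed
qed

end

section \<open>Roots and simple reflections\<close>

text \<open>
  Sums of vectors stay unevaluated, except where a proof computes with coordinates.
\<close>
declare plus_fun_apply [simp del] zero_fun_apply [simp del] minus_apply [simp del] uminus_apply [simp del]

lemmas vec_apply = plus_fun_apply zero_fun_apply minus_apply uminus_apply

context dquiver
begin

definition pm_root :: "nat \<Rightarrow> nat \<Rightarrow> int \<Rightarrow> vec" where
  "pm_root a b s = eps a + (\<lambda>x. s * eps b x)"

lemma pm_root_apply: "pm_root a b s x = (if x = a then 1 else 0) + s * (if x = b then 1 else 0)"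
  unfolding pm_root_def eps_def by (simp add: vec_apply)

lemma Pos_iff:
  "v \<in> Pos \<longleftrightarrow> (\<exists>a b s. 1 \<le> a \<and> a < b \<and> b \<le> n \<and> (s = 1 \<or> s = - 1) \<and> v = pm_root a b s)"
proof -
  have "pm_root a b 1 = eps a + eps b" "pm_root a b (- 1) = eps a - eps b" for a b
    by (auto simp: pm_root_def fun_eq_iff vec_apply)
  then show ?thesis unfolding positive_roots_def by (auto; metis)
qed

lemma PosI: "1 \<le> a \<Longrightarrow> a < b \<Longrightarrow> b \<le> n \<Longrightarrow> s = 1 \<or> s = - 1 \<Longrightarrow> pm_root a b s \<in> Pos"
  unfolding Pos_iff by blast

lemma euler2_pm_root:
  assumes "a \<in> {1..n}" "b \<in> {1..n}" "c \<in> {1..n}" "d \<in> {1..n}"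
  shows "euler2 (pm_root a b s) (pm_root c d t) = euler2_eps a c + t * euler2_eps a d + s * euler2_eps b c + s * t * euler2_eps b d"
  unfolding pm_root_def using assms
  by (simp add: euler2_add_left euler2_add_right euler2_scale_left euler2_scale_right euler2_of_eps algebra_simps)

lemma simple_pm_root: "i < n \<Longrightarrow> \<alpha> i = pm_root i (i + 1) (- 1)" "\<alpha> n = pm_root (n - 1) n 1"
  unfolding simple_root_def pm_root_def by (auto simp: fun_eq_iff vec_apply)

lemma simple_Pos: "i \<in> {1..n} \<Longrightarrow> \<alpha> i \<in> Pos"
  using simple_pm_root n4 by (cases "i = n") (auto intro: PosI)

lemma Pos_outside: "v \<in> Pos \<Longrightarrow> x \<notin> {1..n} \<Longrightarrow> v x = 0"
  unfolding Pos_iff by (auto simp: pm_root_apply)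

lemma finite_Pos: "finite Pos"
proof -
  have "Pos \<subseteq> (\<lambda>(a, b, s). pm_root a b s) ` ({1..n} \<times> {1..n} \<times> {1, - 1})"
  proof
    fix v assume "v \<in> Pos"
    then obtain a b s where "1 \<le> a" "a < b" "b \<le> n" "s = 1 \<or> s = - 1" "v = pm_root a b s"
      unfolding Pos_iff by blast
    then show "v \<in> (\<lambda>(a, b, s). pm_root a b s) ` ({1..n} \<times> {1..n} \<times> {1, - 1})"
      by (intro image_eqI[where x = "(a, b, s)"]) auto
  qed
  then show ?thesis by (rule finite_subset) auto
qed

text \<open>
  Positive roots are obtained from the simple roots by addition: \<open>\<epsilon>\<^sub>a - \<epsilon>\<^sub>b\<close> by increasing
  \<open>b\<close>, then \<open>\<epsilon>\<^sub>a + \<epsilon>\<^sub>b\<close> by decreasing \<open>b\<close> from \<open>n\<close>. This replaces the expansion into simple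
  roots.
\<close>
lemma Pos_induct [consumes 1, case_names simple add]:
  assumes "y \<in> Pos" "\<And>i. i \<in> {1..n} \<Longrightarrow> P (\<alpha> i)" "\<And>u v. P u \<Longrightarrow> P v \<Longrightarrow> P (u + v)"
  shows "P y"
proof -
  obtain a b s where ab: "1 \<le> a" "a < b" "b \<le> n" "s = 1 \<or> s = - 1" "y = pm_root a b s"
    using assms(1) unfolding Pos_iff by blast
  have m: "P (pm_root a b (- 1))" if "1 \<le> a" "Suc a \<le> b" "b \<le> n" for a b
    using that(2,3)
  proof (induction b rule: dec_induct)
    case base
    then show ?case using assms(2)[of a] simple_pm_root(1)[of a] that by auto
  next
    case (step b)
    have b: "b \<in> {1..n}" "b < n" using step that by auto
    have "pm_root a (Suc b) (- 1) = pm_root a b (- 1) + \<alpha> b"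
      using step by (simp add: simple_pm_root) (auto simp: fun_eq_iff vec_apply pm_root_apply)
    then show ?case using step b that assms(2)[of b] assms(3) by simp
  qed
  have p: "P (pm_root a n 1)" if "1 \<le> a" "a < n" for a
  proof (cases "a = n - 1")
    case True
    then show ?thesis using assms(2)[of n] simple_pm_root(2) n4 by auto
  next
    case False
    have "pm_root a n 1 = pm_root a (n - 1) (- 1) + \<alpha> n"
      unfolding simple_pm_root by (auto simp: fun_eq_iff vec_apply pm_root_apply)
    then show ?thesis using m[of a "n - 1"] that False assms(2)[of n] assms(3) n4 by auto
  qed
  have "P (pm_root a b 1)"
    using ab(3,2)
  proof (induction rule: inc_induct)
    case base
    then show ?case using p ab by auto
  next
    case (step b)
    have "pm_root a b 1 = pm_root a (Suc b) 1 + \<alpha> b"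
      using step by (simp add: simple_pm_root) (auto simp: fun_eq_iff vec_apply pm_root_apply)
    then show ?case using step ab assms(2)[of b] assms(3) by auto
  qed
  then show ?thesis using ab m[of a b] by auto
qed

abbreviation srefl :: "nat \<Rightarrow> vec \<Rightarrow> vec" where "srefl \<equiv> simple_reflection n"
abbreviation srefls :: "nat list \<Rightarrow> vec \<Rightarrow> vec" where "srefls \<equiv> foldr (simple_reflection n)"

lemma srefl_alt: "srefl i v = v - (\<lambda>x. inner_prod n v (\<alpha> i) * \<alpha> i x)"
  unfolding simple_reflection_def by (auto simp: fun_eq_iff vec_apply)

lemma inner_add: "inner_prod n (u + v) z = inner_prod n u z + inner_prod n v z"
  unfolding inner_prod_def by (simp add: algebra_simps sum.distrib vec_apply)

lemma inner_minus: "inner_prod n (- u) z = - inner_prod n u z"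
  unfolding inner_prod_def by (simp add: sum_negf vec_apply)

lemma inner_simple_self: "i \<in> {1..n} \<Longrightarrow> inner_prod n (\<alpha> i) (\<alpha> i) = 2"
  using euler2_sym[of "\<alpha> i" "\<alpha> i"] euler2_simple[of i i] by simp

lemma srefl_add: "srefl i (u + v) = srefl i u + srefl i v"
  unfolding simple_reflection_def inner_add by (simp add: fun_eq_iff vec_apply algebra_simps)

lemma srefl_minus: "srefl i (- u) = - srefl i u"
  unfolding simple_reflection_def inner_minus by (simp add: fun_eq_iff vec_apply algebra_simps)

lemma srefls_add: "srefls us (u + v) = srefls us u + srefls us v"
  by (induction us) (auto simp: srefl_add)

lemma srefls_minus: "srefls us (- u) = - srefls us u"
  by (induction us) (auto simp: srefl_minus)

lemma srefl_simple: "i \<in> {1..n} \<Longrightarrow> srefl i (\<alpha> i) = - \<alpha> i"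
  unfolding simple_reflection_def inner_simple_self by (simp add: fun_eq_iff vec_apply inner_simple_self)

lemma srefl_srefl: assumes "i \<in> {1..n}" shows "srefl i (srefl i v) = v"
proof -
  define c where "c = inner_prod n v (\<alpha> i)"
  have "inner_prod n (srefl i v) (\<alpha> i) = c - c * inner_prod n (\<alpha> i) (\<alpha> i)"
    unfolding simple_reflection_def inner_prod_def c_def
    by (simp add: algebra_simps sum_subtractf sum_distrib_left)
  then show ?thesis unfolding simple_reflection_def[of n i "srefl i v"]
    unfolding simple_reflection_def inner_simple_self[OF assms] c_def by (simp add: fun_eq_iff vec_apply algebra_simps)
qed

lemma inj_srefls: "set us \<subseteq> {1..n} \<Longrightarrow> inj (srefls us)"
proof (induction us)
  case (Cons i us)
  have "inj (srefl i)" by (rule inj_on_inverseI[where g = "srefl i"]) (use Cons srefl_srefl in auto)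
  then show ?case using Cons inj_compose[of "srefl i" "srefls us"] by (simp add: comp_def)
qed (simp add: inj_def)

lemma srefl_eq: assumes "i \<in> {1..n}"
  shows "srefl i v = (if i = n then (\<lambda>x. if x = n - 1 then - v n else if x = n then - v (n - 1) else v x)
     else (\<lambda>x. v (if x = i then i + 1 else if x = i + 1 then i else x)))"
proof (cases "i = n")
  case True
  have "inner_prod n v (\<alpha> n) = (\<Sum>x\<in>{1..n}. (if x = n - 1 then v x else 0) + (if x = n then v x else 0))"
    unfolding inner_prod_def simple_pm_root by (intro sum.cong refl) (use n4 in \<open>auto simp: pm_root_apply\<close>)
  also have "\<dots> = v (n - 1) + v n"
  proof -
    have "n - 1 \<in> {1..n}" "n \<in> {1..n}" using n4 by auto
    then show ?thesis by (simp only: sum.distrib sum.delta finite_atLeastAtMost if_True)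
  qed
  finally show ?thesis using True n4 unfolding simple_reflection_def
    by (auto simp: fun_eq_iff vec_apply simple_pm_root pm_root_apply)
next
  case False
  then have i: "i < n" using assms by auto
  have "inner_prod n v (\<alpha> i) = (\<Sum>x\<in>{1..n}. (if x = i then v x else 0) + (if x = i + 1 then - v x else 0))"
    unfolding inner_prod_def simple_pm_root(1)[OF i] by (intro sum.cong refl) (auto simp: pm_root_apply)
  also have "\<dots> = v i - v (i + 1)" using i assms by (simp add: sum.distrib)
  finally show ?thesis using False unfolding simple_reflection_def
    by (auto simp: fun_eq_iff vec_apply simple_pm_root(1)[OF i] pm_root_apply)
qed

lemma srefl_Pos: assumes "i \<in> {1..n}" "v \<in> Pos" "v \<noteq> \<alpha> i" shows "srefl i v \<in> Pos"
proof -
  obtain a b s where ab: "1 \<le> a" "a < b" "b \<le> n" "s = 1 \<or> s = - 1" "v = pm_root a b s"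
    using assms(2) unfolding Pos_iff by blast
  show ?thesis
  proof (cases "i = n")
    case True
    consider "b < n - 1" | "b = n - 1" | "a < n - 1" "b = n" | "a = n - 1" "b = n" using ab by linarith
    then show ?thesis
    proof cases
      case 1
      then have "srefl i v = pm_root a b s" using ab(1-4) True n4 unfolding srefl_eq[OF assms(1)] ab(5) by (auto simp: pm_root_apply fun_eq_iff vec_apply)
      then show ?thesis using ab PosI by auto
    next
      case 2
      then have "srefl i v = pm_root a n (- s)" using ab(1-4) True n4 unfolding srefl_eq[OF assms(1)] ab(5) by (auto simp: pm_root_apply fun_eq_iff vec_apply)
      then show ?thesis using ab 2 n4 PosI[of a n "-s"] by auto
    next
      case 3
      then have "srefl i v = pm_root a (n - 1) (- s)" using ab(1-4) True n4 unfolding srefl_eq[OF assms(1)] ab(5) by (auto simp: pm_root_apply fun_eq_iff vec_apply)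
      then show ?thesis using ab 3 n4 PosI[of a "n - 1" "-s"] by auto
    next
      case 4
      then have s: "s = - 1" using assms(3) ab True simple_pm_root(2) by auto
      then have "srefl i v = pm_root (n - 1) n (- 1)" using 4 ab(1-4) True n4 unfolding srefl_eq[OF assms(1)] ab(5) by (auto simp: pm_root_apply fun_eq_iff vec_apply)
      then show ?thesis using PosI[of "n - 1" n "-1"] n4 by auto
    qed
  next
    case False
    then have i: "1 \<le> i" "i < n" using assms by auto
    define sw where "sw x = (if x = i then i + 1 else if x = i + 1 then i else x)" for x
    have e: "srefl i v = pm_root (sw a) (sw b) s"
      using False ab(1-4) unfolding srefl_eq[OF assms(1)] ab(5) by (auto simp: pm_root_apply fun_eq_iff vec_apply sw_def)
    show ?thesis
    proof (cases "a = i \<and> b = i + 1")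
      case True
      then have "s = 1" using assms(3) ab simple_pm_root(1)[OF i(2)] by auto
      then have "srefl i v = pm_root a b 1" using e True by (auto simp: pm_root_apply fun_eq_iff vec_apply sw_def)
      then show ?thesis using PosI ab by auto
    next
      case False
      then have "sw a < sw b" "1 \<le> sw a" "sw b \<le> n" using ab i by (auto simp: sw_def)
      then show ?thesis using e PosI ab by auto
    qed
  qed
qed

definition roots :: "vec set" where "roots = Pos \<union> uminus ` Pos"

lemma Pos_roots: "v \<in> Pos \<Longrightarrow> v \<in> roots" unfolding roots_def by blast

lemma roots_minus: "v \<in> roots \<Longrightarrow> - v \<in> roots"
  unfolding roots_def by auto

lemma srefl_roots: assumes "i \<in> {1..n}" "v \<in> roots" shows "srefl i v \<in> roots"
proof -
  have p: "srefl i u \<in> roots" if "u \<in> Pos" for u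
    using srefl_Pos[OF assms(1) that] srefl_simple[OF assms(1)] simple_Pos[OF assms(1)]
    by (cases "u = \<alpha> i") (auto simp: roots_def)
  show ?thesis
  proof (cases "v \<in> Pos")
    case False
    then obtain u where "u \<in> Pos" "v = - u" using assms(2) unfolding roots_def by auto
    then show ?thesis using p roots_minus[OF p] srefl_minus by simp
  qed (rule p)
qed

lemma srefls_roots: "set us \<subseteq> {1..n} \<Longrightarrow> v \<in> roots \<Longrightarrow> srefls us v \<in> roots"
  by (induction us) (auto intro: srefl_roots)

lemma roots_cases: "v \<in> roots \<Longrightarrow> v \<notin> Pos \<Longrightarrow> - v \<in> Pos"
  unfolding roots_def by auto

inductive_set root_lattice :: "vec set" where
  root_lattice_simple: "i \<in> {1..n} \<Longrightarrow> \<alpha> i \<in> root_lattice"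
| root_lattice_add: "u \<in> root_lattice \<Longrightarrow> v \<in> root_lattice \<Longrightarrow> u + v \<in> root_lattice"
| root_lattice_minus: "u \<in> root_lattice \<Longrightarrow> - u \<in> root_lattice"

lemma Pos_root_lattice: "v \<in> Pos \<Longrightarrow> v \<in> root_lattice"
  by (induction rule: Pos_induct) (auto intro: root_lattice_simple root_lattice_add)

lemma roots_root_lattice: "v \<in> roots \<Longrightarrow> v \<in> root_lattice"
  unfolding roots_def by (auto intro: Pos_root_lattice root_lattice_minus)

lemma root_lattice_diff: "u \<in> root_lattice \<Longrightarrow> v \<in> root_lattice \<Longrightarrow> u - v \<in> root_lattice"
  using root_lattice_add[OF _ root_lattice_minus, of u v] by simp

lemma root_lattice_zero: "0 \<in> root_lattice"
  using root_lattice_diff[OF root_lattice_simple root_lattice_simple, of 1 1] n4 by simp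

lemma root_lattice_sum: "(\<And>i. i \<in> A \<Longrightarrow> h i \<in> root_lattice) \<Longrightarrow> sum h A \<in> root_lattice"
  by (induction A rule: infinite_finite_induct)
    (auto intro: root_lattice_add root_lattice_zero)

text \<open>
  A vector of the root lattice in the right kernel pairs to zero with itself, and the
  symmetrised form is the positive definite inner product.
\<close>
lemma nondegenerate:
  assumes "v \<in> root_lattice" "\<And>k. k \<in> {1..n} \<Longrightarrow> euler2 (\<alpha> k) v = 0"
  shows "v = 0"
proof -
  have "euler2 u v = 0" if "u \<in> root_lattice" for u
    using that by induction (auto simp: assms(2) euler2_add_left)
  then have "inner_prod n v v = 0" using euler2_sym[of v v] assms(1) by simp
  then have "\<forall>x\<in>{1..n}. v x = 0"
    unfolding inner_prod_def by (subst (asm) sum_nonneg_eq_0_iff) auto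
  moreover have "v x = 0" if "x \<notin> {1..n}" for x
    using assms(1)
  proof induction
    case (root_lattice_simple i)
    then show ?case using Pos_outside[OF simple_Pos that] by auto
  qed (auto simp: vec_apply)
  ultimately show ?thesis by (auto simp: fun_eq_iff vec_apply)
qed

end

section \<open>Paths in an oriented tree\<close>

context dquiver
begin

text \<open>
  The component of \<open>v\<close> after removal of the edge to its parent.
\<close>
definition subtree :: "nat \<Rightarrow> nat set" where
  "subtree v = (if v \<le> n - 2 then {v..n} else {v})"

lemma subtree_cross:
  assumes "(x, y) \<in> Q \<or> (y, x) \<in> Q" "x \<in> subtree v" "y \<notin> subtree v" "2 \<le> v" "v \<le> n"
  shows "x = v \<and> y = parent v"
proof -
  have "2 \<le> y \<and> y \<le> n \<and> x = parent y \<or> 2 \<le> x \<and> x \<le> n \<and> y = parent x"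
    using assms(1) arrow_cases by blast
  then show ?thesis using assms(2-) n4 unfolding subtree_def parent_def by (auto split: if_splits)
qed

lemma path_child: assumes "(j, l) \<in> Q" "(l, i) \<in> Q\<^sup>*" "j = parent l" "2 \<le> l" "l \<le> n" shows "i \<in> subtree l"
  using assms(2)
proof induction
  case base
  then show ?case using assms unfolding subtree_def by auto
next
  case (step x y)
  show ?case
  proof (rule ccontr)
    assume "y \<notin> subtree l"
    then have "x = l \<and> y = parent l" using subtree_cross[of x y l] step assms by auto
    then show False using step(2) assms one_orientation[of l] by auto
  qed
qed

lemma path_parent: assumes "(j, l) \<in> Q" "(l, i) \<in> Q\<^sup>*" "l = parent j" "2 \<le> j" "j \<le> n" shows "i \<notin> subtree j"
  using assms(2)
proof induction
  case base
  then show ?case using assms parent_bounds[of j] unfolding subtree_def by auto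
next
  case (step x y)
  show ?case
  proof
    assume "y \<in> subtree j"
    then have "y = j \<and> x = parent j" using subtree_cross[of y x j] step assms by auto
    then show False using step(2) assms one_orientation[of j] by auto
  qed
qed

text \<open>
  Removing the edge \<open>j - l\<close> separates \<open>l\<close> from all other neighbours of \<open>j\<close>, and a path cannot
  return over an arrow that it has used. So the end of the path determines its first step.
\<close>
lemma next_unique:
  assumes "(j, l) \<in> Q" "(l, i) \<in> Q\<^sup>*" "(j, l') \<in> Q" "(l', i) \<in> Q\<^sup>*"
  shows "l = l'"
proof -
  have sub: "subtree l \<subseteq> subtree j" if "j = parent l" "2 \<le> l" "l \<le> n" for l
    using that n4 unfolding subtree_def parent_def by (auto split: if_splits)
  have dis: "l = l'" if "i \<in> subtree l" "i \<in> subtree l'" "parent l = parent l'" "2 \<le> l" "l \<le> n" "2 \<le> l'" "l' \<le> n"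
    using that n4 unfolding subtree_def parent_def by (auto split: if_splits)
  show ?thesis
    using arrow_cases[OF assms(1)] arrow_cases[OF assms(3)] path_child[OF assms(1,2)] path_child[OF assms(3,4)]
      path_parent[OF assms(1,2)] path_parent[OF assms(3,4)] sub[of l] sub[of l'] dis
    by blast
qed

end

section \<open>The adapted Coxeter element\<close>

text \<open>
  An arrow keeps its direction until one of its ends has been reversed. Hence in an adapted
  word the source of an arrow comes before its target.
\<close>
lemma reverse_fold:
  "a \<notin> set us \<Longrightarrow> b \<notin> set us \<Longrightarrow> (a, b) \<in> fold reverse_at us Q \<longleftrightarrow> (a, b) \<in> Q"
  by (induction us arbitrary: Q) (auto simp: reverse_at_def)

locale ar = dquiver +
  fixes \<xi> :: "nat \<Rightarrow> int" and w :: "nat list"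
  assumes height: "height_function Q \<xi>" and adapted: "adapted_word n Q w"
begin

abbreviation \<eta> :: "nat \<Rightarrow> vec" where "\<eta> \<equiv> eta n Q"
abbreviation \<tau> :: "vec \<Rightarrow> vec" where "\<tau> \<equiv> coxeter n w"

lemma xi_arrow: "(i, j) \<in> Q \<Longrightarrow> \<xi> j = \<xi> i - 1"
  using height unfolding height_function_def by blast

lemma xi_path: "(i, j) \<in> Q\<^sup>* \<Longrightarrow> i = j \<or> \<xi> j < \<xi> i"
  by (induction rule: rtrancl_induct) (auto dest: xi_arrow)

text \<open>
  The roots \<open>\<eta>\<^sub>i\<close> are dual to the simple roots: if \<open>j \<noteq> i\<close> has a path to \<open>i\<close>, then \<open>\<alpha>\<^sub>j\<close>
  contributes \<open>2\<close> and the unique next vertex of the path contributes \<open>-2\<close>. Consequently the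
  form with \<open>\<eta>\<^sub>i\<close> reads off the coefficient of \<open>\<alpha>\<^sub>i\<close>. (For representations of \<open>Q\<close>, \<open>\<eta>\<^sub>i\<close> is
  the dimension vector of an injective hull.)
\<close>
lemma euler2_simple_eta: assumes "i \<in> {1..n}" "j \<in> {1..n}"
  shows "euler2 (\<alpha> j) (\<eta> i) = (if j = i then 2 else 0)"
proof -
  let ?S = "{l \<in> {1..n}. (l, i) \<in> Q\<^sup>*}"
  let ?h = "\<lambda>l. if j = l then 2 else if (j, l) \<in> Q then - 2 else (0::int)"
  have "euler2 (\<alpha> j) (\<eta> i) = (\<Sum>l\<in>?S. euler2 (\<alpha> j) (\<alpha> l))"
    unfolding eta_def by (rule euler2_sum_right)
  also have "\<dots> = sum ?h ?S" by (intro sum.cong refl) (use assms euler2_simple in auto)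
  finally have e: "euler2 (\<alpha> j) (\<eta> i) = sum ?h ?S" .
  have irr: "(j, j) \<notin> Q" using xi_arrow[of j j] by auto
  show ?thesis
  proof (cases "(j, i) \<in> Q\<^sup>*")
    case False
    have "\<forall>l\<in>?S. ?h l = 0" using False by (auto intro: converse_rtrancl_into_rtrancl)
    then show ?thesis using e False by (auto simp: sum.neutral)
  next
    case True
    show ?thesis
    proof (cases "j = i")
      case True
      have "(i, l) \<notin> Q" if "(l, i) \<in> Q\<^sup>*" for l using xi_arrow[of i l] xi_path[OF that] by auto
      then have "sum ?h ?S = sum ?h {i}" using assms True
        by (intro sum.mono_neutral_right) auto
      then show ?thesis using e True by simp
    next
      case False
      then obtain l0 where l0: "(j, l0) \<in> Q" "(l0, i) \<in> Q\<^sup>*" using True by (metis converse_rtranclE)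
      then have "l0 \<noteq> j" "l0 \<in> {1..n}" using irr arrow_range by auto
      moreover have "(j, l) \<notin> Q" if "(l, i) \<in> Q\<^sup>*" "l \<noteq> l0" for l using next_unique[OF _ that(1) l0] that by blast
      ultimately have "sum ?h ?S = sum ?h {j, l0}" using assms True l0
        by (intro sum.mono_neutral_right) auto
      also have "\<dots> = 0" using \<open>l0 \<noteq> j\<close> l0 by auto
      finally show ?thesis using e False by simp
    qed
  qed
qed

lemma euler2_eta_eta: assumes "i \<in> {1..n}" "j \<in> {1..n}"
  shows "euler2 (\<eta> j) (\<eta> i) = (if (i, j) \<in> Q\<^sup>* then 2 else 0)"
proof -
  let ?S = "{l \<in> {1..n}. (l, j) \<in> Q\<^sup>*}"
  have "euler2 (\<eta> j) (\<eta> i) = (\<Sum>l\<in>?S. euler2 (\<alpha> l) (\<eta> i))"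
    unfolding eta_def[of n Q j] by (rule euler2_sum_left)
  also have "\<dots> = (\<Sum>l\<in>?S. if l = i then 2 else 0)" by (intro sum.cong refl) (use assms euler2_simple_eta in auto)
  also have "\<dots> = (if (i, j) \<in> Q\<^sup>* then 2 else 0)" using assms by simp
  finally show ?thesis .
qed

lemma euler2_Pos_eta: "y \<in> Pos \<Longrightarrow> i \<in> {1..n} \<Longrightarrow> 0 \<le> euler2 y (\<eta> i)"
  by (induction rule: Pos_induct) (auto simp: euler2_simple_eta euler2_add_left)

lemma word_set: "set w = {1..n}" "distinct w" using adapted unfolding adapted_word_def by auto

lemma pred_before: assumes "w = us @ i # vs" "(j, i) \<in> Q" shows "j \<in> set us"
proof (rule ccontr)
  assume j: "j \<notin> set us"
  have "length us < length w" "take (length us) w = us" "w ! length us = i" using assms by auto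
  then have "is_source (fold reverse_at us Q) i" using adapted unfolding adapted_word_def by metis
  moreover have "i \<notin> set us" using word_set assms by auto
  ultimately show False using reverse_fold[OF j, of i] assms unfolding is_source_def by auto
qed

lemma succ_after: assumes "w = us @ i # vs" "(i, j) \<in> Q" shows "j \<in> set vs"
proof (rule ccontr)
  assume j: "j \<notin> set vs"
  have "j \<noteq> i" "j \<in> set w" using arrow_range[OF assms(2)] word_set by auto
  then have "j \<in> set us" using j assms by auto
  then obtain us1 us2 where u: "us = us1 @ j # us2" by (meson split_list)
  then have "w = us1 @ j # (us2 @ i # vs)" using assms by simp
  then have "i \<in> set us1" using pred_before assms by blast
  then show False using word_set assms u by auto
qed

lemma euler2_srefls_right: "(\<And>l. l \<in> set us \<Longrightarrow> euler2 x (\<alpha> l) = 0) \<Longrightarrow> euler2 x (srefls us v) = euler2 x v"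
  by (induction us) (auto simp: srefl_alt euler2_diff_right euler2_scale_right)

lemma euler2_srefls_left: "(\<And>l. l \<in> set us \<Longrightarrow> euler2 (\<alpha> l) x = 0) \<Longrightarrow> euler2 (srefls us v) x = euler2 v x"
  by (induction us) (auto simp: srefl_alt euler2_diff_left euler2_scale_left)

lemma euler2_simple_srefl: assumes "i \<in> {1..n}" shows "euler2 (\<alpha> i) (srefl i v) = - euler2 v (\<alpha> i)"
proof -
  have "euler2 (\<alpha> i) (srefl i v) = euler2 (\<alpha> i) v - 2 * inner_prod n v (\<alpha> i)"
    using assms by (simp add: srefl_alt euler2_diff_right euler2_scale_right euler2_simple)
  then show ?thesis using euler2_sym[of v "\<alpha> i"] by simp
qed

lemma word_orth:
  assumes "w = us @ i # vs"
  shows "l \<in> set us \<Longrightarrow> euler2 (\<alpha> i) (\<alpha> l) = 0" and "l \<in> set vs \<Longrightarrow> euler2 (\<alpha> l) (\<alpha> i) = 0"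
proof -
  have r: "set us \<subseteq> {1..n}" "set vs \<subseteq> {1..n}" "i \<in> {1..n}" using word_set assms by auto
  have d: "i \<notin> set us" "i \<notin> set vs" "set us \<inter> set vs = {}" using word_set assms by auto
  show "l \<in> set us \<Longrightarrow> euler2 (\<alpha> i) (\<alpha> l) = 0" using r d succ_after[OF assms, of l] euler2_simple[of i l] by fastforce
  show "l \<in> set vs \<Longrightarrow> euler2 (\<alpha> l) (\<alpha> i) = 0" using r d pred_before[OF assms, of l] euler2_simple[of l i] by fastforce
qed

lemma tau_srefls: "\<tau> = srefls w" unfolding coxeter_def ..

text \<open>
  The letters behind \<open>i\<close> change \<open>x\<close> by simple roots that pair to zero with \<open>\<alpha>\<^sub>i\<close> on the right,
  the letters in front of \<open>i\<close> by simple roots that pair to zero on the left. Only the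
  reflection at \<open>i\<close> matters.
\<close>
lemma euler2_simple_tau: assumes "i \<in> {1..n}" shows "euler2 (\<alpha> i) (\<tau> x) = - euler2 x (\<alpha> i)"
proof -
  obtain us vs where w: "w = us @ i # vs" using word_set assms by (metis split_list)
  have "euler2 (\<alpha> i) (\<tau> x) = euler2 (\<alpha> i) (srefl i (srefls vs x))"
    unfolding tau_srefls unfolding w by (simp add: euler2_srefls_right word_orth(1)[OF w])
  also have "\<dots> = - euler2 (srefls vs x) (\<alpha> i)" by (rule euler2_simple_srefl[OF assms])
  also have "\<dots> = - euler2 x (\<alpha> i)" by (simp add: euler2_srefls_left word_orth(2)[OF w])
  finally show ?thesis .
qed

text \<open>
  The Auslander-Reiten formula. Applied twice, it shows that \<open>\<tau>\<close> preserves the form.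
\<close>
lemma euler2_tau: "y \<in> root_lattice \<Longrightarrow> euler2 y (\<tau> x) = - euler2 x y"
  by (induction rule: root_lattice.induct) (auto simp: euler2_simple_tau euler2_add_left euler2_add_right)

lemma tau_add: "\<tau> (u + v) = \<tau> u + \<tau> v" unfolding tau_srefls by (rule srefls_add)

lemma tau_minus: "\<tau> (- u) = - \<tau> u" unfolding tau_srefls by (rule srefls_minus)

lemma tau_roots: "v \<in> roots \<Longrightarrow> \<tau> v \<in> roots" unfolding tau_srefls using srefls_roots word_set by auto

lemma inj_tau: "inj \<tau>" unfolding tau_srefls using inj_srefls word_set by auto

text \<open>
  Both sides pair to \<open>2\<close> with \<open>\<alpha>\<^sub>i\<close> and to \<open>0\<close> with the other simple roots, by the argument
  for \<open>euler2_simple_tau\<close>.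
\<close>
lemma eta_srefls: assumes "w = us @ i # vs" shows "\<eta> i = srefls us (\<alpha> i)"
proof -
  let ?y = "srefls us (\<alpha> i)"
  have r: "set us \<subseteq> {1..n}" "set vs \<subseteq> {1..n}" "i \<in> {1..n}" using word_set assms by auto
  have d: "i \<notin> set us" "i \<notin> set vs" using word_set assms by auto
  have "euler2 (\<alpha> k) ?y = (if k = i then 2 else 0)" if k: "k \<in> {1..n}" for k
  proof -
    have "k \<in> set us \<union> {i} \<union> set vs" using k word_set assms by auto
    then consider "k \<in> set us" | "k = i" | "k \<in> set vs" by auto
    then show ?thesis
    proof cases
      case 1
      then obtain us1 us2 where u: "us = us1 @ k # us2" by (meson split_list)
      then have w: "w = us1 @ k # (us2 @ i # vs)" using assms by simp
      have "euler2 (\<alpha> k) ?y = euler2 (\<alpha> k) (srefl k (srefls us2 (\<alpha> i)))"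
        unfolding u by (simp add: euler2_srefls_right word_orth(1)[OF w])
      also have "\<dots> = - euler2 (srefls us2 (\<alpha> i)) (\<alpha> k)" by (rule euler2_simple_srefl[OF k])
      also have "\<dots> = - euler2 (\<alpha> i) (\<alpha> k)" by (simp add: euler2_srefls_left word_orth(2)[OF w])
      also have "\<dots> = 0" using word_orth(2)[OF w, of i] by simp
      finally show ?thesis using 1 d by auto
    next
      case 2
      then show ?thesis using r by (simp add: euler2_srefls_right word_orth(1)[OF assms] euler2_simple)
    next
      case 3
      then obtain vs1 vs2 where u: "vs = vs1 @ k # vs2" by (meson split_list)
      then have w: "w = (us @ i # vs1) @ k # vs2" using assms by simp
      have "euler2 (\<alpha> k) ?y = euler2 (\<alpha> k) (\<alpha> i)" by (rule euler2_srefls_right) (rule word_orth(1)[OF w], simp)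
      also have "\<dots> = 0" using word_orth(1)[OF w, of i] by simp
      finally show ?thesis using 3 d by auto
    qed
  qed
  then have "euler2 (\<alpha> k) (\<eta> i - ?y) = 0" if "k \<in> {1..n}" for k
    using that r euler2_simple_eta[of i k] by (simp add: euler2_diff_right)
  moreover have "\<eta> i \<in> root_lattice" unfolding eta_def by (rule root_lattice_sum) (auto intro: root_lattice_simple)
  moreover have "?y \<in> root_lattice" using roots_root_lattice srefls_roots r Pos_roots simple_Pos by blast
  ultimately have "\<eta> i - ?y = 0" by (intro nondegenerate root_lattice_diff)
  then show ?thesis by simp
qed

lemma eta_roots: assumes "i \<in> {1..n}" shows "\<eta> i \<in> roots"
proof -
  obtain us vs where w: "w = us @ i # vs" using word_set assms by (metis split_list)
  then have "set us \<subseteq> {1..n}" using word_set by auto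
  then show ?thesis using eta_srefls[OF w] srefls_roots Pos_roots simple_Pos[OF assms] by simp
qed

text \<open>
  The form of \<open>\<eta>\<^sub>i\<close> with itself is positive, so the negative of \<open>\<eta>\<^sub>i\<close> cannot have a
  nonnegative coefficient at \<open>\<alpha>\<^sub>i\<close>.
\<close>
lemma eta_Pos: assumes "i \<in> {1..n}" shows "\<eta> i \<in> Pos"
proof (rule ccontr)
  assume "\<eta> i \<notin> Pos"
  then have "- \<eta> i \<in> Pos" using eta_roots[OF assms] roots_cases by blast
  then have "0 \<le> euler2 (- \<eta> i) (\<eta> i)" using euler2_Pos_eta assms by blast
  then show False using euler2_eta_eta[OF assms assms] by simp
qed

lemma srefls_first_negative:
  assumes "set vs \<subseteq> {1..n}" "u \<in> Pos"
  shows "srefls vs u \<in> Pos \<or> (\<exists>vs1 i vs2. vs = vs1 @ i # vs2 \<and> srefls vs u = srefls vs1 (- \<alpha> i))"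
  using assms(1)
proof (induction vs)
  case Nil
  then show ?case using assms by simp
next
  case (Cons j vs)
  then have j: "j \<in> {1..n}" and IH: "srefls vs u \<in> Pos \<or> (\<exists>vs1 i vs2. vs = vs1 @ i # vs2 \<and> srefls vs u = srefls vs1 (- \<alpha> i))" by auto
  from IH show ?case
  proof
    assume p: "srefls vs u \<in> Pos"
    show ?thesis
    proof (cases "srefls vs u = \<alpha> j")
      case True
      then have "j # vs = [] @ j # vs \<and> srefls (j # vs) u = srefls [] (- \<alpha> j)" using srefl_simple[OF j] by simp
      then show ?thesis by blast
    next
      case False
      then show ?thesis using srefl_Pos[OF j p] by simp
    qed
  next
    assume "\<exists>vs1 i vs2. vs = vs1 @ i # vs2 \<and> srefls vs u = srefls vs1 (- \<alpha> i)"
    then obtain vs1 i vs2 where "vs = vs1 @ i # vs2" "srefls vs u = srefls vs1 (- \<alpha> i)" by blast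
    then have "j # vs = (j # vs1) @ i # vs2 \<and> srefls (j # vs) u = srefls (j # vs1) (- \<alpha> i)" by simp
    then show ?thesis by blast
  qed
qed

text \<open>
  A simple reflection makes only one positive root negative, its simple root. The part of the
  word that is still to be applied sends that root to some \<open>\<eta>\<^sub>i\<close>.
\<close>
lemma tau_not_Pos: assumes "u \<in> Pos" "\<tau> u \<notin> Pos" shows "\<exists>i\<in>{1..n}. \<tau> u = - \<eta> i"
proof -
  obtain us i vs where w: "w = us @ i # vs" and e: "srefls w u = srefls us (- \<alpha> i)"
    using srefls_first_negative[of w u] assms word_set unfolding tau_srefls by auto
  then have "\<tau> u = - \<eta> i" unfolding tau_srefls eta_srefls[OF w] by (simp add: srefls_minus)
  moreover have "i \<in> {1..n}" using w word_set by auto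
  ultimately show ?thesis by blast
qed

end

section \<open>The Auslander-Reiten quiver\<close>

context ar
begin

text \<open>
  The root at the vertex \<open>(i, \<xi>\<^sub>i - 2k)\<close>.
\<close>
definition ar_entry :: "nat \<Rightarrow> nat \<Rightarrow> vec" where "ar_entry k i = (\<tau> ^^ k) (\<eta> i)"

text \<open>
  The vertex \<open>(i, \<xi>\<^sub>i - 2k)\<close> exists; see \<open>vertices_iff\<close>.
\<close>
definition valid :: "nat \<Rightarrow> nat \<Rightarrow> bool" where
  "valid i k \<longleftrightarrow> i \<in> {1..n} \<and> (\<forall>l\<le>k. ar_entry l i \<in> Pos)"

lemma tau_power_roots: "x \<in> roots \<Longrightarrow> (\<tau> ^^ k) x \<in> roots"
  by (induction k) (auto intro: tau_roots)

lemma euler2_tau_tau: assumes "x \<in> roots" "y \<in> roots" shows "euler2 (\<tau> x) (\<tau> y) = euler2 x y"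
proof -
  have "euler2 (\<tau> x) (\<tau> y) = - euler2 y (\<tau> x)" using euler2_tau[of "\<tau> x" y] roots_root_lattice tau_roots assms by blast
  then show ?thesis using euler2_tau[of y x] roots_root_lattice assms by auto
qed

lemma euler2_tau_power: "x \<in> roots \<Longrightarrow> y \<in> roots \<Longrightarrow> euler2 ((\<tau> ^^ k) x) ((\<tau> ^^ k) y) = euler2 x y"
  by (induction k) (auto simp: euler2_tau_tau tau_power_roots)

lemma tau_power_add: "(\<tau> ^^ k) (u + v) = (\<tau> ^^ k) u + (\<tau> ^^ k) v"
  by (induction k) (auto simp: tau_add)

lemma tau_power_zero: "(\<tau> ^^ k) 0 = 0"
  using tau_power_add[of k 0 0] by simp

lemma tau_power_sum: "(\<tau> ^^ k) (sum h A) = (\<Sum>i\<in>A. (\<tau> ^^ k) (h i))"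
  by (induction A rule: infinite_finite_induct) (auto simp: tau_power_add tau_power_zero)

lemma tau_orbit_periodic: assumes "x \<in> roots" obtains N where "N > 0" "(\<tau> ^^ N) x = x"
proof -
  have "finite roots" unfolding roots_def using finite_Pos by auto
  moreover have "{y. \<exists>n. y = (\<tau> ^^ n) x} \<subseteq> roots" using tau_power_roots[OF assms] by auto
  ultimately have "finite {y. \<exists>n. y = (\<tau> ^^ n) x}" by (rule finite_subset[rotated])
  then show ?thesis using funpow_inj_finite[OF inj_tau] that by blast
qed

text \<open>
  The sum over a \<open>\<tau>\<close>-orbit is fixed by \<open>\<tau>\<close>, so by the Auslander-Reiten formula it pairs to
  zero with itself and vanishes. A sum of positive roots does not vanish, because a linear
  functional is positive on all of them.
\<close>
lemma leaves_Pos: assumes "x \<in> Pos" shows "\<exists>k. (\<tau> ^^ k) x \<notin> Pos"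
proof (rule ccontr)
  assume "\<not> ?thesis"
  then have p: "(\<tau> ^^ k) x \<in> Pos" for k by blast
  obtain N where N: "N > 0" "(\<tau> ^^ N) x = x" using tau_orbit_periodic[OF Pos_roots[OF assms]] .
  define s where "s = (\<Sum>k<N. (\<tau> ^^ k) x)"
  define h where "h k = (\<tau> ^^ k) x" for k
  have "\<tau> s = (\<Sum>k<N. h (Suc k))"
    using tau_power_sum[of 1 h "{..<N}"] by (simp add: s_def h_def)
  moreover have "h 0 + (\<Sum>k<N. h (Suc k)) = s + h N"
    using sum.lessThan_Suc_shift[of h N] sum.lessThan_Suc[of h N] unfolding s_def h_def[symmetric] by (rule trans[OF sym])
  moreover have "h 0 = h N" using N(2) unfolding h_def by simp
  ultimately have "\<tau> s = s" by (metis add.commute add_right_cancel)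
  have "s \<in> root_lattice" unfolding s_def using p Pos_root_lattice by (intro root_lattice_sum) blast
  then have "euler2 s s = - euler2 s s" using euler2_tau[of s s] \<open>\<tau> s = s\<close> by simp
  then have "inner_prod n s s = 0" using euler2_sym[of s s] by simp
  then have s0: "\<forall>a\<in>{1..n}. s a = 0"
    unfolding inner_prod_def by (subst (asm) sum_nonneg_eq_0_iff) auto
  define ht where "ht v = (\<Sum>a\<in>{1..n}. (int n - int a) * v a)" for v :: vec
  have ht_pos: "ht v > 0" if "v \<in> Pos" for v
  proof -
    obtain a b t where ab: "1 \<le> a" "a < b" "b \<le> n" "t = 1 \<or> t = - 1" "v = pm_root a b t"
      using \<open>v \<in> Pos\<close> unfolding Pos_iff by blast
    have "ht v = (\<Sum>x\<in>{1..n}. (if x = a then int n - int x else 0) + (if x = b then t * (int n - int x) else 0))"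
      unfolding ht_def ab(5) by (intro sum.cong refl) (use ab in \<open>auto simp: pm_root_apply\<close>)
    also have "\<dots> = (int n - int a) + t * (int n - int b)"
      using ab by (simp add: sum.distrib)
    finally show ?thesis using ab by auto
  qed
  have ht_add: "ht (u + v) = ht u + ht v" for u v
    unfolding ht_def by (simp add: vec_apply distrib_left sum.distrib)
  have ht_zero: "ht 0 = 0" unfolding ht_def by (simp add: vec_apply)
  have "ht (sum h A) = (\<Sum>i\<in>A. ht (h i))" for h :: "nat \<Rightarrow> vec" and A
    by (induction A rule: infinite_finite_induct) (simp_all add: ht_add ht_zero)
  then have "ht s = (\<Sum>k<N. ht ((\<tau> ^^ k) x))" unfolding s_def .
  also have "\<dots> > 0" using N p ht_pos by (intro sum_pos) auto
  finally show False using s0 unfolding ht_def by simp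
qed

lemma valid_m_max: assumes "i \<in> {1..n}" shows "k \<le> m_max n Q w i \<longleftrightarrow> valid i k"
proof -
  let ?S = "{k. \<forall>l\<le>k. (\<tau> ^^ l) (\<eta> i) \<in> Pos}"
  obtain K where K: "(\<tau> ^^ K) (\<eta> i) \<notin> Pos" using leaves_Pos[OF eta_Pos[OF assms]] by blast
  have "?S \<subseteq> {..K}" using K by (auto, meson nat_le_linear)
  then have fin: "finite ?S" by (rule finite_subset) simp
  have "0 \<in> ?S" using eta_Pos[OF assms] by simp
  then have m: "Max ?S \<in> ?S" using fin Max_in by blast
  have "k \<in> ?S" if "k \<le> Max ?S"
    using m order_trans[OF _ that] by (intro CollectI allI impI) (elim CollectE, blast)
  moreover have "k \<le> Max ?S" if "k \<in> ?S" using Max_ge[OF fin that] .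
  ultimately have "k \<le> Max ?S \<longleftrightarrow> k \<in> ?S" by (rule iffI)
  moreover have "k \<in> ?S \<longleftrightarrow> valid i k" unfolding valid_def ar_entry_def using assms by simp
  ultimately show ?thesis unfolding m_max_def by (rule trans)
qed

lemma vertices_iff: "(i, p) \<in> ar_vertices n Q \<xi> w \<longleftrightarrow> (\<exists>k. p = \<xi> i - 2 * int k \<and> valid i k)"
proof
  assume "(i, p) \<in> ar_vertices n Q \<xi> w"
  then obtain k where "p = \<xi> i - 2 * int k" "i \<in> {1..n}" "k \<le> m_max n Q w i"
    unfolding ar_vertices_def by blast
  then show "\<exists>k. p = \<xi> i - 2 * int k \<and> valid i k" using valid_m_max[of i k] by blast
next
  assume "\<exists>k. p = \<xi> i - 2 * int k \<and> valid i k"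
  then obtain k where k: "p = \<xi> i - 2 * int k" "valid i k" by blast
  then have "i \<in> {1..n}" unfolding valid_def by (rule_tac conjunct1)
  then show "(i, p) \<in> ar_vertices n Q \<xi> w"
    using k valid_m_max[of i k] unfolding ar_vertices_def by blast
qed

lemma root_vertex: "ar_root n Q \<xi> w (i, \<xi> i - 2 * int k) = ar_entry k i"
proof -
  have "nat ((\<xi> i - (\<xi> i - 2 * int k)) div 2) = k" by simp
  then show ?thesis unfolding ar_root_def ar_entry_def prod.case by (rule arg_cong)
qed

lemma eta_root_lattice: "i \<in> {1..n} \<Longrightarrow> \<eta> i \<in> root_lattice" using roots_root_lattice eta_roots by blast

lemma finite_neighbours: "finite {j. (i, j) \<in> Q}" "finite {j. (j, i) \<in> Q}"
  by (rule finite_subset[of _ "{1..n}"]; use arrow_range in blast)+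

lemma simple_eta: assumes "i \<in> {1..n}" shows "\<alpha> i = \<eta> i - (\<Sum>j | (j, i) \<in> Q. \<eta> j)"
proof -
  have "euler2 (\<alpha> k) (\<eta> i - (\<Sum>j | (j, i) \<in> Q. \<eta> j) - \<alpha> i) = 0" if k: "k \<in> {1..n}" for k
  proof -
    have "(\<Sum>j | (j, i) \<in> Q. euler2 (\<alpha> k) (\<eta> j)) = (\<Sum>j | (j, i) \<in> Q. if k = j then 2 else 0)"
      by (intro sum.cong refl) (use k euler2_simple_eta arrow_range in auto)
    also have "\<dots> = (if (k, i) \<in> Q then 2 else 0)" using finite_neighbours by simp
    finally show ?thesis using k assms arrow_range(3)[of i i]
      by (auto simp: euler2_diff_right euler2_sum_right euler2_simple_eta euler2_simple)
  qed
  moreover have "\<eta> i - (\<Sum>j | (j, i) \<in> Q. \<eta> j) - \<alpha> i \<in> root_lattice"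
    using assms arrow_range by (intro root_lattice_diff root_lattice_sum eta_root_lattice root_lattice_simple) auto
  ultimately show ?thesis using nondegenerate by (metis eq_iff_diff_eq_0)
qed

lemma tau_simple: assumes "i \<in> {1..n}" shows "- \<tau> (\<alpha> i) = \<eta> i - (\<Sum>j | (i, j) \<in> Q. \<eta> j)"
proof -
  have "euler2 (\<alpha> k) (\<eta> i - (\<Sum>j | (i, j) \<in> Q. \<eta> j) - (- \<tau> (\<alpha> i))) = 0" if k: "k \<in> {1..n}" for k
  proof -
    have "(\<Sum>j | (i, j) \<in> Q. euler2 (\<alpha> k) (\<eta> j)) = (\<Sum>j | (i, j) \<in> Q. if k = j then 2 else 0)"
      by (intro sum.cong refl) (use k euler2_simple_eta arrow_range in auto)
    also have "\<dots> = (if (i, k) \<in> Q then 2 else 0)" using finite_neighbours by simp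
    finally show ?thesis using k assms arrow_range(3)[of i i]
      by (auto simp: euler2_diff_right euler2_add_right euler2_sum_right euler2_simple_eta euler2_simple_tau euler2_simple)
  qed
  moreover have "\<eta> i - (\<Sum>j | (i, j) \<in> Q. \<eta> j) - (- \<tau> (\<alpha> i)) \<in> root_lattice"
    using assms arrow_range roots_root_lattice[OF tau_roots[OF Pos_roots[OF simple_Pos[OF assms]]]]
    by (intro root_lattice_diff root_lattice_sum eta_root_lattice root_lattice_minus) auto
  ultimately show ?thesis using nondegenerate by (metis eq_iff_diff_eq_0)
qed

text \<open>
  The mesh relation: a vertex and the next vertex of its row add up to the sum over the
  vertices between them. For \<open>k = 0\<close> it compares the two expressions \<open>simple_eta\<close> and
  \<open>tau_simple\<close> in terms of \<open>\<alpha>\<^sub>i\<close>.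
\<close>
lemma mesh: assumes "i \<in> {1..n}"
  shows "ar_entry k i + ar_entry (Suc k) i = (\<Sum>j | (i, j) \<in> Q. ar_entry k j) + (\<Sum>j | (j, i) \<in> Q. ar_entry (Suc k) j)"
proof -
  have "\<tau> (\<eta> i) = \<tau> (\<alpha> i + (\<Sum>j | (j, i) \<in> Q. \<eta> j))" using simple_eta[OF assms] by simp
  also have "\<dots> = \<tau> (\<alpha> i) + (\<Sum>j | (j, i) \<in> Q. \<tau> (\<eta> j))"
    unfolding tau_add using tau_power_sum[of 1 \<eta>] by simp
  also have "\<tau> (\<alpha> i) = (\<Sum>j | (i, j) \<in> Q. \<eta> j) - \<eta> i" using tau_simple[OF assms] by (metis add.inverse_inverse minus_diff_eq)
  finally have "\<eta> i + \<tau> (\<eta> i) = (\<Sum>j | (i, j) \<in> Q. \<eta> j) + (\<Sum>j | (j, i) \<in> Q. \<tau> (\<eta> j))" by simp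
  then have "(\<tau> ^^ k) (\<eta> i + \<tau> (\<eta> i)) = (\<tau> ^^ k) ((\<Sum>j | (i, j) \<in> Q. \<eta> j) + (\<Sum>j | (j, i) \<in> Q. \<tau> (\<eta> j)))" by simp
  then show ?thesis unfolding tau_power_add tau_power_sum ar_entry_def by (simp add: funpow_swap1)
qed

lemma ar_entry_roots: "i \<in> {1..n} \<Longrightarrow> ar_entry k i \<in> roots" unfolding ar_entry_def using tau_power_roots eta_roots by blast

lemma euler2_ar_entry_shift: "i \<in> {1..n} \<Longrightarrow> j \<in> {1..n} \<Longrightarrow> euler2 (ar_entry (a + k) i) (ar_entry (b + k) j) = euler2 (ar_entry a i) (ar_entry b j)"
  using euler2_tau_power[OF ar_entry_roots[of i a] ar_entry_roots[of j b], of k] unfolding ar_entry_def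
  by (simp add: add.commute[of _ k] funpow_add)

lemma euler2_ar_entry_Suc: "i \<in> {1..n} \<Longrightarrow> j \<in> {1..n} \<Longrightarrow> euler2 (ar_entry b j) (ar_entry (Suc a) i) = - euler2 (ar_entry a i) (ar_entry b j)"
  using euler2_tau[OF roots_root_lattice[OF ar_entry_roots[of j b]], of "ar_entry a i"] unfolding ar_entry_def by simp

lemma ar_entry_0: "ar_entry 0 i = \<eta> i" unfolding ar_entry_def by simp

text \<open>
  Let \<open>u\<close> be the last positive root of a row. Then \<open>\<tau>u = - \<eta>\<^sub>s\<close> for some \<open>s\<close>, and the form of
  \<open>u\<close> with \<open>x\<close> is the coefficient of \<open>\<alpha>\<^sub>s\<close> in \<open>x\<close>. (For representations of \<open>Q\<close>, \<open>u\<close> is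
  projective.)
\<close>
lemma not_valid: assumes "j \<in> {1..n}" "\<not> valid j k"
  shows "\<exists>l<k. \<forall>x\<in>Pos. 0 \<le> euler2 (ar_entry l j) x"
proof -
  have "\<exists>l\<le>k. ar_entry l j \<notin> Pos" using assms unfolding valid_def by auto
  then obtain l where l: "l \<le> k" "ar_entry l j \<notin> Pos" "\<And>m. m < l \<Longrightarrow> ar_entry m j \<in> Pos"
    using exists_least_iff[of "\<lambda>l. l \<le> k \<and> ar_entry l j \<notin> Pos"] by auto
  have "l \<noteq> 0" using l eta_Pos[OF assms(1)] ar_entry_0 by metis
  then obtain m where m: "l = Suc m" using not0_implies_Suc by blast
  have t: "ar_entry l j = \<tau> (ar_entry m j)" unfolding m ar_entry_def by simp
  then obtain s where s: "s \<in> {1..n}" "\<tau> (ar_entry m j) = - \<eta> s"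
    using tau_not_Pos[of "ar_entry m j"] l m by auto
  have "0 \<le> euler2 (ar_entry m j) x" if "x \<in> Pos" for x
  proof -
    have "euler2 (ar_entry m j) x = euler2 x (\<eta> s)" using euler2_tau[OF Pos_root_lattice[OF that], of "ar_entry m j"] s(2) by simp
    then show ?thesis using euler2_Pos_eta[OF that s(1)] by simp
  qed
  moreover have "m < k" using m l by simp
  ultimately show ?thesis by blast
qed

text \<open>
  If the row of \<open>j'\<close> ended too early, \<open>not_valid\<close> would make the form nonnegative on a pair of
  roots where it equals \<open>-2\<close>. The lemma \<open>valid_succ\<close> is similar; both together say that every
  vertex outside the right end of its row has all its right neighbours.
\<close>
lemma valid_pred: assumes "valid j k" "(j', j) \<in> Q" shows "valid j' k"
proof (rule ccontr)
  assume nv: "\<not> valid j' k"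
  have r: "j \<in> {1..n}" "j' \<in> {1..n}" using assms arrow_range by auto
  obtain l where l: "l < k" "\<forall>x\<in>Pos. 0 \<le> euler2 (ar_entry l j') x" using not_valid[OF r(2) nv] by blast
  then have "0 \<le> euler2 (ar_entry l j') (ar_entry (Suc l) j)" using assms unfolding valid_def by auto
  also have "\<dots> = - euler2 (\<eta> j) (\<eta> j')"
    using euler2_ar_entry_Suc[OF r, of l l] euler2_ar_entry_shift[OF r, of 0 l 0] by (simp add: ar_entry_0)
  also have "\<dots> = - 2" using euler2_eta_eta[OF r(2,1)] assms by auto
  finally show False by simp
qed

lemma euler2_arrow_Suc: assumes "valid j (Suc k)" "(j, j') \<in> Q" shows "2 \<le> euler2 (ar_entry (Suc 0) j) (\<eta> j')"
proof -
  have r: "j \<in> {1..n}" "j' \<in> {1..n}" using assms arrow_range by auto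
  have v1: "valid j 1" using assms unfolding valid_def by auto
  have nj: "(j', j) \<notin> Q\<^sup>*" using xi_path[of j' j] xi_arrow[OF assms(2)] by auto
  have "euler2 (ar_entry 0 j + ar_entry (Suc 0) j) (\<eta> j') = (\<Sum>x | (j, x) \<in> Q. euler2 (\<eta> x) (\<eta> j')) + (\<Sum>x | (x, j) \<in> Q. euler2 (ar_entry 1 x) (\<eta> j'))"
    unfolding mesh[OF r(1)] by (simp add: euler2_add_left euler2_sum_left ar_entry_0)
  moreover have "2 \<le> (\<Sum>x | (j, x) \<in> Q. euler2 (\<eta> x) (\<eta> j'))"
  proof -
    have "euler2 (\<eta> j') (\<eta> j') \<le> (\<Sum>x | (j, x) \<in> Q. euler2 (\<eta> x) (\<eta> j'))"
      by (rule member_le_sum) (use finite_neighbours assms r euler2_Pos_eta eta_Pos arrow_range in auto)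
    then show ?thesis using euler2_eta_eta[OF r(2) r(2)] by simp
  qed
  moreover have "0 \<le> (\<Sum>x | (x, j) \<in> Q. euler2 (ar_entry 1 x) (\<eta> j'))"
  proof (rule sum_nonneg)
    fix x assume "x \<in> {x. (x, j) \<in> Q}"
    then have "valid x 1" using valid_pred v1 by blast
    then show "0 \<le> euler2 (ar_entry 1 x) (\<eta> j')" using euler2_Pos_eta r unfolding valid_def by blast
  qed
  moreover have "euler2 (ar_entry 0 j) (\<eta> j') = 0" using euler2_eta_eta[OF r(2,1)] nj by (simp add: ar_entry_0)
  ultimately show ?thesis by (simp add: euler2_add_left)
qed

lemma valid_succ: assumes "valid j (Suc k)" "(j, j') \<in> Q" shows "valid j' k"
proof (rule ccontr)
  assume nv: "\<not> valid j' k"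
  have r: "j \<in> {1..n}" "j' \<in> {1..n}" using assms arrow_range by auto
  obtain l where l: "l < k" "\<forall>x\<in>Pos. 0 \<le> euler2 (ar_entry l j') x" using not_valid[OF r(2) nv] by blast
  then have "0 \<le> euler2 (ar_entry l j') (ar_entry (Suc (Suc l)) j)" using assms unfolding valid_def by auto
  also have "\<dots> = - euler2 (ar_entry (Suc 0) j) (\<eta> j')"
    using euler2_ar_entry_Suc[OF r, of l "Suc l"] euler2_ar_entry_shift[OF r, of "Suc 0" l 0] by (simp add: ar_entry_0)
  also have "\<dots> \<le> - 2" using euler2_arrow_Suc[OF assms] by simp
  finally show False by simp
qed

abbreviation arrows where "arrows \<equiv> ar_arrows n Q \<xi> w"

lemma arrow_same: assumes "valid i k" "(j, i) \<in> Q"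
  shows "((i, \<xi> i - 2 * int k), (j, \<xi> j - 2 * int k)) \<in> arrows"
proof -
  have "valid j k" using valid_pred assms by blast
  have e: "\<xi> j - 2 * int k = \<xi> i - 2 * int k + 1" using xi_arrow[OF assms(2)] by simp
  have "adjacent n i j" using arrow_adjacent[OF assms(2)] unfolding adjacent_def by blast
  moreover have "(i, \<xi> i - 2 * int k) \<in> ar_vertices n Q \<xi> w" "(j, \<xi> j - 2 * int k) \<in> ar_vertices n Q \<xi> w"
    using assms(1) \<open>valid j k\<close> vertices_iff by blast+
  ultimately show ?thesis unfolding ar_arrows_def e by blast
qed

lemma arrow_next: assumes "valid i (Suc k)" "(i, j) \<in> Q"
  shows "((i, \<xi> i - 2 * int (Suc k)), (j, \<xi> j - 2 * int k)) \<in> arrows"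
proof -
  have "valid j k" using valid_succ assms by blast
  have e: "\<xi> j - 2 * int k = \<xi> i - 2 * int (Suc k) + 1" using xi_arrow[OF assms(2)] by simp
  have "adjacent n i j" using arrow_adjacent[OF assms(2)] .
  moreover have "(i, \<xi> i - 2 * int (Suc k)) \<in> ar_vertices n Q \<xi> w" "(j, \<xi> j - 2 * int k) \<in> ar_vertices n Q \<xi> w"
    using assms(1) \<open>valid j k\<close> vertices_iff by blast+
  ultimately show ?thesis unfolding ar_arrows_def e by blast
qed

lemma path_same_level: assumes "(i, j) \<in> Q\<^sup>*" "valid j k"
  shows "valid i k \<and> ((j, \<xi> j - 2 * int k), (i, \<xi> i - 2 * int k)) \<in> arrows\<^sup>*"
  using assms(1)
proof (induction rule: converse_rtrancl_induct)
  case base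
  then show ?case using assms by auto
next
  case (step x y)
  then show ?case using valid_pred[of y k x] arrow_same[of y k x] by (meson rtrancl.rtrancl_into_rtrancl)
qed

text \<open>
  Induction towards larger heights. As long as \<open>m > k\<close>, positivity of the form at the first
  vertex is inherited, through the mesh relation, by one of its right neighbours. For \<open>m = k\<close>
  a path within the slice \<open>k\<close> is read off from \<open>Q\<close>, and for \<open>m < k\<close> the form is not positive.
\<close>
lemma path_if_hom:
  assumes "valid i k" "valid j m" "0 < euler2 (ar_entry m j) (ar_entry k i)"
  shows "((j, \<xi> j - 2 * int m), (i, \<xi> i - 2 * int k)) \<in> arrows\<^sup>*"
proof -
  have i: "i \<in> {1..n}" using assms unfolding valid_def by auto
  have nonneg: "0 \<le> euler2 (ar_entry l x) (ar_entry k i)" if "valid x l" "k \<le> l" for x l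
  proof -
    have x: "x \<in> {1..n}" using that unfolding valid_def by auto
    have "euler2 (ar_entry l x) (ar_entry k i) = euler2 (ar_entry (l - k) x) (ar_entry 0 i)"
      using euler2_ar_entry_shift[OF x i, of "l - k" k 0] that by simp
    moreover have "ar_entry (l - k) x \<in> Pos" using that unfolding valid_def by auto
    ultimately show ?thesis using euler2_Pos_eta i by (simp add: ar_entry_0)
  qed
  obtain M where M: "\<forall>x\<in>{1..n}. \<xi> x \<le> M" using bdd_above_finite[of "\<xi> ` {1..n}"] unfolding bdd_above_def by auto
  show ?thesis using assms(2,3)
  proof (induction "nat (M - (\<xi> j - 2 * int m))" arbitrary: j m rule: less_induct)
    case less
    have j: "j \<in> {1..n}" using less.prems unfolding valid_def by auto
    consider "m < k" | "m = k" | m' where "m = Suc m'" "k \<le> m'" by (metis not_less_eq_eq linorder_neqE_nat not0_implies_Suc not_less_zero le_refl less_eq_Suc_le Suc_le_D)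
    then show ?case
    proof cases
      case 1
      define d where "d = k - Suc m"
      have "k = Suc d + m" using 1 unfolding d_def by simp
      then have "euler2 (ar_entry m j) (ar_entry k i) = euler2 (ar_entry 0 j) (ar_entry (Suc d) i)" using euler2_ar_entry_shift[OF j i, of 0 m "Suc d"] by simp
      also have "\<dots> = - euler2 (ar_entry d i) (\<eta> j)" using euler2_ar_entry_Suc[OF i j, of 0 d] by (simp add: ar_entry_0)
      also have "\<dots> \<le> 0" using assms(1) \<open>k = Suc d + m\<close> euler2_Pos_eta[OF _ j] unfolding valid_def by auto
      finally show ?thesis using less.prems by simp
    next
      case 2
      then have "0 < euler2 (\<eta> j) (\<eta> i)" using less.prems euler2_ar_entry_shift[OF j i, of 0 m 0] by (simp add: ar_entry_0)
      then have "(i, j) \<in> Q\<^sup>*" using euler2_eta_eta[OF i j] by (auto split: if_splits)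
      then show ?thesis using path_same_level[of i j k] 2 less.prems by blast
    next
      case (3 m')
      have vm: "valid j m'" using less.prems 3 unfolding valid_def by auto
      have "0 < euler2 (ar_entry m' j + ar_entry (Suc m') j) (ar_entry k i)" using less.prems 3 nonneg[OF vm] by (simp add: euler2_add_left)
      then have s: "0 < (\<Sum>x | (j, x) \<in> Q. euler2 (ar_entry m' x) (ar_entry k i)) + (\<Sum>x | (x, j) \<in> Q. euler2 (ar_entry (Suc m') x) (ar_entry k i))"
        unfolding mesh[OF j] by (simp add: euler2_add_left euler2_sum_left)
      have "(\<exists>x. (j, x) \<in> Q \<and> 0 < euler2 (ar_entry m' x) (ar_entry k i)) \<or> (\<exists>x. (x, j) \<in> Q \<and> 0 < euler2 (ar_entry (Suc m') x) (ar_entry k i))"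
      proof (rule ccontr)
        assume "\<not> ?thesis"
        then have "(\<Sum>x | (j, x) \<in> Q. euler2 (ar_entry m' x) (ar_entry k i)) \<le> 0" "(\<Sum>x | (x, j) \<in> Q. euler2 (ar_entry (Suc m') x) (ar_entry k i)) \<le> 0"
          by (auto intro!: sum_nonpos simp: not_less)
        then show False using s by simp
      qed
      then show ?thesis
      proof (elim disjE exE conjE)
        fix x assume x: "(j, x) \<in> Q" "0 < euler2 (ar_entry m' x) (ar_entry k i)"
        have v: "valid x m'" using valid_succ x less.prems 3 by blast
        then have "\<xi> x \<le> M" "\<xi> x = \<xi> j - 1" using M xi_arrow[OF x(1)] unfolding valid_def by blast+
        then have "nat (M - (\<xi> x - 2 * int m')) < nat (M - (\<xi> j - 2 * int m))" using 3 by auto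
        then have "((x, \<xi> x - 2 * int m'), (i, \<xi> i - 2 * int k)) \<in> arrows\<^sup>*" using less.hyps v x by blast
        then show ?thesis using arrow_next[of j m' x] x less.prems 3 by (meson converse_rtrancl_into_rtrancl)
      next
        fix x assume x: "(x, j) \<in> Q" "0 < euler2 (ar_entry (Suc m') x) (ar_entry k i)"
        have v: "valid x (Suc m')" using valid_pred x less.prems 3 by blast
        then have "\<xi> x \<le> M" "\<xi> j = \<xi> x - 1" using M xi_arrow[OF x(1)] unfolding valid_def by blast+
        then have "nat (M - (\<xi> x - 2 * int (Suc m'))) < nat (M - (\<xi> j - 2 * int m))" using 3 by auto
        then have "((x, \<xi> x - 2 * int (Suc m')), (i, \<xi> i - 2 * int k)) \<in> arrows\<^sup>*" using less.hyps v x by blast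
        then show ?thesis using arrow_same[of j "Suc m'" x] x less.prems 3 by (meson converse_rtrancl_into_rtrancl)
      qed
    qed
  qed
qed

text \<open>
  Walk from \<open>y\<close> backwards along its \<open>\<tau>\<close>-orbit up to the last negative root; its negative is a
  positive root that \<open>\<tau>\<close> makes negative, so the walk has arrived at some \<open>\<eta>\<^sub>i\<close>.
\<close>
lemma Pos_vertex: assumes "y \<in> Pos" obtains i k where "valid i k" "y = ar_entry k i"
proof -
  obtain N where N: "N > 0" "(\<tau> ^^ N) y = y" using tau_orbit_periodic[OF Pos_roots[OF assms]] .
  obtain k0 where "(\<tau> ^^ k0) y \<notin> Pos" using leaves_Pos[OF assms] by blast
  then have k0: "(\<tau> ^^ (k0 mod N)) y \<notin> Pos" using funpow_mod_eq[OF N(2)] by metis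
  define K where "K = Max {k. k < N \<and> (\<tau> ^^ k) y \<notin> Pos}"
  have fin: "finite {k. k < N \<and> (\<tau> ^^ k) y \<notin> Pos}" by simp
  have K: "K < N" "(\<tau> ^^ K) y \<notin> Pos"
    using Max_in[OF fin] k0 N(1) mod_less_divisor unfolding K_def by blast+
  have after: "(\<tau> ^^ k) y \<in> Pos" if "K < k" "k \<le> N" for k
  proof (cases "k = N")
    case True
    then show ?thesis using N assms by simp
  next
    case False
    show ?thesis
    proof (rule ccontr)
      assume "(\<tau> ^^ k) y \<notin> Pos"
      then have "k \<in> {k. k < N \<and> (\<tau> ^^ k) y \<notin> Pos}" using False that by simp
      then show False using Max_ge[OF fin] that unfolding K_def by (meson leD)
    qed
  qed
  define u where "u = - (\<tau> ^^ K) y"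
  have u: "u \<in> Pos" unfolding u_def using roots_cases[OF tau_power_roots[OF Pos_roots[OF assms]] K(2)] .
  have tu: "\<tau> u = - (\<tau> ^^ Suc K) y" unfolding u_def by (simp add: tau_minus)
  have "\<tau> u \<notin> Pos"
  proof
    assume "\<tau> u \<in> Pos"
    then obtain a b s where ab: "1 \<le> a" "a < b" "b \<le> n" "\<tau> u = pm_root a b s" unfolding Pos_iff by blast
    have "(\<tau> ^^ Suc K) y \<in> Pos" using after K by (simp del: funpow.simps)
    then obtain a' b' s' where ab': "1 \<le> a'" "a' < b'" "b' \<le> n" "(\<tau> ^^ Suc K) y = pm_root a' b' s'" unfolding Pos_iff by blast
    have "pm_root a b s = - pm_root a' b' s'" using ab(4) ab'(4) tu by (simp del: funpow.simps)
    then have e: "pm_root a b s x = - pm_root a' b' s' x" for x by (simp add: vec_apply)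
    show False using e[of a] e[of a'] ab ab' by (auto simp: pm_root_apply split: if_splits)
  qed
  then obtain i where i: "i \<in> {1..n}" "\<tau> u = - \<eta> i" using tau_not_Pos[OF u] by blast
  then have e: "\<eta> i = (\<tau> ^^ Suc K) y" using tu by (simp del: funpow.simps)
  have t: "ar_entry l i = (\<tau> ^^ (l + Suc K)) y" for l unfolding ar_entry_def e funpow_add by simp
  have "(\<tau> ^^ (l + Suc K)) y \<in> Pos" if "l \<le> N - Suc K" for l
    using after[of "l + Suc K"] that K by linarith
  then have "valid i (N - Suc K)" unfolding valid_def t using i by blast
  moreover have "y = ar_entry (N - Suc K) i" unfolding t using K N by simp
  ultimately show ?thesis using that by blast
qed

text \<open>
  For indecomposable representations with dimension vectors \<open>x\<close> and \<open>y\<close> this means that there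
  is a nonzero homomorphism.
\<close>
definition hom :: "vec \<Rightarrow> vec \<Rightarrow> bool" where
  "hom x y \<longleftrightarrow> x \<in> Pos \<and> y \<in> Pos \<and> 0 < euler2 x y"

lemma path_if_homs: assumes "hom\<^sup>*\<^sup>* x y" "valid j m" "x = ar_entry m j"
  shows "\<exists>i k. valid i k \<and> y = ar_entry k i \<and> ((j, \<xi> j - 2 * int m), (i, \<xi> i - 2 * int k)) \<in> arrows\<^sup>*"
  using assms(1)
proof (induction rule: rtranclp_induct)
  case base
  then show ?case using assms by blast
next
  case (step y z)
  then obtain i k where ik: "valid i k" "y = ar_entry k i" "((j, \<xi> j - 2 * int m), (i, \<xi> i - 2 * int k)) \<in> arrows\<^sup>*" by blast
  obtain i' k' where ik': "valid i' k'" "z = ar_entry k' i'" using Pos_vertex step(2) unfolding hom_def by blast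
  then have "((i, \<xi> i - 2 * int k), (i', \<xi> i' - 2 * int k')) \<in> arrows\<^sup>*"
    using path_if_hom[of i' k' i k] ik step(2) unfolding hom_def by blast
  then have "valid i' k' \<and> z = ar_entry k' i' \<and> ((j, \<xi> j - 2 * int m), (i', \<xi> i' - 2 * int k')) \<in> arrows\<^sup>*"
    using ik ik' by (blast intro: rtrancl_trans)
  then show ?case by blast
qed

lemma hom_if_arrow: assumes "(v, u) \<in> arrows" shows "hom (ar_root n Q \<xi> w v) (ar_root n Q \<xi> w u)"
proof -
  obtain i j p where vu: "v = (i, p)" "u = (j, p + 1)" "(i, p) \<in> ar_vertices n Q \<xi> w" "(j, p + 1) \<in> ar_vertices n Q \<xi> w" "adjacent n i j"
    using assms unfolding ar_arrows_def by blast
  obtain k where k: "p = \<xi> i - 2 * int k" "valid i k" using vu vertices_iff by blast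
  obtain l where l: "p + 1 = \<xi> j - 2 * int l" "valid j l" using vu vertices_iff by blast
  have r: "i \<in> {1..n}" "j \<in> {1..n}" using k l unfolding valid_def by auto
  have "0 < euler2 (ar_entry k i) (ar_entry l j)"
  proof -
    consider "(i, j) \<in> Q" | "(j, i) \<in> Q" using vu(5) dynkin unfolding adjacent_def dynkin_quiver_def by blast
    then show ?thesis
    proof cases
      case 1
      then have "k = Suc l" using xi_arrow[of i j] k l by simp
      moreover have "0 < euler2 (ar_entry (Suc 0) i) (\<eta> j)" using euler2_arrow_Suc[of i l j] 1 k \<open>k = Suc l\<close> by fastforce
      ultimately show ?thesis using euler2_ar_entry_shift[OF r, of "Suc 0" l 0] by (simp add: ar_entry_0)
    next
      case 2
      then have "k = l" using xi_arrow[of j i] k l by simp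
      then show ?thesis using euler2_ar_entry_shift[OF r, of 0 l 0] euler2_eta_eta[OF r(2,1)] 2 by (simp add: ar_entry_0)
    qed
  qed
  then show ?thesis using vu(1,2) k l root_vertex[of i k] root_vertex[of j l] unfolding hom_def valid_def by auto
qed

lemma prec_iff: "prec n Q \<xi> w y x \<and> x \<in> Pos \<longleftrightarrow> x \<noteq> y \<and> x \<in> Pos \<and> hom\<^sup>*\<^sup>* x y"
proof (intro iffI conjI; (elim conjE)?)
  assume p: "prec n Q \<xi> w y x" and x: "x \<in> Pos"
  then obtain u v where uv: "ar_root n Q \<xi> w u = y" "ar_root n Q \<xi> w v = x" "(v, u) \<in> arrows\<^sup>*"
    unfolding prec_def by blast
  show "x \<noteq> y" using p unfolding prec_def by blast
  have "hom\<^sup>*\<^sup>* (ar_root n Q \<xi> w v) (ar_root n Q \<xi> w u)" using uv(3)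
    by (induction rule: rtrancl_induct) (auto dest: hom_if_arrow intro: rtranclp.rtrancl_into_rtrancl)
  then show "hom\<^sup>*\<^sup>* x y" using uv by simp
  show "x \<in> Pos" by fact
next
  assume x: "x \<noteq> y" "x \<in> Pos" "hom\<^sup>*\<^sup>* x y"
  obtain j m where jm: "valid j m" "x = ar_entry m j" using Pos_vertex x by blast
  obtain i k where ik: "valid i k" "y = ar_entry k i" "((j, \<xi> j - 2 * int m), (i, \<xi> i - 2 * int k)) \<in> arrows\<^sup>*"
    using path_if_homs[OF x(3) jm] by blast
  then show "prec n Q \<xi> w y x" unfolding prec_def using x jm root_vertex vertices_iff by metis
qed auto

end

section \<open>Roots on a line of times\<close>

definition step_sign :: "int \<Rightarrow> int \<Rightarrow> int" where "step_sign x y = (if x \<le> y then 1 else - 1)"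

text \<open>
  With vectors \<open>e(t)\<close> subject to \<open>e(t + H) = - e(t)\<close>, the root \<open>e(x) + s e(y)\<close> is written as
  \<open>e(u) - e(l)\<close> with \<open>l < u < l + H\<close>; \<open>upper\<close> and \<open>lower\<close> are \<open>u\<close> and \<open>l\<close>. It is assumed that
  \<open>\<bar>x\<bar> < \<bar>y\<bar>\<close>, so that \<open>y\<close> is the earlier time iff it is negative.
\<close>
definition upper :: "int \<Rightarrow> int \<Rightarrow> int \<Rightarrow> int \<Rightarrow> int" where
  "upper H x y s = (if y < 0 then (if s = 1 then y else x) else (if s = 1 then x else y - H))"

definition lower :: "int \<Rightarrow> int \<Rightarrow> int \<Rightarrow> int \<Rightarrow> int" where
  "lower H x y s = (if y < 0 then (if s = 1 then x - H else y) else (if s = 1 then y - H else x - H))"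

text \<open>
  The time at which the vector on the line is the one at \<open>x\<close> multiplied by the sign \<open>e\<close>. For
  \<open>e = -1\<close> there are two nearest candidates; the only root concerned, a simple root at the
  vertex \<open>n - 1\<close>, has no path leaving it if \<open>x\<close> is the earliest time, and none entering it if
  \<open>x\<close> is the latest.
\<close>
definition spin_upper :: "int \<Rightarrow> int \<Rightarrow> int \<Rightarrow> int" where
  "spin_upper H x e = (if e = 1 then x else if x < 0 then x + H else x - H)"

text \<open>
  The next lemmas evaluate the form on \<open>c e(p) + d e(q)\<close> and \<open>c' e(p') + d' e(q')\<close>, where a
  root has one of three kinds: both times in the base window, one of them shifted by \<open>H\<close>, or
  both shifted.
\<close>
lemma form_base_base: "q < p \<Longrightarrow> q' < p' \<Longrightarrow> 0 < step_sign p p' - step_sign p q' - step_sign q p' + step_sign q q' \<Longrightarrow> p \<le> p' \<and> q \<le> q'"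
  unfolding step_sign_def by (auto split: if_splits)

lemma form_base_mixed: "q < p \<Longrightarrow> 0 < step_sign p p' + step_sign p q' - step_sign q p' - step_sign q q' \<Longrightarrow> False"
  unfolding step_sign_def by (auto split: if_splits)

lemma form_base_shifted: "q < p \<Longrightarrow> q' < p' \<Longrightarrow> q \<le> q' \<or> p \<le> p' \<Longrightarrow> 0 < - step_sign p p' + step_sign p q' + step_sign q p' - step_sign q q' \<Longrightarrow> False"
  unfolding step_sign_def by (auto split: if_splits)

lemma form_mixed_base: "p < q \<Longrightarrow> q' < p' \<Longrightarrow> 0 < step_sign p p' - step_sign p q' + step_sign q p' - step_sign q q' \<Longrightarrow> p \<le> p'"
  unfolding step_sign_def by (auto split: if_splits)

lemma form_mixed_mixed: "p < q \<Longrightarrow> p' < q' \<Longrightarrow> 0 < step_sign p p' + step_sign p q' + step_sign q p' + step_sign q q' \<Longrightarrow> p \<le> p' \<and> q \<le> q'"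
  unfolding step_sign_def by (auto split: if_splits)

lemma form_mixed_shifted: "q' < p' \<Longrightarrow> 0 < - step_sign p p' + step_sign p q' - step_sign q p' + step_sign q q' \<Longrightarrow> False"
  unfolding step_sign_def by (auto split: if_splits)

lemma form_shifted_mixed: "q < p \<Longrightarrow> p' < q' \<Longrightarrow> 0 < - step_sign p p' - step_sign p q' + step_sign q p' + step_sign q q' \<Longrightarrow> q \<le> q'"
  unfolding step_sign_def by (auto split: if_splits)

text \<open>
  Where the windows forbid that the coordinates increase, the form is not positive.
\<close>
lemma kinds_mono:
  fixes U L p q U' L' p' q' N H c d c' d' :: int
  assumes A: "U = p \<and> L = q \<and> c = 1 \<and> d = - 1 \<and> q < p \<or> U = p \<and> L = q - H \<and> c = 1 \<and> d = 1 \<and> p < q \<or>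
      U = p - H \<and> L = q - H \<and> c = - 1 \<and> d = 1 \<and> q < p"
    and A': "U' = p' \<and> L' = q' \<and> c' = 1 \<and> d' = - 1 \<and> q' < p' \<or> U' = p' \<and> L' = q' - H \<and> c' = 1 \<and> d' = 1 \<and> p' < q' \<or>
      U' = p' - H \<and> L' = q' - H \<and> c' = - 1 \<and> d' = 1 \<and> q' < p'"
    and b: "\<bar>p\<bar> \<le> N" "\<bar>q\<bar> \<le> N" "\<bar>p'\<bar> \<le> N" "\<bar>q'\<bar> \<le> N" "2 * N < H"
    and x: "c = 1 \<Longrightarrow> d = - 1 \<Longrightarrow> c' = - 1 \<Longrightarrow> d' = 1 \<Longrightarrow> q \<le> q' \<or> p \<le> p'"
    and E: "0 < c * c' * step_sign p p' + c * d' * step_sign p q' + d * c' * step_sign q p' + d * d' * step_sign q q'"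
  shows "U \<le> U' \<and> L \<le> L'"
  using A
proof (elim disjE)
  assume 0: "U = p \<and> L = q \<and> c = 1 \<and> d = - 1 \<and> q < p"
  show ?thesis using A'
  proof (elim disjE)
    assume 1: "U' = p' \<and> L' = q' \<and> c' = 1 \<and> d' = - 1 \<and> q' < p'"
    then show ?thesis using form_base_base[of q p q' p'] E 0 by simp
  next
    assume 1: "U' = p' \<and> L' = q' - H \<and> c' = 1 \<and> d' = 1 \<and> p' < q'"
    then show ?thesis using form_base_mixed[of q p p' q'] E 0 by simp
  next
    assume 1: "U' = p' - H \<and> L' = q' - H \<and> c' = - 1 \<and> d' = 1 \<and> q' < p'"
    then show ?thesis using form_base_shifted[of q p q' p'] E 0 x by simp
  qed
next
  assume 0: "U = p \<and> L = q - H \<and> c = 1 \<and> d = 1 \<and> p < q"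
  show ?thesis using A'
  proof (elim disjE)
    assume 1: "U' = p' \<and> L' = q' \<and> c' = 1 \<and> d' = - 1 \<and> q' < p'"
    then show ?thesis using form_mixed_base[of p q q' p'] E 0 b by simp
  next
    assume 1: "U' = p' \<and> L' = q' - H \<and> c' = 1 \<and> d' = 1 \<and> p' < q'"
    then show ?thesis using form_mixed_mixed[of p q p' q'] E 0 by simp
  next
    assume 1: "U' = p' - H \<and> L' = q' - H \<and> c' = - 1 \<and> d' = 1 \<and> q' < p'"
    then show ?thesis using form_mixed_shifted[of q' p' p q] E 0 by simp
  qed
next
  assume 0: "U = p - H \<and> L = q - H \<and> c = - 1 \<and> d = 1 \<and> q < p"
  show ?thesis using A'
  proof (elim disjE)
    assume 1: "U' = p' \<and> L' = q' \<and> c' = 1 \<and> d' = - 1 \<and> q' < p'"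
    then show ?thesis using 0 b by linarith
  next
    assume 1: "U' = p' \<and> L' = q' - H \<and> c' = 1 \<and> d' = 1 \<and> p' < q'"
    then have "q \<le> q'" using form_shifted_mixed[of q p p' q'] E 0 by simp
    then show ?thesis using 0 1 b by linarith
  next
    assume 1: "U' = p' - H \<and> L' = q' - H \<and> c' = - 1 \<and> d' = 1 \<and> q' < p'"
    then show ?thesis using form_base_base[of q p q' p'] E 0 by simp
  qed
qed

text \<open>
  The upper coordinate belongs to \<open>p\<close>, the lower one to \<open>q\<close>; the coefficients of \<open>e(p)\<close> and
  \<open>e(q)\<close> are \<open>c\<close> and \<open>d\<close>.
\<close>
lemma upper_lower_kinds:
  fixes x y s H :: int
  assumes "\<bar>x\<bar> < \<bar>y\<bar>" "s = 1 \<or> s = - 1"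
  defines "p \<equiv> (if (y < 0) = (s = 1) then y else x)" and "q \<equiv> (if (y < 0) = (s = 1) then x else y)"
    and "c \<equiv> (if (y < 0) = (s = 1) then s else 1)" and "d \<equiv> (if (y < 0) = (s = 1) then 1 else s)"
  shows "upper H x y s = p \<and> lower H x y s = q \<and> c = 1 \<and> d = - 1 \<and> q < p \<or> upper H x y s = p \<and> lower H x y s = q - H \<and> c = 1 \<and> d = 1 \<and> p < q \<or>
      upper H x y s = p - H \<and> lower H x y s = q - H \<and> c = - 1 \<and> d = 1 \<and> q < p"
proof (cases "y < 0")
  case True
  then show ?thesis using assms(1,2) unfolding p_def q_def c_def d_def upper_def lower_def by auto
next
  case False
  then show ?thesis using assms(1,2) unfolding p_def q_def c_def d_def upper_def lower_def by auto
qed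

lemma upper_lower_mono:
  fixes x y x' y' N H :: int
  assumes s: "s = 1 \<or> s = - 1" "t = 1 \<or> t = - 1" and xy: "\<bar>x\<bar> < \<bar>y\<bar>" "\<bar>x'\<bar> < \<bar>y'\<bar>" and b: "\<bar>y\<bar> \<le> N" "\<bar>y'\<bar> \<le> N" "2 * N < H" 
    and E: "0 < step_sign x x' + t * step_sign x y' + s * step_sign y x' + s * t * step_sign y y'"
  shows "upper H x y s \<le> upper H x' y' t \<and> lower H x y s \<le> lower H x' y' t"
proof (rule kinds_mono[OF upper_lower_kinds[OF xy(1) s(1)] upper_lower_kinds[OF xy(2) s(2)], where N = N])
  show "2 * N < H" by fact
  show "0 < (if (y < 0) = (s = 1) then s else 1) * (if (y' < 0) = (t = 1) then t else 1) *
         step_sign (if (y < 0) = (s = 1) then y else x) (if (y' < 0) = (t = 1) then y' else x') +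
         (if (y < 0) = (s = 1) then s else 1) * (if (y' < 0) = (t = 1) then 1 else t) *
         step_sign (if (y < 0) = (s = 1) then y else x) (if (y' < 0) = (t = 1) then x' else y') +
         (if (y < 0) = (s = 1) then 1 else s) * (if (y' < 0) = (t = 1) then t else 1) *
         step_sign (if (y < 0) = (s = 1) then x else y) (if (y' < 0) = (t = 1) then y' else x') +
         (if (y < 0) = (s = 1) then 1 else s) * (if (y' < 0) = (t = 1) then 1 else t) *
         step_sign (if (y < 0) = (s = 1) then x else y) (if (y' < 0) = (t = 1) then x' else y')"
    using E by (cases "(y < 0) = (s = 1)"; cases "(y' < 0) = (t = 1)") (simp_all add: algebra_simps)
  assume "(if (y < 0) = (s = 1) then s else 1) = 1" "(if (y < 0) = (s = 1) then 1 else s) = - 1"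
    "(if (y' < 0) = (t = 1) then t else 1) = - 1" "(if (y' < 0) = (t = 1) then 1 else t) = 1"
  then have st: "s = - 1" "y < 0" "t = - 1" "\<not> y' < 0" using s by (auto split: if_splits)
  show "(if (y < 0) = (s = 1) then x else y) \<le> (if (y' < 0) = (t = 1) then x' else y') \<or>
    (if (y < 0) = (s = 1) then y else x) \<le> (if (y' < 0) = (t = 1) then y' else x')"
    using st xy by simp linarith
qed (use xy b in \<open>auto split: if_splits\<close>)

lemma upper_lower_inj:
  fixes x y x' y' N H :: int
  assumes s: "s = 1 \<or> s = - 1" "t = 1 \<or> t = - 1" and xy: "\<bar>x\<bar> < \<bar>y\<bar>" "\<bar>x'\<bar> < \<bar>y'\<bar>" and b: "\<bar>y\<bar> \<le> N" "\<bar>y'\<bar> \<le> N" "2 * N < H" 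
    and e: "upper H x y s = upper H x' y' t" "lower H x y s = lower H x' y' t"
  shows "x = x' \<and> y = y' \<and> s = t"
  using s e
proof (elim disjE)
qed (cases "y < 0"; cases "y' < 0"; simp add: upper_def lower_def; use xy b in linarith)+

lemma upper_lower_width:
  fixes x y N H :: int
  assumes "s = 1 \<or> s = - 1" "\<bar>x\<bar> < \<bar>y\<bar>" "\<bar>y\<bar> \<le> N" "2 * N < H"
  shows "lower H x y s \<noteq> upper H x y s - H"
  using assms(1)
  by (elim disjE; cases "y < 0"; simp add: upper_def lower_def; use assms in linarith)

lemma spin_upper_inj:
  fixes x x' N H :: int
  assumes "e = 1 \<or> e = - 1" "e' = 1 \<or> e' = - 1" "\<bar>x\<bar> \<le> N" "\<bar>x'\<bar> \<le> N" "2 * N < H" "spin_upper H x e = spin_upper H x' e'" "x \<noteq> 0" "x' \<noteq> 0"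
  shows "x = x' \<and> e = e'"
  using assms(1,2)
  by (elim disjE; cases "x < 0"; cases "x' < 0"; use assms(6) in \<open>simp add: spin_upper_def\<close>; use assms in linarith)

lemma spin_upper_upper_lower:
  fixes x y x' N H :: int
  assumes "e = 1 \<or> e = - 1 \<and> \<bar>y'\<bar> \<le> \<bar>x\<bar>" "t = 1 \<or> t = - 1" "\<bar>x'\<bar> < \<bar>y'\<bar>" "\<bar>x\<bar> \<le> N" "\<bar>y'\<bar> \<le> N" "2 * N < H" 
    "x + x' \<noteq> 0" "x + y' \<noteq> 0" "0 < e * step_sign x x' + e * t * step_sign x y'"
  shows "spin_upper H x e \<le> upper H x' y' t \<and> spin_upper H x e - H \<le> lower H x' y' t"
  using assms(1,2)
  by (elim disjE conjE; cases "y' < 0"; use assms(9) in \<open>simp add: upper_def lower_def spin_upper_def step_sign_def split: if_splits\<close>; use assms(3-8) in linarith)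

lemma upper_lower_spin_upper:
  fixes x y x' N H :: int
  assumes "e = 1 \<or> e = - 1 \<and> \<bar>y\<bar> \<le> \<bar>x'\<bar>" "s = 1 \<or> s = - 1"
   "\<bar>x\<bar> < \<bar>y\<bar>" "\<bar>x'\<bar> \<le> N" "\<bar>y\<bar> \<le> N" "2 * N < H" 
    "x + x' \<noteq> 0" "y + x' \<noteq> 0" "0 < e * step_sign x x' + e * s * step_sign y x'"
  shows "upper H x y s \<le> spin_upper H x' e \<and> lower H x y s \<le> spin_upper H x' e - H"
  using assms(1,2)
  by (elim disjE conjE; cases "y < 0"; use assms(9) in \<open>simp add: upper_def lower_def spin_upper_def step_sign_def split: if_splits\<close>; use assms(3-8) in linarith)

lemma spin_upper_spin_upper:
  fixes x x' N H :: int
  assumes "e = 1 \<or> e = - 1 \<and> \<bar>x'\<bar> \<le> \<bar>x\<bar>" "e' = 1 \<or> e' = - 1 \<and> \<bar>x\<bar> \<le> \<bar>x'\<bar>" 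
    "\<bar>x\<bar> \<le> N" "\<bar>x'\<bar> \<le> N" "2 * N < H" "x + x' \<noteq> 0" "0 < e * e' * step_sign x x'" 
  shows "spin_upper H x e \<le> spin_upper H x' e'"
  using assms(1,2)
  by (elim disjE conjE; use assms(7) in \<open>simp add: spin_upper_def step_sign_def split: if_splits\<close>; use assms(3-6) in linarith)

section \<open>Two coordinates that increase along paths\<close>

context dquiver
begin

definition root_index :: "nat \<times> nat \<times> int \<Rightarrow> bool" where
  "root_index = (\<lambda>(a, b, s). 1 \<le> a \<and> a < b \<and> b \<le> n \<and> (s = 1 \<or> s = - 1))"

text \<open>
  Any number larger than all differences of times would do.
\<close>
abbreviation (input) antiperiod :: int where "antiperiod \<equiv> 2 * int n + 1"

definition upper_ix :: "nat \<times> nat \<times> int \<Rightarrow> int" where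
  "upper_ix = (\<lambda>(a, b, s). if b = spin then spin_upper antiperiod (time a) 1 else if a = spin then spin_upper antiperiod (time b) s else upper antiperiod (time a) (time b) s)"

definition lower_ix :: "nat \<times> nat \<times> int \<Rightarrow> int" where
  "lower_ix = (\<lambda>(a, b, s). if b = spin then spin_upper antiperiod (time a) 1 - antiperiod else if a = spin then spin_upper antiperiod (time b) s - antiperiod else lower antiperiod (time a) (time b) s)"

text \<open>
  The coefficient at the distinguished index; it separates the two roots that share both
  coordinates.
\<close>
definition spin_ix :: "nat \<times> nat \<times> int \<Rightarrow> int" where
  "spin_ix = (\<lambda>(a, b, s). if b = spin then s else if a = spin then 1 else 0)"

lemma euler2_eps_step_sign: "a \<noteq> spin \<Longrightarrow> b \<noteq> spin \<Longrightarrow> euler2_eps a b = step_sign (time a) (time b)"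
proof -
  assume ab: "a \<noteq> spin" "b \<noteq> spin"
  have "a = b \<or> time a \<noteq> time b" using time_abs[of a] time_abs[of b] by (metis of_nat_eq_iff)
  then show ?thesis using ab unfolding euler2_eps_def step_sign_def by auto
qed

lemma step_sign_self: "step_sign x x = 1" unfolding step_sign_def by simp

lemma euler2_eps_spin_iff: "euler2_eps a spin = (if a = spin then 1 else 0)" "euler2_eps spin a = (if a = spin then 1 else 0)"
  unfolding euler2_eps_def by auto

lemma time_less: "a < b \<Longrightarrow> \<bar>time a\<bar> < \<bar>time b\<bar>" using time_abs by simp

lemma time_bound: "a \<le> n \<Longrightarrow> \<bar>time a\<bar> \<le> int n" using time_abs by simp

lemma time_inj: assumes "time a = time b" shows "a = b"
proof -
  have "\<bar>time a\<bar> = \<bar>time b\<bar>" unfolding assms ..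
  then show ?thesis unfolding time_abs of_nat_eq_iff .
qed

lemma time_nonzero: "1 \<le> a \<Longrightarrow> time a \<noteq> 0" using time_abs[of a] by linarith

lemma time_sum: assumes "1 \<le> a" shows "time a + time b \<noteq> 0"
proof
  assume a: "time a + time b = 0"
  then have "\<bar>time a\<bar> = \<bar>time b\<bar>" by linarith
  then have "a = b" unfolding time_abs of_nat_eq_iff .
  then have "time a + time a = 0" using a by (simp only:)
  then show False using time_nonzero[OF assms] by linarith
qed

lemma spin_first_index: "a < b \<Longrightarrow> b \<le> n \<Longrightarrow> a = spin \<Longrightarrow> b = n" using spin_cases by linarith

lemma spin_range: "1 \<le> spin" "spin \<le> n" using spin_cases n4 by linarith+

text \<open>
  \<open>p\<close> is the index of the root \<open>e \<epsilon>\<^sub>x + h \<epsilon>\<^sub>f\<close> with \<open>f = spin\<close>.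
\<close>
inductive spinroot :: "nat \<times> nat \<times> int \<Rightarrow> nat \<Rightarrow> int \<Rightarrow> int \<Rightarrow> bool" where
  right: "1 \<le> x \<Longrightarrow> x < spin \<Longrightarrow> h = 1 \<or> h = - 1 \<Longrightarrow> spinroot (x, spin, h) x 1 h"
| left: "spin < n \<Longrightarrow> spin \<noteq> n \<Longrightarrow> e = 1 \<or> e = - 1 \<Longrightarrow> spinroot (spin, n, e) n e 1"

lemma spinroot_exists:
  assumes "root_index (a, b, s)" "a = spin \<or> b = spin"
  shows "\<exists>x e h. spinroot (a, b, s) x e h"
proof (cases "b = spin")
  case True
  then have "spinroot (a, b, s) a 1 s" using assms right unfolding root_index_def by simp
  then show ?thesis by blast
next
  case False
  then have "a = spin" "b = n" using assms spin_first_index unfolding root_index_def by auto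
  then have "spinroot (a, b, s) n s 1" using assms False left unfolding root_index_def by simp
  then show ?thesis by blast
qed

lemma spinroot_values:
  assumes "spinroot p x e h"
  shows "upper_ix p = spin_upper antiperiod (time x) e" "lower_ix p = spin_upper antiperiod (time x) e - antiperiod" "spin_ix p = h" "e = 1 \<or> e = - 1 \<and> x = n" "h = 1 \<or> h = - 1"
proof -
  have "upper_ix p = spin_upper antiperiod (time x) e \<and> lower_ix p = spin_upper antiperiod (time x) e - antiperiod \<and> spin_ix p = h \<and> (e = 1 \<or> e = - 1 \<and> x = n) \<and> (h = 1 \<or> h = - 1)"
    using assms
  proof cases
    case right
    show ?thesis using right(5) unfolding right(1,2) upper_ix_def lower_ix_def spin_ix_def prod.case by simp
  next
    case left
    have "(n = spin) = False" using left(5) by simp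
    then show ?thesis using left(6) unfolding left(1,2,3) upper_ix_def lower_ix_def spin_ix_def prod.case by simp
  qed
  then show "upper_ix p = spin_upper antiperiod (time x) e" "lower_ix p = spin_upper antiperiod (time x) e - antiperiod" "spin_ix p = h" "e = 1 \<or> e = - 1 \<and> x = n" "h = 1 \<or> h = - 1"
    by blast+
qed

lemma spinroot_index: assumes "spinroot p x e h" shows "1 \<le> x" "x \<le> n" "x \<noteq> spin"
proof -
  have "1 \<le> x \<and> x \<le> n \<and> x \<noteq> spin"
    using assms
  proof cases
    case right
    then show ?thesis using spin_range by simp
  next
    case left
    show ?thesis unfolding left(2) using left(5) n4 by auto
  qed
  then show "1 \<le> x" "x \<le> n" "x \<noteq> spin" by blast+
qed

lemma spinroot_range: assumes "spinroot (a, b, s) x e h" shows "a \<in> {1..n} \<and> b \<in> {1..n}"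
  using assms
proof cases
  case right
  then show ?thesis using spin_range by simp
next
  case left
  then show ?thesis using spin_range n4 by simp
qed

lemma spinroot_unique: assumes "spinroot p x e h" "spinroot p' x e h" shows "p = p'"
  using assms(1)
proof cases
  case 1: right
  show ?thesis using assms(2)
  proof cases
    case right
    show ?thesis unfolding right(1) 1(1) by (rule refl)
  next
    case left
    then show ?thesis using 1(4) spin_range by simp
  qed
next
  case 1: left
  show ?thesis using assms(2)
  proof cases
    case right
    then show ?thesis using 1(2) spin_range by simp
  next
    case left
    show ?thesis unfolding left(1) 1(1) by (rule refl)
  qed
qed

lemma euler2_spin_left:
  assumes "spinroot (a, b, s) x e h" "c \<in> {1..n}" "d \<in> {1..n}" "c \<noteq> spin" "d \<noteq> spin"
  shows "euler2 (pm_root a b s) (pm_root c d t) = e * step_sign (time x) (time c) + e * t * step_sign (time x) (time d)"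
proof -
  have ab: "a \<in> {1..n}" "b \<in> {1..n}" using spinroot_range[OF assms(1)] by auto
  show ?thesis using assms unfolding euler2_pm_root[OF ab assms(2,3)]
    by (elim spinroot.cases) (simp_all add: euler2_eps_spin_iff euler2_eps_step_sign step_sign_self)
qed

lemma euler2_spin_right:
  assumes "spinroot (a, b, s) x e h" "c \<in> {1..n}" "d \<in> {1..n}" "c \<noteq> spin" "d \<noteq> spin"
  shows "euler2 (pm_root c d t) (pm_root a b s) = e * step_sign (time c) (time x) + e * t * step_sign (time d) (time x)"
proof -
  have ab: "a \<in> {1..n}" "b \<in> {1..n}" using spinroot_range[OF assms(1)] by auto
  show ?thesis using assms unfolding euler2_pm_root[OF assms(2,3) ab]
    by (elim spinroot.cases) (simp_all add: euler2_eps_spin_iff euler2_eps_step_sign step_sign_self)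
qed

lemma euler2_spin_spin:
  assumes "spinroot (a, b, s) x e h" "spinroot (c, d, t) y e' h'"
  shows "euler2 (pm_root a b s) (pm_root c d t) = e * e' * step_sign (time x) (time y) + h * h'"
proof -
  have ab: "a \<in> {1..n}" "b \<in> {1..n}" "c \<in> {1..n}" "d \<in> {1..n}" using spinroot_range[OF assms(1)] spinroot_range[OF assms(2)] by auto
  show ?thesis using assms unfolding euler2_pm_root[OF ab]
    by (elim spinroot.cases) (simp_all add: euler2_eps_spin_iff euler2_eps_step_sign step_sign_self)
qed

lemma upper_ix_generic: "a \<noteq> spin \<Longrightarrow> b \<noteq> spin \<Longrightarrow> upper_ix (a, b, s) = upper antiperiod (time a) (time b) s"
  unfolding upper_ix_def by simp

lemma lower_ix_generic: "a \<noteq> spin \<Longrightarrow> b \<noteq> spin \<Longrightarrow> lower_ix (a, b, s) = lower antiperiod (time a) (time b) s"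
  unfolding lower_ix_def by simp

lemma spin_ix_generic: "a \<noteq> spin \<Longrightarrow> b \<noteq> spin \<Longrightarrow> spin_ix (a, b, s) = 0"
  unfolding spin_ix_def by simp

lemmas index_coords_generic = upper_ix_generic lower_ix_generic spin_ix_generic

text \<open>
  All other roots have coordinates at distance less than the antiperiod.
\<close>
lemma spin_iff:
  assumes "root_index (a, b, s)"
  shows "a = spin \<or> b = spin \<longleftrightarrow> lower_ix (a, b, s) = upper_ix (a, b, s) - antiperiod"
proof (cases "a = spin \<or> b = spin")
  case True
  then obtain x e h where "spinroot (a, b, s) x e h" using spinroot_exists[OF assms] by blast
  then show ?thesis using True spinroot_values(1,2) by simp
next
  case False
  have "\<bar>time a\<bar> < \<bar>time b\<bar>" "\<bar>time b\<bar> \<le> int n" "s = 1 \<or> s = - 1"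
    using assms time_less time_bound unfolding root_index_def by simp_all
  then have "lower antiperiod (time a) (time b) s \<noteq> upper antiperiod (time a) (time b) s - antiperiod" by (intro upper_lower_width) simp_all
  then show ?thesis using False index_coords_generic[of a b s] by simp
qed

lemma index_coords_inj:
  assumes p: "root_index (a, b, s)" and q: "root_index (c, d, t)"
    and e: "upper_ix (a, b, s) = upper_ix (c, d, t)" "lower_ix (a, b, s) = lower_ix (c, d, t)" "spin_ix (a, b, s) = spin_ix (c, d, t)"
  shows "(a, b, s) = (c, d, t)"
proof (cases "a = spin \<or> b = spin")
  case True
  then have "c = spin \<or> d = spin" using spin_iff[OF p] spin_iff[OF q] unfolding e(1,2) by blast
  then obtain y e' h' where 2: "spinroot (c, d, t) y e' h'" using spinroot_exists[OF q] by blast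
  obtain x e0 h where 1: "spinroot (a, b, s) x e0 h" using True spinroot_exists[OF p] by blast
  note v1 = spinroot_values[OF 1] and v2 = spinroot_values[OF 2]
  have "time x = time y \<and> e0 = e'"
  proof (rule spin_upper_inj[where N = "int n" and H = antiperiod])
    show "spin_upper antiperiod (time x) e0 = spin_upper antiperiod (time y) e'" using v1(1) v2(1) e(1) by (simp only:)
    show "e0 = 1 \<or> e0 = - 1" "e' = 1 \<or> e' = - 1" using v1(4) v2(4) by blast+
  qed (use spinroot_index[OF 1] spinroot_index[OF 2] time_bound time_nonzero in simp_all)
  moreover have "h = h'" using v1(3) v2(3) e(3) by (simp only:)
  ultimately have "x = y" "e0 = e'" "h = h'" using time_inj[of x y] by blast+
  then show ?thesis using spinroot_unique[of "(a, b, s)" x e0 h "(c, d, t)"] 1 2 by blast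
next
  case False
  then have ns: "c \<noteq> spin" "d \<noteq> spin" "a \<noteq> spin" "b \<noteq> spin"
    using spin_iff[OF p] spin_iff[OF q] unfolding e(1,2) by blast+
  note g1 = index_coords_generic[OF ns(3,4)] and g2 = index_coords_generic[OF ns(1,2)]
  have "time a = time c \<and> time b = time d \<and> s = t"
  proof (rule upper_lower_inj[where N = "int n" and H = antiperiod])
    show "upper antiperiod (time a) (time b) s = upper antiperiod (time c) (time d) t" using g1(1) g2(1) e(1) by (simp only:)
    show "lower antiperiod (time a) (time b) s = lower antiperiod (time c) (time d) t" using g1(2) g2(2) e(2) by (simp only:)
    show "s = 1 \<or> s = - 1" "t = 1 \<or> t = - 1" using p q unfolding root_index_def by simp_all
  qed (use p q time_less time_bound in \<open>simp_all add: root_index_def\<close>)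
  then have "a = c" "b = d" "s = t" using time_inj by blast+
  then show ?thesis by blast
qed

lemma index_coords_mono:
  assumes p: "root_index (a, b, s)" and q: "root_index (c, d, t)" and E: "0 < euler2 (pm_root a b s) (pm_root c d t)"
  shows "upper_ix (a, b, s) \<le> upper_ix (c, d, t) \<and> lower_ix (a, b, s) \<le> lower_ix (c, d, t)"
proof -
  have r: "a \<in> {1..n}" "b \<in> {1..n}" "c \<in> {1..n}" "d \<in> {1..n}" "a < b" "c < d"
     "s = 1 \<or> s = - 1" "t = 1 \<or> t = - 1" using p q unfolding root_index_def prod.case by simp_all
  have N: "2 * int n < antiperiod" by simp
  consider "a \<noteq> spin" "b \<noteq> spin" "c \<noteq> spin" "d \<noteq> spin" | "a = spin \<or> b = spin" "c \<noteq> spin" "d \<noteq> spin"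
    | "a \<noteq> spin" "b \<noteq> spin" "c = spin \<or> d = spin" | "a = spin \<or> b = spin" "c = spin \<or> d = spin" by blast
  then show ?thesis
  proof cases
    case 1
    have "0 < step_sign (time a) (time c) + t * step_sign (time a) (time d) + s * step_sign (time b) (time c) + s * t * step_sign (time b) (time d)"
      using E 1 by (simp add: euler2_pm_root[OF r(1-4)] euler2_eps_step_sign)
    then show ?thesis using upper_lower_mono[OF r(7,8) time_less[OF r(5)] time_less[OF r(6)] _ _ N] r 1 time_bound
      unfolding upper_ix_def lower_ix_def by simp
  next
    case 2
    then obtain x e h where 1: "spinroot (a, b, s) x e h" using spinroot_exists p by blast
    have x: "1 \<le> x" "x \<le> n" using spinroot_index[OF 1] by auto
    have e: "e = 1 \<or> e = - 1 \<and> \<bar>time d\<bar> \<le> \<bar>time x\<bar>" using spinroot_values(4)[OF 1] r time_abs by auto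
    have "0 < e * step_sign (time x) (time c) + e * t * step_sign (time x) (time d)" using E 2 euler2_spin_left[OF 1 r(3,4)] by simp
    then show ?thesis
      using spin_upper_upper_lower[OF e r(8) time_less[OF r(6)] _ _ N] x r time_bound time_sum spinroot_values[OF 1] 2
      unfolding upper_ix_def[of] lower_ix_def[of] by simp
  next
    case 3
    then obtain x e h where 1: "spinroot (c, d, t) x e h" using spinroot_exists q by blast
    have x: "1 \<le> x" "x \<le> n" using spinroot_index[OF 1] by auto
    have e: "e = 1 \<or> e = - 1 \<and> \<bar>time b\<bar> \<le> \<bar>time x\<bar>" using spinroot_values(4)[OF 1] r time_abs by auto
    have "0 < e * step_sign (time a) (time x) + e * s * step_sign (time b) (time x)" using E 3 euler2_spin_right[OF 1 r(1,2)] by simp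
    then show ?thesis
      using upper_lower_spin_upper[OF e r(7) time_less[OF r(5)] _ _ N] x r time_bound time_sum spinroot_values[OF 1] 3
      unfolding upper_ix_def[of] lower_ix_def[of] by simp
  next
    case 4
    obtain x e h where 1: "spinroot (a, b, s) x e h" using spinroot_exists p 4 by blast
    obtain y e' h' where 2: "spinroot (c, d, t) y e' h'" using spinroot_exists q 4 by blast
    have x: "1 \<le> x" "x \<le> n" "1 \<le> y" "y \<le> n" using spinroot_index[OF 1] spinroot_index[OF 2] by auto
    have e: "e = 1 \<or> e = - 1 \<and> \<bar>time y\<bar> \<le> \<bar>time x\<bar>" using spinroot_values(4)[OF 1] x time_abs by auto
    have e': "e' = 1 \<or> e' = - 1 \<and> \<bar>time x\<bar> \<le> \<bar>time y\<bar>" using spinroot_values(4)[OF 2] x time_abs by auto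
    have s: "0 < e * e' * step_sign (time x) (time y) + h * h'" using E euler2_spin_spin[OF 1 2] by simp
    have "e * e' * step_sign (time x) (time y) = 1 \<or> e * e' * step_sign (time x) (time y) = - 1" using e e' unfolding step_sign_def by auto
    moreover have "h * h' = 1 \<or> h * h' = - 1" using spinroot_values(5)[OF 1] spinroot_values(5)[OF 2] by auto
    ultimately have "0 < e * e' * step_sign (time x) (time y)" using s by auto
    then have "spin_upper antiperiod (time x) e \<le> spin_upper antiperiod (time y) e'"
      using spin_upper_spin_upper[OF e e' _ _ N] time_bound time_sum x by simp
    then show ?thesis using spinroot_values[OF 1] spinroot_values[OF 2] by simp
  qed
qed

text \<open>
  Different roots with the same coordinates are \<open>v + \<epsilon>\<^sub>f\<close> and \<open>v - \<epsilon>\<^sub>f\<close>, and the form vanishes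
  on them.
\<close>
lemma index_coords_strict:
  assumes p: "root_index (a, b, s)" and q: "root_index (c, d, t)" and E: "0 < euler2 (pm_root a b s) (pm_root c d t)"
    and e: "upper_ix (a, b, s) = upper_ix (c, d, t)" "lower_ix (a, b, s) = lower_ix (c, d, t)"
  shows "(a, b, s) = (c, d, t)"
proof (cases "spin_ix (a, b, s) = spin_ix (c, d, t)")
  case True
  then show ?thesis using index_coords_inj[OF p q e] by blast
next
  case False
  have N: "2 * int n < antiperiod" by simp
  have "(a = spin \<or> b = spin) = (c = spin \<or> d = spin)" using spin_iff[OF p] spin_iff[OF q] unfolding e by blast
  then have "(a = spin \<or> b = spin) \<and> (c = spin \<or> d = spin)"
    using False index_coords_generic(3)[of a b s] index_coords_generic(3)[of c d t] by (cases "a = spin \<or> b = spin") simp_all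
  then obtain x e0 h y e' h' where 1: "spinroot (a, b, s) x e0 h" and 2: "spinroot (c, d, t) y e' h'"
    using spinroot_exists[OF p] spinroot_exists[OF q] by blast
  have xy: "1 \<le> x" "x \<le> n" "1 \<le> y" "y \<le> n" using spinroot_index[OF 1] spinroot_index[OF 2] by auto
  note v1 = spinroot_values[OF 1] and v2 = spinroot_values[OF 2]
  have "time x = time y \<and> e0 = e'"
  proof (rule spin_upper_inj[where N = "int n" and H = antiperiod])
    show "spin_upper antiperiod (time x) e0 = spin_upper antiperiod (time y) e'" using v1(1) v2(1) e(1) by (simp only:)
    show "e0 = 1 \<or> e0 = - 1" "e' = 1 \<or> e' = - 1" using v1(4) v2(4) by blast+
  qed (use xy time_bound time_nonzero in simp_all)
  moreover have "h * h' = - 1" using False v1(3,5) v2(3,5) by auto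
  ultimately have "euler2 (pm_root a b s) (pm_root c d t) = 0"
    using spinroot_values(4)[OF 1] unfolding euler2_spin_spin[OF 1 2] step_sign_def by auto
  then show ?thesis using E by simp
qed

lemma pm_root_inj: assumes "root_index (a, b, s)" "root_index (c, d, t)" "pm_root a b s = pm_root c d t" shows "(a, b, s) = (c, d, t)"
proof -
  have e: "pm_root a b s x = pm_root c d t x" for x unfolding assms(3) ..
  have o: "a < b" "c < d" "s = 1 \<or> s = - 1" "t = 1 \<or> t = - 1" using assms(1,2) unfolding root_index_def prod.case by blast+
  have "a = c" using e[of a] e[of c] o by (auto simp: pm_root_apply split: if_splits)
  moreover have "b = d" using e[of b] e[of d] o \<open>a = c\<close> by (auto simp: pm_root_apply split: if_splits)
  moreover have "s = t" using e[of b] o \<open>a = c\<close> \<open>b = d\<close> by (auto simp: pm_root_apply split: if_splits)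
  ultimately show ?thesis by simp
qed

definition index_of :: "vec \<Rightarrow> nat \<times> nat \<times> int" where
  "index_of v = (THE p. root_index p \<and> v = (case p of (a, b, s) \<Rightarrow> pm_root a b s))"

lemma index_pm_root: assumes "root_index (a, b, s)" shows "index_of (pm_root a b s) = (a, b, s)"
  unfolding index_of_def
proof (rule the_equality)
  show "root_index (a, b, s) \<and> pm_root a b s = (case (a, b, s) of (a, b, s) \<Rightarrow> pm_root a b s)"
    unfolding prod.case using assms by (intro conjI refl)
next
  fix p assume p: "root_index p \<and> pm_root a b s = (case p of (a, b, s) \<Rightarrow> pm_root a b s)"
  obtain c d t where q: "p = (c, d, t)" by (rule prod_cases3)
  have "root_index (c, d, t)" "pm_root c d t = pm_root a b s" using p unfolding q prod.case by (blast, metis)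
  then show "p = (a, b, s)" unfolding q using pm_root_inj assms by blast
qed

lemma Pos_index: "v \<in> Pos \<longleftrightarrow> (\<exists>a b s. root_index (a, b, s) \<and> v = pm_root a b s)"
  unfolding Pos_iff root_index_def prod.case by blast

text \<open>
  Small elements have large first and second keys, since the coordinates decrease towards
  larger roots; the third key only breaks ties.
\<close>
definition lex_less :: "(vec \<Rightarrow> int) \<Rightarrow> (vec \<Rightarrow> int) \<Rightarrow> (vec \<Rightarrow> int) \<Rightarrow> vec \<Rightarrow> vec \<Rightarrow> bool" where
  "lex_less k1 k2 k3 x y \<longleftrightarrow> k1 y < k1 x \<or> k1 x = k1 y \<and> (k2 y < k2 x \<or> k2 x = k2 y \<and> k3 x < k3 y)"

definition upper_vec :: "vec \<Rightarrow> int" where "upper_vec v = upper_ix (index_of v)"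

definition lower_vec :: "vec \<Rightarrow> int" where "lower_vec v = lower_ix (index_of v)"

definition spin_vec :: "vec \<Rightarrow> int" where "spin_vec v = spin_ix (index_of v)"

lemma Pos_coords: assumes "x \<in> Pos"
  obtains a b s where "root_index (a, b, s)" "x = pm_root a b s"
    "upper_vec x = upper_ix (a, b, s)" "lower_vec x = lower_ix (a, b, s)" "spin_vec x = spin_ix (a, b, s)"
proof -
  obtain a b s where p: "root_index (a, b, s)" "x = pm_root a b s" using assms Pos_index by blast
  have "index_of x = (a, b, s)" unfolding p(2) by (rule index_pm_root[OF p(1)])
  then show ?thesis using that[OF p] unfolding upper_vec_def lower_vec_def spin_vec_def by (simp only: simp_thms)
qed

lemma coords_vec_inj: assumes "x \<in> Pos" "y \<in> Pos" "upper_vec x = upper_vec y" "lower_vec x = lower_vec y" "spin_vec x = spin_vec y" shows "x = y"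
proof -
  obtain a b s where p: "root_index (a, b, s)" "x = pm_root a b s" "upper_vec x = upper_ix (a, b, s)" "lower_vec x = lower_ix (a, b, s)" "spin_vec x = spin_ix (a, b, s)"
    using Pos_coords[OF assms(1)] .
  obtain c d t where q: "root_index (c, d, t)" "y = pm_root c d t" "upper_vec y = upper_ix (c, d, t)" "lower_vec y = lower_ix (c, d, t)" "spin_vec y = spin_ix (c, d, t)"
    using Pos_coords[OF assms(2)] .
  have "(a, b, s) = (c, d, t)" using index_coords_inj[OF p(1) q(1)] assms(3-5) unfolding p(3-5) q(3-5) by blast
  then show ?thesis unfolding p(2) q(2) by simp
qed

lemma coords_vec_mono: assumes "x \<in> Pos" "y \<in> Pos" "0 < euler2 x y"
  shows "upper_vec x \<le> upper_vec y \<and> lower_vec x \<le> lower_vec y \<and> (upper_vec x = upper_vec y \<longrightarrow> lower_vec x = lower_vec y \<longrightarrow> x = y)"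
proof -
  obtain a b s where p: "root_index (a, b, s)" "x = pm_root a b s" "upper_vec x = upper_ix (a, b, s)" "lower_vec x = lower_ix (a, b, s)" "spin_vec x = spin_ix (a, b, s)"
    using Pos_coords[OF assms(1)] .
  obtain c d t where q: "root_index (c, d, t)" "y = pm_root c d t" "upper_vec y = upper_ix (c, d, t)" "lower_vec y = lower_ix (c, d, t)" "spin_vec y = spin_ix (c, d, t)"
    using Pos_coords[OF assms(2)] .
  have E: "0 < euler2 (pm_root a b s) (pm_root c d t)" using assms(3) unfolding p(2) q(2) .
  have "(a, b, s) = (c, d, t) \<Longrightarrow> x = y" unfolding p(2) q(2) by simp
  then show ?thesis
    using index_coords_mono[OF p(1) q(1) E] index_coords_strict[OF p(1) q(1) E] unfolding p(3,4) q(3,4) by blast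
qed

definition order_by :: "(vec \<Rightarrow> vec \<Rightarrow> bool) \<Rightarrow> vec rel" where
  "order_by lt = {(x, y). x \<in> Pos \<and> y \<in> Pos \<and> lt x y}"

end

section \<open>Two compatible orders\<close>

context ar
begin

lemma homs_mono: assumes "hom\<^sup>*\<^sup>* x y"
  shows "x = y \<or> upper_vec x \<le> upper_vec y \<and> lower_vec x \<le> lower_vec y \<and> (upper_vec x \<noteq> upper_vec y \<or> lower_vec x \<noteq> lower_vec y)"
  using assms
proof (induction rule: rtranclp_induct)
  case (step y z)
  have s: "upper_vec y \<le> upper_vec z" "lower_vec y \<le> lower_vec z" "y = z \<or> upper_vec y \<noteq> upper_vec z \<or> lower_vec y \<noteq> lower_vec z"
    using step(2) coords_vec_mono[of y z] unfolding hom_def by blast+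
  from step(3) show ?case
  proof
    assume "x = y"
    then show ?thesis using s by blast
  next
    assume "upper_vec x \<le> upper_vec y \<and> lower_vec x \<le> lower_vec y \<and> (upper_vec x \<noteq> upper_vec y \<or> lower_vec x \<noteq> lower_vec y)"
    then have "upper_vec x \<le> upper_vec z \<and> lower_vec x \<le> lower_vec z \<and> (upper_vec x \<noteq> upper_vec z \<or> lower_vec x \<noteq> lower_vec z)" using s(1,2) by linarith
    then show ?thesis by blast
  qed
qed blast

lemma prec_mono: assumes "prec n Q \<xi> w y x" "x \<in> Pos"
  shows "upper_vec x \<le> upper_vec y \<and> lower_vec x \<le> lower_vec y \<and> (upper_vec x \<noteq> upper_vec y \<or> lower_vec x \<noteq> lower_vec y)"
  using homs_mono prec_iff assms by blast

lemma compatible_order_by: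
  assumes "\<And>x y. x \<in> Pos \<Longrightarrow> y \<in> Pos \<Longrightarrow> k1 x = k1 y \<Longrightarrow> k2 x = k2 y \<Longrightarrow> k3 x = k3 y \<Longrightarrow> x = y"
    and "\<And>x y. x \<in> Pos \<Longrightarrow> prec n Q \<xi> w y x \<Longrightarrow> k1 x \<le> k1 y \<and> k2 x \<le> k2 y \<and> (k1 x \<noteq> k1 y \<or> k2 x \<noteq> k2 y)"
  shows "compatible_order n Q \<xi> w (order_by (lex_less k1 k2 k3))"
proof -
  have "trans (order_by (lex_less k1 k2 k3))" unfolding trans_def order_by_def lex_less_def by auto
  moreover have "irrefl (order_by (lex_less k1 k2 k3))" unfolding irrefl_def order_by_def lex_less_def by auto
  moreover have "total_on Pos (order_by (lex_less k1 k2 k3))"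
    unfolding total_on_def
  proof (intro ballI impI)
    fix x y assume xy: "x \<in> Pos" "y \<in> Pos" "x \<noteq> y"
    then have "k1 x \<noteq> k1 y \<or> k2 x \<noteq> k2 y \<or> k3 x \<noteq> k3 y" using assms(1) by blast
    then have "lex_less k1 k2 k3 x y \<or> lex_less k1 k2 k3 y x" unfolding lex_less_def by linarith
    then show "(x, y) \<in> order_by (lex_less k1 k2 k3) \<or> (y, x) \<in> order_by (lex_less k1 k2 k3)" using xy unfolding order_by_def by blast
  qed
  moreover have "(y, x) \<in> order_by (lex_less k1 k2 k3)" if "y \<in> Pos" "x \<in> Pos" "prec n Q \<xi> w y x" for x y
    using assms(2)[OF that(2,3)] that unfolding order_by_def lex_less_def by auto
  ultimately show ?thesis unfolding compatible_order_def strict_linear_order_on_def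
    by (auto simp: order_by_def)
qed

lemma compatible_upper: assumes "e = 1 \<or> e = - 1" shows "compatible_order n Q \<xi> w (order_by (lex_less upper_vec lower_vec (\<lambda>v. e * spin_vec v)))"
  by (rule compatible_order_by) (use assms coords_vec_inj prec_mono in auto)

lemma compatible_lower: assumes "e = 1 \<or> e = - 1" shows "compatible_order n Q \<xi> w (order_by (lex_less lower_vec upper_vec (\<lambda>v. e * spin_vec v)))"
  by (rule compatible_order_by) (use assms coords_vec_inj prec_mono in auto)

end

section \<open>Splittings that lie inside one another\<close>

definition lex3_less :: "int \<times> int \<times> int \<Rightarrow> int \<times> int \<times> int \<Rightarrow> bool" where
  "lex3_less = (\<lambda>(u, l, s) (u', l', s'). u' < u \<or> u = u' \<and> (l' < l \<or> l = l' \<and> s < s'))"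

lemma lex3_less_simp: "lex3_less (u, l, s) (u', l', s') \<longleftrightarrow> u' < u \<or> u = u' \<and> (l' < l \<or> l = l' \<and> s < s')"
  unfolding lex3_less_def by simp

text \<open>
  Coordinates of the two parts \<open>x\<close> and \<open>y\<close> of a root with indices \<open>a < b\<close> and \<open>b \<noteq> spin\<close>,
  where \<open>A\<close> and \<open>B\<close> are the times of \<open>a\<close> and \<open>b\<close>: either the parts share an index of time \<open>C\<close>,
  or they share the distinguished index.
\<close>
definition generic_split :: "int \<Rightarrow> int \<Rightarrow> int \<Rightarrow> int \<Rightarrow> int \<Rightarrow> int \<Rightarrow> int \<Rightarrow> int \<Rightarrow> int \<Rightarrow> int \<Rightarrow> bool" where
  "generic_split H A B s xu xl xs yu yl ys \<longleftrightarrow>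
     (\<exists>C. \<bar>A\<bar> < \<bar>C\<bar> \<and> \<bar>C\<bar> < \<bar>B\<bar> \<and> xu = upper H A C (- 1) \<and> xl = lower H A C (- 1) \<and> xs = 0 \<and>
        yu = upper H C B s \<and> yl = lower H C B s \<and> ys = 0) \<or>
     (ys = 1 \<or> ys = - 1) \<and> xs = - ys \<and> xu = A \<and> xl = A - H \<and> yu = spin_upper H B s \<and> yl = spin_upper H B s - H"

text \<open>
  The same for \<open>b = spin\<close>. Here \<open>M\<close> is the time of the other index in \<open>{n - 1, n}\<close>, the only
  index at which a split with sign \<open>-1\<close> can occur.
\<close>
definition spin_split :: "int \<Rightarrow> int \<Rightarrow> int \<Rightarrow> int \<Rightarrow> int \<Rightarrow> int \<Rightarrow> int \<Rightarrow> int \<Rightarrow> int \<Rightarrow> int \<Rightarrow> bool" where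
  "spin_split H A M s xu xl xs yu yl ys \<longleftrightarrow> xs = 0 \<and> ys = s \<and>
     ((\<exists>C. \<bar>A\<bar> < \<bar>C\<bar> \<and> \<bar>C\<bar> < \<bar>M\<bar> \<and> xu = upper H A C (- 1) \<and> xl = lower H A C (- 1) \<and> yu = C \<and> yl = C - H) \<or>
      (\<exists>t. (t = 1 \<or> t = - 1) \<and> \<bar>A\<bar> < \<bar>M\<bar> \<and> xu = upper H A M (- t) \<and> xl = lower H A M (- t) \<and> yu = spin_upper H M t \<and> yl = spin_upper H M t - H))"

text \<open>
  If the part \<open>x\<close> containing \<open>\<epsilon>\<^sub>a\<close> is the smaller one, no other splitting lies strictly inside
  this one when large upper coordinates come first; the sign \<open>e\<close> makes \<open>x\<close> the larger of two
  roots with equal coordinates. Once the signs of the times are fixed, all coordinates are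
  linear expressions, and the claim is linear arithmetic. The following lemmas are the
  variants for the other kind of root and, with the roles of \<open>x\<close> and \<open>y\<close> and of the two
  coordinates exchanged, for the other order.
\<close>
lemma generic_split_upper:
  fixes A B N H s :: int
  assumes "\<bar>B\<bar> \<le> N" "2 * N < H" "s = 1 \<or> s = - 1" "\<bar>A\<bar> < \<bar>B\<bar>"
    and d: "generic_split H A B s xu xl xs yu yl ys" and d': "generic_split H A B s vu vl vs zu zl zs"
    and X: "yu \<le> xu" and e: "e = (if xs = - 1 then - 1 else 1)"
  shows "zu \<le> vu \<Longrightarrow> lex3_less (xu, xl, e * xs) (vu, vl, e * vs) \<Longrightarrow> lex3_less (zu, zl, e * zs) (yu, yl, e * ys) \<Longrightarrow> False"
    and "vu \<le> zu \<Longrightarrow> lex3_less (xu, xl, e * xs) (zu, zl, e * zs) \<Longrightarrow> lex3_less (vu, vl, e * vs) (yu, yl, e * ys) \<Longrightarrow> False"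
proof -
  assume O: "zu \<le> vu" and o: "lex3_less (xu, xl, e * xs) (vu, vl, e * vs)" "lex3_less (zu, zl, e * zs) (yu, yl, e * ys)"
  show False using assms(3) d d' unfolding generic_split_def
    apply (elim disjE conjE exE)
    by (cases "B < 0"; use X O o e in \<open>simp add: upper_def lower_def spin_upper_def lex3_less_simp split: if_splits\<close>; use assms(1,2,4) in linarith)+
next
  assume O: "vu \<le> zu" and o: "lex3_less (xu, xl, e * xs) (zu, zl, e * zs)" "lex3_less (vu, vl, e * vs) (yu, yl, e * ys)"
  show False using assms(3) d d' unfolding generic_split_def
    apply (elim disjE conjE exE)
    by (cases "B < 0"; use X O o e in \<open>simp add: upper_def lower_def spin_upper_def lex3_less_simp split: if_splits\<close>; use assms(1,2,4) in linarith)+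
qed

lemma generic_split_lower:
  fixes A B N H s :: int
  assumes "\<bar>B\<bar> \<le> N" "2 * N < H" "s = 1 \<or> s = - 1" "\<bar>A\<bar> < \<bar>B\<bar>"
    and d: "generic_split H A B s xu xl xs yu yl ys" and d': "generic_split H A B s vu vl vs zu zl zs"
    and X: "xl \<le> yl" and e: "e = (if ys = - 1 then - 1 else 1)"
  shows "zl \<le> vl \<Longrightarrow> lex3_less (yl, yu, e * ys) (vl, vu, e * vs) \<Longrightarrow> lex3_less (zl, zu, e * zs) (xl, xu, e * xs) \<Longrightarrow> False"
    and "vl \<le> zl \<Longrightarrow> lex3_less (yl, yu, e * ys) (zl, zu, e * zs) \<Longrightarrow> lex3_less (vl, vu, e * vs) (xl, xu, e * xs) \<Longrightarrow> False"
proof -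
  assume O: "zl \<le> vl" and o: "lex3_less (yl, yu, e * ys) (vl, vu, e * vs)" "lex3_less (zl, zu, e * zs) (xl, xu, e * xs)"
  show False using assms(3) d d' unfolding generic_split_def
    apply (elim disjE conjE exE)
    by (cases "B < 0"; use X O o e in \<open>simp add: upper_def lower_def spin_upper_def lex3_less_simp split: if_splits\<close>; use assms(1,2,4) in linarith)+
next
  assume O: "vl \<le> zl" and o: "lex3_less (yl, yu, e * ys) (zl, zu, e * zs)" "lex3_less (vl, vu, e * vs) (xl, xu, e * xs)"
  show False using assms(3) d d' unfolding generic_split_def
    apply (elim disjE conjE exE)
    by (cases "B < 0"; use X O o e in \<open>simp add: upper_def lower_def spin_upper_def lex3_less_simp split: if_splits\<close>; use assms(1,2,4) in linarith)+
qed

lemma spin_split_upper: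
  fixes A M N H s :: int
  assumes "\<bar>M\<bar> \<le> N" "2 * N < H"
    and d: "spin_split H A M s xu xl xs yu yl ys" and d': "spin_split H A M s vu vl vs zu zl zs"
    and X: "yu \<le> xu" and e: "e = (if xs = - 1 then - 1 else 1)"
  shows "zu \<le> vu \<Longrightarrow> lex3_less (xu, xl, e * xs) (vu, vl, e * vs) \<Longrightarrow> lex3_less (zu, zl, e * zs) (yu, yl, e * ys) \<Longrightarrow> False"
    and "vu \<le> zu \<Longrightarrow> lex3_less (xu, xl, e * xs) (zu, zl, e * zs) \<Longrightarrow> lex3_less (vu, vl, e * vs) (yu, yl, e * ys) \<Longrightarrow> False"
proof -
  assume O: "zu \<le> vu" and o: "lex3_less (xu, xl, e * xs) (vu, vl, e * vs)" "lex3_less (zu, zl, e * zs) (yu, yl, e * ys)"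
  show False using d d' unfolding spin_split_def
    apply (elim disjE conjE exE)
    by (cases "M < 0"; use X O o e in \<open>simp add: upper_def lower_def spin_upper_def lex3_less_simp split: if_splits\<close>; use assms(1,2) in linarith)+
next
  assume O: "vu \<le> zu" and o: "lex3_less (xu, xl, e * xs) (zu, zl, e * zs)" "lex3_less (vu, vl, e * vs) (yu, yl, e * ys)"
  show False using d d' unfolding spin_split_def
    apply (elim disjE conjE exE)
    by (cases "M < 0"; use X O o e in \<open>simp add: upper_def lower_def spin_upper_def lex3_less_simp split: if_splits\<close>; use assms(1,2) in linarith)+
qed

lemma spin_split_lower:
  fixes A M N H s :: int
  assumes "\<bar>M\<bar> \<le> N" "2 * N < H" "s = 1 \<or> s = - 1"
    and d: "spin_split H A M s xu xl xs yu yl ys" and d': "spin_split H A M s vu vl vs zu zl zs"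
    and X: "xl \<le> yl" and e: "e = (if ys = - 1 then - 1 else 1)"
  shows "zl \<le> vl \<Longrightarrow> lex3_less (yl, yu, e * ys) (vl, vu, e * vs) \<Longrightarrow> lex3_less (zl, zu, e * zs) (xl, xu, e * xs) \<Longrightarrow> False"
    and "vl \<le> zl \<Longrightarrow> lex3_less (yl, yu, e * ys) (zl, zu, e * zs) \<Longrightarrow> lex3_less (vl, vu, e * vs) (xl, xu, e * xs) \<Longrightarrow> False"
proof -
  assume O: "zl \<le> vl" and o: "lex3_less (yl, yu, e * ys) (vl, vu, e * vs)" "lex3_less (zl, zu, e * zs) (xl, xu, e * xs)"
  show False using d d' assms(3) unfolding spin_split_def
    apply (elim disjE conjE exE)
    by (cases "M < 0"; use X O o e in \<open>simp add: upper_def lower_def spin_upper_def lex3_less_simp split: if_splits\<close>; use assms(1,2) in linarith)+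
next
  assume O: "vl \<le> zl" and o: "lex3_less (yl, yu, e * ys) (zl, zu, e * zs)" "lex3_less (vl, vu, e * vs) (xl, xu, e * xs)"
  show False using d d' assms(3) unfolding spin_split_def
    apply (elim disjE conjE exE)
    by (cases "M < 0"; use X O o e in \<open>simp add: upper_def lower_def spin_upper_def lex3_less_simp split: if_splits\<close>; use assms(1,2) in linarith)+
qed

section \<open>Splittings of a root and multiplicities\<close>

context dquiver
begin

lemma lex_less_lex3: "lex_less k1 k2 (\<lambda>v. e * k3 v) x y \<longleftrightarrow> lex3_less (k1 x, k2 x, e * k3 x) (k1 y, k2 y, e * k3 y)"
  unfolding lex_less_def lex3_less_simp ..

text \<open>
  Multiplicity-free roots split either at an index between \<open>a\<close> and \<open>b\<close>, or, for \<open>\<epsilon>\<^sub>a +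
  \<epsilon>\<^sub>n\<^sub>-\<^sub>1\<close>, at the index \<open>n\<close> with either sign.
\<close>
definition splitting :: "nat \<Rightarrow> nat \<Rightarrow> int \<Rightarrow> vec \<Rightarrow> vec \<Rightarrow> bool" where
  "splitting a b s p q \<longleftrightarrow>
     (\<exists>c. a < c \<and> c < b \<and> p = pm_root a c (- 1) \<and> q = pm_root c b s) \<or>
     (\<exists>t. (t = 1 \<or> t = - 1) \<and> b = n - 1 \<and> s = 1 \<and> p = pm_root a n (- t) \<and> q = pm_root b n t)"

text \<open>
  The summand with the smaller leading index contains \<open>\<epsilon>\<^sub>a\<close>. What it adds has to be cancelled
  by the other summand; an index beyond \<open>b\<close> is possible only if \<open>\<epsilon>\<^sub>b\<close> is the leading vector of
  the other summand, and multiplicity freeness leaves only \<open>n\<close> there.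
\<close>
lemma splitting_ordered:
  assumes ok: "root_index (a, b, s)" and mf: "s = - 1 \<or> n - 1 \<le> b"
    and x: "root_index (p, q, u)" and y: "root_index (p', q', u')" and less: "p < p'"
    and sum: "pm_root p q u + pm_root p' q' u' = pm_root a b s"
  shows "splitting a b s (pm_root p q u) (pm_root p' q' u')"
proof -
  have e: "pm_root p q u z + pm_root p' q' u' z = pm_root a b s z" for z using fun_cong[OF sum, of z] by (simp add: vec_apply)
  have o: "a < b" "p < q" "p' < q'" "b \<le> n" "q \<le> n" "q' \<le> n" and sgn: "s = 1 \<or> s = - 1" "u = 1 \<or> u = - 1" "u' = 1 \<or> u' = - 1"
    using ok x y unfolding root_index_def prod.case by blast+
  have s0: "s \<noteq> 0" "u \<noteq> 0" "u' \<noteq> 0" using sgn by auto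
  have "p = a"
  proof -
    have "pm_root p q u p + pm_root p' q' u' p = 1" using o less by (simp add: pm_root_apply)
    then have "pm_root a b s p \<noteq> 0" using e[of p] by simp
    then have "p = a \<or> p = b" by (auto simp: pm_root_apply split: if_splits)
    moreover have "p \<noteq> b"
    proof
      assume "p = b"
      then have "pm_root p q u a + pm_root p' q' u' a = 0" using o less by (simp add: pm_root_apply)
      then show False using e[of a] o by (simp add: pm_root_apply)
    qed
    ultimately show ?thesis by blast
  qed
  have r: "pm_root p' q' u' z = (if z = b then s else 0) - (if z = q then u else 0)" for z
    using e[of z] unfolding \<open>p = a\<close> by (simp add: pm_root_apply split: if_splits)
  have p': "(if p' = b then s else 0) - (if p' = q then u else 0) = 1"
    using r[of p'] o by (simp add: pm_root_apply)
  have q': "(if q' = b then s else 0) - (if q' = q then u else 0) = u'"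
    using r[of q'] o by (simp add: pm_root_apply)
  have "q \<noteq> b" using p' sgn by (auto split: if_splits)
  then have "p' = b \<and> s = 1 \<or> p' = q \<and> u = - 1" using p' sgn by (auto split: if_splits)
  then show ?thesis
  proof (elim disjE conjE)
    assume h: "p' = q" "u = - 1"
    then have "q' = b" "u' = s" using q' o s0 by (auto split: if_splits)
    then have "a < q \<and> q < b \<and> pm_root p q u = pm_root a q (- 1) \<and> pm_root p' q' u' = pm_root q b s"
      using h o \<open>p = a\<close> by simp
    then show ?thesis unfolding splitting_def by blast
  next
    assume h: "p' = b" "s = 1"
    then have "q' = q" "u = - u'" using q' o s0 by (auto split: if_splits)
    moreover have "b < q" using h o \<open>q' = q\<close> by simp
    then have "b = n - 1" "q = n" using mf h o by linarith+
    ultimately have "b = n - 1 \<and> s = 1 \<and> pm_root p q u = pm_root a n (- u') \<and> pm_root p' q' u' = pm_root b n u'"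
      using h \<open>p = a\<close> by simp
    then show ?thesis using sgn(3) unfolding splitting_def by blast
  qed
qed

lemma splitting_exists:
  assumes ok: "root_index (a, b, s)" and mf: "s = - 1 \<or> n - 1 \<le> b" and "x \<in> Pos" "y \<in> Pos" "x + y = pm_root a b s"
  shows "splitting a b s x y \<or> splitting a b s y x"
proof -
  obtain p q u where x: "root_index (p, q, u)" "x = pm_root p q u" using assms Pos_index by blast
  obtain p' q' u' where y: "root_index (p', q', u')" "y = pm_root p' q' u'" using assms Pos_index by blast
  have "p \<noteq> p'"
  proof
    assume "p = p'"
    then have "2 = pm_root a b s p" using fun_cong[OF assms(5), of p] x y
      unfolding root_index_def by (simp add: vec_apply pm_root_apply)
    then show False using ok unfolding root_index_def by (auto simp: pm_root_apply split: if_splits)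
  qed
  then consider "p < p'" | "p' < p" by linarith
  then show ?thesis
  proof cases
    case 1
    then show ?thesis using splitting_ordered[OF ok mf x(1) y(1)] assms(5) x(2) y(2) by blast
  next
    case 2
    then show ?thesis using splitting_ordered[OF ok mf y(1) x(1)] assms(5) x(2) y(2) add.commute[of x y] by simp
  qed
qed

lemma coords_pm_root: assumes "root_index (a, b, s)"
  shows "upper_vec (pm_root a b s) = upper_ix (a, b, s)" "lower_vec (pm_root a b s) = lower_ix (a, b, s)" "spin_vec (pm_root a b s) = spin_ix (a, b, s)"
  unfolding upper_vec_def lower_vec_def spin_vec_def index_pm_root[OF assms] by (rule refl)+

lemma coords_generic: assumes "1 \<le> a" "a < b" "b \<le> n" "s = 1 \<or> s = - 1" "a \<noteq> spin" "b \<noteq> spin"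
  shows "upper_vec (pm_root a b s) = upper antiperiod (time a) (time b) s" "lower_vec (pm_root a b s) = lower antiperiod (time a) (time b) s" "spin_vec (pm_root a b s) = 0"
proof -
  have ok: "root_index (a, b, s)" unfolding root_index_def prod.case using assms by blast
  show "upper_vec (pm_root a b s) = upper antiperiod (time a) (time b) s" "lower_vec (pm_root a b s) = lower antiperiod (time a) (time b) s" "spin_vec (pm_root a b s) = 0"
    unfolding coords_pm_root[OF ok] using index_coords_generic[OF assms(5,6)] by blast+
qed

lemma coords_right: assumes "1 \<le> a" "a < spin" "s = 1 \<or> s = - 1"
  shows "upper_vec (pm_root a spin s) = time a" "lower_vec (pm_root a spin s) = time a - antiperiod" "spin_vec (pm_root a spin s) = s"
proof -
  have ok: "root_index (a, spin, s)" unfolding root_index_def prod.case using assms spin_range by blast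
  have v: "spinroot (a, spin, s) a 1 s" by (rule right[OF assms])
  show "upper_vec (pm_root a spin s) = time a" "lower_vec (pm_root a spin s) = time a - antiperiod" "spin_vec (pm_root a spin s) = s"
    unfolding coords_pm_root[OF ok] spinroot_values(1-3)[OF v] spin_upper_def by simp_all
qed

lemma coords_left: assumes "spin < n" "s = 1 \<or> s = - 1"
  shows "upper_vec (pm_root spin n s) = spin_upper antiperiod (time n) s" "lower_vec (pm_root spin n s) = spin_upper antiperiod (time n) s - antiperiod" "spin_vec (pm_root spin n s) = 1"
proof -
  have ok: "root_index (spin, n, s)" unfolding root_index_def prod.case using assms spin_range by blast
  have "spin \<noteq> n" using assms(1) by (rule less_imp_neq)
  then have v: "spinroot (spin, n, s) n s 1" using left assms by blast
  show "upper_vec (pm_root spin n s) = spin_upper antiperiod (time n) s" "lower_vec (pm_root spin n s) = spin_upper antiperiod (time n) s - antiperiod" "spin_vec (pm_root spin n s) = 1"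
    unfolding coords_pm_root[OF ok] by (rule spinroot_values(1-3)[OF v])+
qed

lemma splitting_generic:
  assumes ok: "root_index (a, b, s)" and sp: "splitting a b s p q" and b: "b \<noteq> spin"
  shows "generic_split antiperiod (time a) (time b) s (upper_vec p) (lower_vec p) (spin_vec p) (upper_vec q) (lower_vec q) (spin_vec q)"
proof -
  have o: "1 \<le> a" "a < b" "b \<le> n" "s = 1 \<or> s = - 1" using ok unfolding root_index_def prod.case by blast+
  consider c where "a < c" "c < b" "p = pm_root a c (- 1)" "q = pm_root c b s"
    | t where "t = 1 \<or> t = - 1" "b = n - 1" "s = 1" "p = pm_root a n (- t)" "q = pm_root b n t"
    using sp unfolding splitting_def by blast
  then show ?thesis
  proof cases
    case (1 c)
    have an: "a \<noteq> spin" using spin_first_index[of a c] 1 o by linarith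
    show ?thesis
    proof (cases "c = spin")
      case False
      have "1 \<le> c" "c \<le> n" using 1 o by linarith+
      then show ?thesis unfolding generic_split_def 1(3,4)
        using coords_generic[of a c "- 1"] coords_generic[of c b s] time_less[OF 1(1)] time_less[OF 1(2)] 1(1,2) o an b False by blast
    next
      case True
      have bn: "b = n" using spin_first_index[OF 1(2) o(3) True] .
      have lt: "a < spin" "spin < n" using 1(1,2) unfolding True bn by blast+
      show ?thesis unfolding generic_split_def 1(3,4) unfolding True bn
        using coords_right[OF o(1) lt(1), of "- 1"] coords_left[OF lt(2) o(4)] by simp
    qed
  next
    case (2 t)
    have sn: "spin = n" using spin_cases b 2(2) by metis
    have lt: "a < n" "b < n" using 2(2) o n4 by linarith+
    have t: "- t = 1 \<or> - t = - 1" using 2(1) by auto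
    have b1: "1 \<le> b" using o by linarith
    have "upper_vec p = time a" "lower_vec p = time a - antiperiod" "spin_vec p = - t"
      using coords_right[OF o(1) _ t] lt(1) unfolding sn 2(4) by blast+
    moreover have "upper_vec q = time b" "lower_vec q = time b - antiperiod" "spin_vec q = t"
      using coords_right[OF b1 _ 2(1)] lt(2) unfolding sn 2(5) by blast+
    ultimately show ?thesis using 2(1) unfolding generic_split_def 2(3) by (simp add: spin_upper_def)
  qed
qed

definition mate :: nat where "mate = (if spin = n then n - 1 else n)"

lemma splitting_spin:
  assumes ok: "root_index (a, b, s)" and sp: "splitting a b s p q" and b: "b = spin"
  shows "spin_split antiperiod (time a) (time mate) s (upper_vec p) (lower_vec p) (spin_vec p) (upper_vec q) (lower_vec q) (spin_vec q)"
proof -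
  have o: "1 \<le> a" "a < b" "b \<le> n" "s = 1 \<or> s = - 1" using ok unfolding root_index_def prod.case by blast+
  consider c where "a < c" "c < b" "p = pm_root a c (- 1)" "q = pm_root c b s"
    | t where "t = 1 \<or> t = - 1" "b = n - 1" "s = 1" "p = pm_root a n (- t)" "q = pm_root b n t"
    using sp unfolding splitting_def by blast
  then show ?thesis
  proof cases
    case (1 c)
    have ns: "a \<noteq> spin" "c \<noteq> spin" using 1 o b by linarith+
    have c: "1 \<le> c" "c \<le> n" "c < spin" using 1 o b by linarith+
    note p = coords_generic[OF o(1) 1(1) c(2) _ ns, of "- 1"] and q = coords_right[OF c(1,3) o(4)]
    show ?thesis
    proof (cases "c = mate")
      case True
      show ?thesis unfolding spin_split_def 1(3,4) b using p q time_less[OF 1(1)] unfolding True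
        by (simp add: spin_upper_def)
    next
      case False
      have "c < mate" using False 1(2) b spin_cases n4 unfolding mate_def by (auto split: if_splits)
      then show ?thesis unfolding spin_split_def 1(3,4) b using p q time_less[OF 1(1)] time_less[of c mate] by blast
    qed
  next
    case (2 t)
    have lt: "spin < n" using 2(2) b n4 by linarith
    then have mn: "mate = n" unfolding mate_def by simp
    have t: "- t = 1 \<or> - t = - 1" using 2(1) by auto
    have an: "a < n" "a \<noteq> spin" "n \<noteq> spin" using lt o b by linarith+
    have "upper_vec p = upper antiperiod (time a) (time n) (- t)" "lower_vec p = lower antiperiod (time a) (time n) (- t)" "spin_vec p = 0"
      using coords_generic[OF o(1) an(1) le_refl t an(2,3)] unfolding 2(4) by blast+
    moreover have "upper_vec q = spin_upper antiperiod (time n) t" "lower_vec q = spin_upper antiperiod (time n) t - antiperiod" "spin_vec q = 1"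
      using coords_left[OF lt 2(1)] unfolding 2(5) b by blast+
    moreover have "\<bar>time a\<bar> < \<bar>time n\<bar>" using time_less[OF an(1)] .
    ultimately show ?thesis using 2(1) unfolding spin_split_def 2(3) mn by blast
  qed
qed

lemma simple_telescope: "a \<le> b \<Longrightarrow> b \<le> n \<Longrightarrow> pm_root a b (- 1) = (\<Sum>i\<in>{a..<b}. \<alpha> i)"
proof (induction b rule: dec_induct)
  case base
  then show ?case by (auto simp: fun_eq_iff vec_apply pm_root_apply)
next
  case (step b)
  have "b < n" using step by simp
  then have "pm_root a (Suc b) (- 1) = pm_root a b (- 1) + \<alpha> b"
    by (simp add: simple_pm_root(1) fun_eq_iff vec_apply pm_root_apply)
  then show ?case using step by simp
qed

lemma sum_fun_apply: "(\<Sum>i\<in>A. h i) x = (\<Sum>i\<in>A. h i x :: int)"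
  by (induction A rule: infinite_finite_induct) (auto simp: vec_apply)

lemma mult_free_sum: assumes "S \<subseteq> {1..n}" shows "multiplicity_free n (\<Sum>i\<in>S. \<alpha> i)"
  unfolding multiplicity_free_def
proof (intro exI conjI)
  show "(\<Sum>i\<in>S. \<alpha> i) = (\<lambda>x. \<Sum>i\<in>{1..n}. int (if i \<in> S then 1 else 0) * \<alpha> i x)"
  proof
    fix x
    have "(\<Sum>i\<in>{1..n}. int (if i \<in> S then 1 else 0) * \<alpha> i x) = (\<Sum>i\<in>{1..n}. if i \<in> S then \<alpha> i x else 0)"
      by (intro sum.cong refl) simp
    also have "\<dots> = (\<Sum>i\<in>{1..n} \<inter> S. \<alpha> i x)" by (simp add: sum.inter_restrict)
    also have "{1..n} \<inter> S = S" using assms by blast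
    finally show "(\<Sum>i\<in>S. \<alpha> i) x = (\<Sum>i\<in>{1..n}. int (if i \<in> S then 1 else 0) * \<alpha> i x)"
      unfolding sum_fun_apply by simp
  qed
qed simp

text \<open>
  For \<open>s = 1\<close> and \<open>b \<le> n - 2\<close> the coefficient of \<open>\<alpha>\<^sub>b\<close>, which is the sum of the first \<open>b\<close>
  coordinates, is \<open>2\<close>. All other roots are sums of distinct simple roots.
\<close>
lemma mult_free_iff: assumes "root_index (a, b, s)"
  shows "multiplicity_free n (pm_root a b s) \<longleftrightarrow> s = - 1 \<or> n - 1 \<le> b"
proof
  have o: "1 \<le> a" "a < b" "b \<le> n" "s = 1 \<or> s = - 1" using assms unfolding root_index_def prod.case by blast+
  assume "multiplicity_free n (pm_root a b s)"
  then obtain c :: "nat \<Rightarrow> nat" where c: "pm_root a b s = (\<lambda>x. \<Sum>i\<in>{1..n}. int (c i) * \<alpha> i x)" "\<forall>i\<in>{1..n}. c i \<le> 1"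
    unfolding multiplicity_free_def by blast
  show "s = - 1 \<or> n - 1 \<le> b"
  proof (rule ccontr)
    assume "\<not> ?thesis"
    then have s: "s = 1" and b: "b < n - 1" using o by auto
    have pre: "(\<Sum>x\<in>{1..b}. \<alpha> i x) = (if i = b then 1 else 0)" if i: "i \<in> {1..n}" for i
    proof (cases "i = n")
      case True
      have "(\<Sum>x\<in>{1..b}. \<alpha> i x) = 0" unfolding True simple_pm_root(2) using b by (intro sum.neutral) (auto simp: pm_root_apply)
      then show ?thesis using True b by simp
    next
      case False
      then have "i < n" using i by simp
      have "(\<Sum>x\<in>{1..b}. \<alpha> i x) = (\<Sum>x\<in>{1..b}. (if x = i then 1 else 0) + (if x = i + 1 then - 1 else 0))"
        unfolding simple_pm_root(1)[OF \<open>i < n\<close>] by (intro sum.cong refl) (simp add: pm_root_apply)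
      also have "\<dots> = (if i \<in> {1..b} then 1 else 0) + (if i + 1 \<in> {1..b} then - 1 else 0)"
        unfolding sum.distrib by simp
      also have "\<dots> = (if i = b then 1 else 0)" using i by auto
      finally show ?thesis .
    qed
    have "(\<Sum>x\<in>{1..b}. pm_root a b s x) = (\<Sum>x\<in>{1..b}. (if x = a then 1 else 0) + (if x = b then 1 else 0))"
      unfolding s by (intro sum.cong refl) (simp add: pm_root_apply)
    also have "\<dots> = 2" unfolding sum.distrib using o by simp
    finally have "2 = (\<Sum>x\<in>{1..b}. \<Sum>i\<in>{1..n}. int (c i) * \<alpha> i x)" unfolding c(1) by simp
    also have "\<dots> = (\<Sum>i\<in>{1..n}. int (c i) * (\<Sum>x\<in>{1..b}. \<alpha> i x))"
      unfolding sum_distrib_left by (rule sum.swap)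
    also have "\<dots> = (\<Sum>i\<in>{1..n}. if i = b then int (c i) else 0)"
      by (intro sum.cong refl) (subst pre, simp_all)
    also have "\<dots> = int (c b)" using o by simp
    finally have "2 = int (c b)" .
    moreover have "c b \<le> 1" using c(2) o by simp
    ultimately show False by simp
  qed
next
  have o: "1 \<le> a" "a < b" "b \<le> n" "s = 1 \<or> s = - 1" using assms unfolding root_index_def prod.case by blast+
  assume "s = - 1 \<or> n - 1 \<le> b"
  then consider "s = - 1" | "s = 1" "b = n" | "s = 1" "b = n - 1" using o by linarith
  then show "multiplicity_free n (pm_root a b s)"
  proof cases
    case 1
    then have "pm_root a b s = (\<Sum>i\<in>{a..<b}. \<alpha> i)" using simple_telescope[of a b] o by simp
    then have e: "pm_root a b s = (\<Sum>i\<in>{a..<b}. \<alpha> i)" .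
    have "{a..<b} \<subseteq> {1..n}" using o n4 by auto
    then show ?thesis unfolding e by (rule mult_free_sum)
  next
    case 2
    have "pm_root a b s = pm_root a (n - 1) (- 1) + \<alpha> n" unfolding simple_pm_root(2) 2 by (auto simp: fun_eq_iff vec_apply pm_root_apply)
    also have "\<dots> = (\<Sum>i\<in>insert n {a..<n - 1}. \<alpha> i)" using simple_telescope[of a "n - 1"] o 2 by (simp add: add.commute)
    finally have e: "pm_root a b s = (\<Sum>i\<in>insert n {a..<n - 1}. \<alpha> i)" .
    have "insert n {a..<n - 1} \<subseteq> {1..n}" using o n4 by auto
    then show ?thesis unfolding e by (rule mult_free_sum)
  next
    case 3
    have "pm_root a b s = pm_root a n (- 1) + \<alpha> n" unfolding simple_pm_root(2) 3 by (auto simp: fun_eq_iff vec_apply pm_root_apply)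
    also have "\<dots> = (\<Sum>i\<in>insert n {a..<n}. \<alpha> i)" using simple_telescope[of a n] o by (simp add: add.commute)
    finally have e: "pm_root a b s = (\<Sum>i\<in>insert n {a..<n}. \<alpha> i)" .
    have "insert n {a..<n} \<subseteq> {1..n}" using o n4 by auto
    then show ?thesis unfolding e by (rule mult_free_sum)
  qed
qed

end

section \<open>Minimal and non-minimal pairs\<close>

context ar
begin

lemma precI: assumes "hom\<^sup>*\<^sup>* x y" "x \<in> Pos" "x \<noteq> y" shows "prec n Q \<xi> w y x"
  using prec_iff assms by blast

text \<open>
  Since \<open>m\<close> is larger than \<open>a\<close> and \<open>b\<close>, its time lies on the same side of both of theirs. With
  \<open>l\<close> the earlier and \<open>h\<close> the later one of \<open>a\<close> and \<open>b\<close>, and \<open>t\<close> chosen by that side, the form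
  takes the value \<open>2\<close> at each step of the chain from \<open>\<epsilon>\<^sub>l + t\<epsilon>\<^sub>m\<close> to \<open>\<epsilon>\<^sub>h - t\<epsilon>\<^sub>m\<close>.
\<close>
lemma crossing_pairs:
  assumes ok: "root_index (a, b, 1)" and b: "b < n - 1"
  obtains x y x' y' where "pair_of n Q \<xi> w (pm_root a b 1) (x, y)" "pair_of n Q \<xi> w (pm_root a b 1) (x', y')"
    "prec n Q \<xi> w x x'" "prec n Q \<xi> w x' (pm_root a b 1)" "prec n Q \<xi> w (pm_root a b 1) y'" "prec n Q \<xi> w y' y"
proof -
  have o: "1 \<le> a" "a < b" using ok unfolding root_index_def prod.case by blast+
  define l h where "l = (if time b < time a then b else a)" and "h = (if time b < time a then a else b)"
  have lh: "l \<noteq> h" "1 \<le> l" "l < n - 1" "1 \<le> h" "h < n - 1" using o b unfolding l_def h_def by auto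
  have "time a \<noteq> time b" using time_inj o by blast
  then have tlh: "time l < time h" unfolding l_def h_def by auto
  have g: "pm_root a b 1 = pm_root l h 1" unfolding l_def h_def by (auto simp: fun_eq_iff pm_root_apply)
  define m where "m = mate"
  have m: "n - 1 \<le> m" "m \<le> n" "m \<noteq> spin" using spin_cases n4 unfolding m_def mate_def by auto
  have ns: "l \<noteq> spin" "h \<noteq> spin" using lh spin_cases by linarith+
  have lm: "l < m" "h < m" using lh m by linarith+
  define t where "t = orient m"
  have t: "t = 1 \<or> t = - 1" "- t = 1 \<or> - t = - 1" "t * t = 1" using orient_cases[of m] unfolding t_def by auto
  have v: "euler2_eps l h = 1" "euler2_eps h l = - 1" "euler2_eps l m = - t" "euler2_eps m l = t" "euler2_eps h m = - t" "euler2_eps m h = t"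
    using euler2_eps_less[OF lm(1)] euler2_eps_less[OF lm(2)] ns m(3) lh(1) tlh unfolding t_def euler2_eps_def[of l h] euler2_eps_def[of h l] by simp_all
  have r: "l \<in> {1..n}" "h \<in> {1..n}" "m \<in> {1..n}" using lh lm m by simp_all
  have okx: "root_index (l, m, u)" "root_index (h, m, u)" if "u = 1 \<or> u = - 1" for u
    using that lh lm m unfolding root_index_def prod.case by blast+
  let ?B = "pm_root l m t" and ?B' = "pm_root h m t" and ?g = "pm_root l h 1" and ?A' = "pm_root l m (- t)" and ?A = "pm_root h m (- t)"
  have gP: "?g \<in> Pos" using ok unfolding g[symmetric] Pos_index by blast
  have P: "?B \<in> Pos" "?B' \<in> Pos" "?A' \<in> Pos" "?A \<in> Pos" unfolding Pos_index using okx t by blast+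
  have h1: "hom ?B ?B'" unfolding hom_def using P t(3) v by (simp add: euler2_pm_root[OF r(1,3) r(2,3)])
  have h2: "hom ?B' ?g" unfolding hom_def using P gP t(3) v by (simp add: euler2_pm_root[OF r(2,3) r(1,2)])
  have h3: "hom ?g ?A'" unfolding hom_def using P gP t(3) v by (simp add: euler2_pm_root[OF r(1,2) r(1,3)])
  have h4: "hom ?A' ?A" unfolding hom_def using P t(3) v by (simp add: euler2_pm_root[OF r(1,3) r(2,3)])
  have ne: "?B \<noteq> ?B'" "?A' \<noteq> ?A" "?B' \<noteq> ?A'" "?B \<noteq> ?A"
    using pm_root_inj[OF okx(1)[OF t(1)] okx(2)[OF t(1)]] pm_root_inj[OF okx(1)[OF t(2)] okx(2)[OF t(2)]]
      pm_root_inj[OF okx(2)[OF t(1)] okx(1)[OF t(2)]] pm_root_inj[OF okx(1)[OF t(1)] okx(2)[OF t(2)]] lh(1) by blast+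
  have "?B' m \<noteq> ?g m" "?g m \<noteq> ?A' m" using t lm by (auto simp: pm_root_apply)
  then have ng: "?B' \<noteq> ?g" "?g \<noteq> ?A'" by metis+
  have p: "prec n Q \<xi> w ?B' ?B" "prec n Q \<xi> w ?g ?B'" "prec n Q \<xi> w ?A' ?g" "prec n Q \<xi> w ?A ?A'"
    using precI[OF r_into_rtranclp[of hom, OF h1] P(1) ne(1)] precI[OF r_into_rtranclp[of hom, OF h2] P(2) ng(1)]
      precI[OF r_into_rtranclp[of hom, OF h3] gP ng(2)] precI[OF r_into_rtranclp[of hom, OF h4] P(3) ne(2)] by blast+
  have c': "hom\<^sup>*\<^sup>* ?B' ?A'" using h2 h3 by (meson rtranclp.rtrancl_into_rtrancl rtranclp.rtrancl_refl)
  then have c: "hom\<^sup>*\<^sup>* ?B ?A" using h1 h4 by (meson rtranclp.rtrancl_into_rtrancl converse_rtranclp_into_rtranclp)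
  have s: "?A + ?B = ?g" "?A' + ?B' = ?g" by (auto simp: fun_eq_iff vec_apply pm_root_apply)
  have "pair_of n Q \<xi> w ?g (?A, ?B)" "pair_of n Q \<xi> w ?g (?A', ?B')"
    unfolding pair_of_def prod.case using P s precI[OF c P(1) ne(4)] precI[OF c' P(2) ne(3)] by blast+
  then show ?thesis using that p unfolding g by blast
qed

text \<open>
  The order depends on which part of the splitting is the smaller one, and its tie-breaking
  sign on the smaller part.
\<close>
lemma minimal_order:
  assumes ok: "root_index (a, b, s)" and mf: "s = - 1 \<or> n - 1 \<le> b" and pair: "pair_of n Q \<xi> w (pm_root a b s) (x, y)"
  shows "\<exists>r. compatible_order n Q \<xi> w r \<and> minimal_pair n Q \<xi> w r (pm_root a b s) (x, y)"
proof -
  have o: "1 \<le> a" "a < b" "b \<le> n" "s = 1 \<or> s = - 1" using ok unfolding root_index_def prod.case by blast+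
  have N: "2 * int n < antiperiod" by simp
  have m: "mate \<le> n" unfolding mate_def by simp
  have pd: "x \<in> Pos \<and> y \<in> Pos \<and> upper_vec y \<le> upper_vec x \<and> lower_vec y \<le> lower_vec x \<and> (splitting a b s x y \<or> splitting a b s y x)"
    if "pair_of n Q \<xi> w (pm_root a b s) (x, y)" for x y
  proof -
    have h: "x \<in> Pos" "y \<in> Pos" "x + y = pm_root a b s" "prec n Q \<xi> w x y"
      using that unfolding pair_of_def prod.case by blast+
    then show ?thesis using prec_mono[OF h(4,2)] splitting_exists[OF ok mf h(1-3)] by blast
  qed
  note xy = pd[OF pair]
  show ?thesis
  proof (cases "splitting a b s x y")
    case True
    define e where "e = (if spin_vec x = - 1 then - 1 else (1::int))"
    let ?r = "order_by (lex_less upper_vec lower_vec (\<lambda>v. e * spin_vec v))"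
    have "compatible_order n Q \<xi> w ?r" by (rule compatible_upper) (simp add: e_def)
    moreover have False if p': "pair_of n Q \<xi> w (pm_root a b s) (x', y')" and r: "(x, x') \<in> ?r" "(y', y) \<in> ?r" for x' y'
    proof -
      note q = pd[OF p']
      have l: "lex3_less (upper_vec x, lower_vec x, e * spin_vec x) (upper_vec x', lower_vec x', e * spin_vec x')" "lex3_less (upper_vec y', lower_vec y', e * spin_vec y') (upper_vec y, lower_vec y, e * spin_vec y)"
        using r unfolding order_by_def lex_less_lex3 by blast+
      show False
      proof (cases "b = spin")
        case False
        note D = splitting_generic[OF ok _ False]
        note R = generic_split_upper[OF time_bound[OF o(3)] N o(4) time_less[OF o(2)] D[OF True] D, OF _ _ e_def]
        show False using q l R xy by blast
      next
        case sp: True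
        note D = splitting_spin[OF ok _ sp]
        note R = spin_split_upper[OF time_bound[OF m] N D[OF True] D, OF _ _ e_def]
        show False using q l R xy by blast
      qed
    qed
    ultimately show ?thesis unfolding minimal_pair_def prod.case using pair by blast
  next
    case False
    then have True: "splitting a b s y x" using xy by blast
    define e where "e = (if spin_vec x = - 1 then - 1 else (1::int))"
    let ?r = "order_by (lex_less lower_vec upper_vec (\<lambda>v. e * spin_vec v))"
    have "compatible_order n Q \<xi> w ?r" by (rule compatible_lower) (simp add: e_def)
    moreover have False if p': "pair_of n Q \<xi> w (pm_root a b s) (x', y')" and r: "(x, x') \<in> ?r" "(y', y) \<in> ?r" for x' y'
    proof -
      note q = pd[OF p']
      have l: "lex3_less (lower_vec x, upper_vec x, e * spin_vec x) (lower_vec x', upper_vec x', e * spin_vec x')" "lex3_less (lower_vec y', upper_vec y', e * spin_vec y') (lower_vec y, upper_vec y, e * spin_vec y)"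
        using r unfolding order_by_def lex_less_lex3 by blast+
      show False
      proof (cases "b = spin")
        case False
        note D = splitting_generic[OF ok _ False]
        note R = generic_split_lower[OF time_bound[OF o(3)] N o(4) time_less[OF o(2)] D[OF True] D, OF _ _ e_def]
        show False using q l R xy by blast
      next
        case sp: True
        note D = splitting_spin[OF ok _ sp]
        note R = spin_split_lower[OF time_bound[OF m] N o(4) D[OF True] D, OF _ _ e_def]
        show False using q l R xy by blast
      qed
    qed
    ultimately show ?thesis unfolding minimal_pair_def prod.case using pair by blast
  qed
qed

end

theorem mainTheorem1:
  fixes n :: nat and Q :: quiver and \<xi> :: "nat \<Rightarrow> int" and w :: "nat list" and \<gamma> :: vec
  assumes "n \<ge> 4"
    and "dynkin_quiver n Q"
    and "height_function Q \<xi>"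
    and "adapted_word n Q w"
    and "\<gamma> \<in> positive_roots n"
    and "\<gamma> \<notin> simple_root n ` {1..n}"
  shows "(\<forall>\<alpha> \<beta>. pair_of n Q \<xi> w \<gamma> (\<alpha>, \<beta>) \<longrightarrow>
            (\<exists>r. compatible_order n Q \<xi> w r \<and> minimal_pair n Q \<xi> w r \<gamma> (\<alpha>, \<beta>)))
         \<longleftrightarrow> multiplicity_free n \<gamma>"
proof -
  interpret ar n Q \<xi> w by unfold_locales (use assms in auto)
  obtain a b s where ok: "root_index (a, b, s)" and \<gamma>: "\<gamma> = pm_root a b s" using assms(5) Pos_index by blast
  show ?thesis
  proof
    assume all: "\<forall>\<alpha> \<beta>. pair_of n Q \<xi> w \<gamma> (\<alpha>, \<beta>) \<longrightarrow>
      (\<exists>r. compatible_order n Q \<xi> w r \<and> minimal_pair n Q \<xi> w r \<gamma> (\<alpha>, \<beta>))"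
    show "multiplicity_free n \<gamma>"
    proof (rule ccontr)
      assume "\<not> ?thesis"
      then have "s \<noteq> - 1" and b: "b < n - 1" unfolding \<gamma> mult_free_iff[OF ok] by auto
      then have s: "s = 1" using ok unfolding root_index_def by auto
      obtain x y x' y' where p: "pair_of n Q \<xi> w \<gamma> (x, y)" "pair_of n Q \<xi> w \<gamma> (x', y')"
        and c: "prec n Q \<xi> w x x'" "prec n Q \<xi> w x' \<gamma>" "prec n Q \<xi> w \<gamma> y'" "prec n Q \<xi> w y' y"
        using crossing_pairs[OF ok[unfolded s] b] unfolding \<gamma> s by blast
      obtain r where r: "compatible_order n Q \<xi> w r" "minimal_pair n Q \<xi> w r \<gamma> (x, y)" using all p(1) by blast
      have P: "x \<in> positive_roots n" "y \<in> positive_roots n" "x' \<in> positive_roots n" "y' \<in> positive_roots n"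
        using p unfolding pair_of_def by blast+
      have "(x, x') \<in> r" "(x', \<gamma>) \<in> r" "(\<gamma>, y') \<in> r" "(y', y) \<in> r"
        using r(1) c P assms(5) unfolding compatible_order_def by blast+
      then show False using r(2) p(2) unfolding minimal_pair_def by blast
    qed
  next
    assume "multiplicity_free n \<gamma>"
    then show "\<forall>\<alpha> \<beta>. pair_of n Q \<xi> w \<gamma> (\<alpha>, \<beta>) \<longrightarrow>
      (\<exists>r. compatible_order n Q \<xi> w r \<and> minimal_pair n Q \<xi> w r \<gamma> (\<alpha>, \<beta>))"
      using minimal_order[OF ok] unfolding \<gamma> mult_free_iff[OF ok] by blast
  qed
qed

end
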